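(* Let $p$ be a prime, $\chi$ a non-trivial multiplicative character modulo $p$, and for $A,B,C,D\subset\mathbb{F}_p$ let \[H_\chi(A,B,C,D)=\sum_{a\in A}\sum_{b\in B}\sum_{c\in C}\sum_{d\in D}\chi(a+b+cd).\] (i) Suppose $A,B,C,D\subset \mathbb{F}_p$ are sets with $|A|,|B|,|C|,|D|>p^\delta$, $|C|<\sqrt p$ and $|D|^4|A|^{56}|B|^{28}|C|^{33}\geq p^{60+\varepsilon}$ for some $\delta,\varepsilon>0$. Then there is a constant $\tau>0$ depending only on $\delta$ and $\varepsilon$ such that \[|H_\chi(A,B,C,D)|\ll |A||B||C||D|p^{-\tau}.\] (ii) Suppose $A,B,C,D\subset\mathbb{F}_p$ are sets with $|A|,|B|,|D|>p^\delta$, $|C|\geq \sqrt p$ and $|D|^8|A|^{112}|B|^{56}\geq p^{87+\varepsilon}$ for some $\delta,\varepsilon>0$. Then there is a constant $\tau>0$ depending only on $\delta$ and $\varepsilon$ such that \[|H_\chi(A,B,C,D)|\ll |A||B||C||D|p^{-\tau}.\]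
   Context: $\mathbb{F}_p$ denotes the field with $p$ elements. A multiplicative character modulo $p$ is a homomorphism $\chi:\mathbb{F}_p^\times\to\mathbb{C}^\times$ extended by $\chi(0)=0$; non-trivial means not identically $1$ on $\mathbb{F}_p^\times$. $X\ll Y$ means $|X|\le cY$ for a constant $c$ (which may depend on $\delta,\varepsilon$ but not on $p$ or the sets). *)

theory Defs
  imports "HOL-Analysis.Analysis" "HOL-Number_Theory.Residues"
begin

definition complex_units :: "complex monoid" where
  "complex_units = \<lparr>carrier = UNIV - {0}, monoid.mult = (*), one = 1\<rparr>"

(* The field with p elements is residue_ring (int p), with carrier {0..int p - 1}.
   A character is a function on int whose values outside this carrier are irrelevant:
   it is only ever evaluated on the carrier. *)
definition mult_character :: "nat \<Rightarrow> (int \<Rightarrow> complex) \<Rightarrow> bool" where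
  "mult_character p chi \<longleftrightarrow>
     chi \<in> hom (mult_of (residue_ring (int p))) complex_units \<and>
     chi \<zero>\<^bsub>residue_ring (int p)\<^esub> = 0"

definition nontrivial_mult_character :: "nat \<Rightarrow> (int \<Rightarrow> complex) \<Rightarrow> bool" where
  "nontrivial_mult_character p chi \<longleftrightarrow>
     mult_character p chi \<and> (\<exists>x \<in> carrier (mult_of (residue_ring (int p))). chi x \<noteq> 1)"

definition H_sum ::
  "nat \<Rightarrow> (int \<Rightarrow> complex) \<Rightarrow> int set \<Rightarrow> int set \<Rightarrow> int set \<Rightarrow> int set \<Rightarrow> complex" where
  "H_sum p chi A B C D =
     (\<Sum>a\<in>A. \<Sum>b\<in>B. \<Sum>c\<in>C. \<Sum>d\<in>D.
        chi (a \<oplus>\<^bsub>residue_ring (int p)\<^esub> b \<oplus>\<^bsub>residue_ring (int p)\<^esub> (c \<otimes>\<^bsub>residue_ring (int p)\<^esub> d)))"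

end

theory Submission
  imports Defs
begin

text \<open>
  The only analytic input is the second moment of the character sum over shifts of \<open>A\<close>; the rest is
  combinatorial. If the sum over \<open>Y \<subseteq> C\<close> (with \<open>A\<close>, \<open>B\<close>, \<open>D\<close> fixed) is at least \<open>\<theta>\<close> times the trivial
  bound, then Cauchy-Schwarz over \<open>A\<close> with \<open>d\<close> fixed gives a dilate of \<open>Y\<close> with large additive energy
  with \<open>B\<close>, while with \<open>b\<close> fixed it gives large multiplicative energy of \<open>Y\<close> itself. By the
  Balog-Szemeredi-Gowers argument, the first property yields a large piece of \<open>Y\<close> with a small
  difference set; removing such pieces greedily produces one, \<open>X\<close>, over which the sum is still
  large, so that \<open>X\<close> has large multiplicative energy as well. A set of size at most \<open>\<surd>p\<close> in a prime
  field cannot have both properties, and keeping track of the exponents gives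
  \<open>\<theta>\<^sup>1\<^sup>4\<^sup>1 |A|\<^sup>5\<^sup>7 |B|\<^sup>2\<^sup>7 |C|\<^sup>2\<^sup>7 |D|\<^sup>4 \<lless> p\<^sup>5\<^sup>7\<close>. In (i) this is compared with the hypothesis through
  \<open>|C|\<^sup>6 \<le> p\<^sup>3\<close>; in (ii) \<open>C\<close> is first replaced by a subset of size about \<open>\<surd>p\<close> on which the sum has the
  same density.
\<close>


subsection \<open>Sumsets and dilates\<close>

text \<open>Cardinalities of difference sets do not change under dilation by a unit, so the
  \<open>d\<close> found by pigeonholing can be forgotten once a piece has been cut out of
  \<open>Y\<close>. The incompatibility is quantitative: |X - X| \<le> K |X| and |X|^2 \<le> p force
  E^4 \<le> 162 K^11 |X|^11 for the multiplicative energy E of X. The condition |X|^2 \<le> p comes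
  from the pivot argument and explains the case distinction at \<surd>p. Into this go K = 512 p^2 /
  (\<theta>^4 |A|^2 |X|^2), E \<ge> \<theta>^4 |A|^2 |X|^4 |D| / p^2 and |X| \<ge> \<theta>^3 |A|
  |B| |C| / (8 p); eliminating E, K and |X| produces p to the power 8 + 22 + 27 = 57 and \<theta> to
  the power 16 + 44 + 81 = 141. The sum is symmetric in A and B while the resulting inequality is
  not; giving the larger set the exponent 57 yields the exponents 56 and 28 of the theorem. Zero has
  to be removed from C and D, because dilation by 0 is not injective. This costs |A||B|(|C| + |D|),
  which the lower bounds on |C| and |D| absorb.\<close>

locale prime_modulus =
  fixes p :: int
  assumes prime_p: "prime p"
begin

abbreviation F :: "int set" where "F \<equiv> {0..<p}"

definition sumset :: "int set \<Rightarrow> int set \<Rightarrow> int set" (infixl "\<boxplus>" 66) where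
  "U \<boxplus> V = (\<lambda>(u, v). (u + v) mod p) ` (U \<times> V)"

text \<open>The case \<open>c = -1\<close> is negation, so the difference set of \<open>X\<close>
  appears throughout as \<open>X \<boxplus> -1 \<star> X\<close>.\<close>

definition dil :: "int \<Rightarrow> int set \<Rightarrow> int set" (infixr "\<star>" 75) where
  "c \<star> U = (\<lambda>u. c * u mod p) ` U"

lemma p_pos [simp]: "0 < p" and p_gt_1: "1 < p"
  using prime_gt_1_int[OF prime_p] by auto

lemma mod_F [simp]: "x mod p \<in> F"
  by simp

lemma F_mod: "x \<in> F \<Longrightarrow> x mod p = x"
  by simp

lemma finite_F_subset: "U \<subseteq> F \<Longrightarrow> finite U"
  by (rule finite_subset) auto

lemma sumset_F [simp]: "U \<boxplus> V \<subseteq> F"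
  by (auto simp: sumset_def)

lemma dil_F [simp]: "c \<star> U \<subseteq> F"
  by (auto simp: dil_def)

lemma finite_sumset [simp]: "finite (U \<boxplus> V)" and finite_dil [simp]: "finite (c \<star> U)"
  by (rule finite_F_subset, simp)+

lemma sumset_iff: "x \<in> U \<boxplus> V \<longleftrightarrow> (\<exists>u\<in>U. \<exists>v\<in>V. x = (u + v) mod p)"
  by (auto simp: sumset_def)

lemma dil_iff: "x \<in> c \<star> U \<longleftrightarrow> (\<exists>u\<in>U. x = c * u mod p)"
  by (auto simp: dil_def)

lemma sumsetI: "u \<in> U \<Longrightarrow> v \<in> V \<Longrightarrow> (u + v) mod p \<in> U \<boxplus> V"
  by (auto simp: sumset_iff)

lemma dilI: "u \<in> U \<Longrightarrow> c * u mod p \<in> c \<star> U"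
  by (auto simp: dil_iff)

lemma sumset_mono: "U \<subseteq> U' \<Longrightarrow> V \<subseteq> V' \<Longrightarrow> U \<boxplus> V \<subseteq> U' \<boxplus> V'"
  by (auto simp: sumset_def)

lemma dil_mono: "U \<subseteq> U' \<Longrightarrow> c \<star> U \<subseteq> c \<star> U'"
  by (auto simp: dil_def)

lemma bex_sumset: "(\<exists>x\<in>U \<boxplus> V. P x) \<longleftrightarrow> (\<exists>u\<in>U. \<exists>v\<in>V. P ((u + v) mod p))"
  by (auto simp: sumset_def)

lemma bex_dil: "(\<exists>x\<in>c \<star> U. P x) \<longleftrightarrow> (\<exists>u\<in>U. P (c * u mod p))"
  by (auto simp: dil_def)

lemma sumset_commute: "U \<boxplus> V = V \<boxplus> U"
proof -
  have "U \<boxplus> V \<subseteq> V \<boxplus> U" for U V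
  proof
    fix x assume "x \<in> U \<boxplus> V"
    then obtain u v where "u \<in> U" "v \<in> V" "x = (v + u) mod p"
      by (auto simp: sumset_iff add.commute)
    then show "x \<in> V \<boxplus> U" by (simp add: sumsetI)
  qed
  then show ?thesis by blast
qed

lemma sumset_assoc: "U \<boxplus> V \<boxplus> W = U \<boxplus> (V \<boxplus> W)"
  by (rule Set.set_eqI) (simp add: sumset_iff bex_sumset mod_simps add.assoc)

lemma sumset_left_commute: "U \<boxplus> (V \<boxplus> W) = V \<boxplus> (U \<boxplus> W)"
  by (metis sumset_assoc sumset_commute)

lemmas sumset_ac = sumset_assoc sumset_commute sumset_left_commute

lemma dil_dil: "c \<star> d \<star> U = (c * d) \<star> U"
  by (rule Set.set_eqI) (simp add: dil_iff bex_dil mod_simps mult.assoc)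

lemma dil_cong: "[c = d] (mod p) \<Longrightarrow> c \<star> U = d \<star> U"
  unfolding dil_def by (rule image_cong) (auto simp: cong_def intro: mod_mult_cong)

lemma dil_one: "U \<subseteq> F \<Longrightarrow> 1 \<star> U = U"
  by (force simp: dil_def image_def)

lemma dil_sumset: "c \<star> (U \<boxplus> V) = c \<star> U \<boxplus> c \<star> V"
  by (rule Set.set_eqI) (simp add: dil_iff sumset_iff bex_dil bex_sumset mod_simps distrib_left)

text \<open>Only an inclusion: on the left both summands come from the same \<open>u\<close>, on the
  right they vary independently. It splits a dilate by a difference \<open>a - a'\<close> into two
  dilates.\<close>

lemma dil_add_subset: "(c + d) \<star> U \<subseteq> c \<star> U \<boxplus> d \<star> U"
proof
  fix x assume "x \<in> (c + d) \<star> U"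
  then obtain u where "u \<in> U" "x = (c * u mod p + d * u mod p) mod p"
    by (auto simp: dil_iff mod_simps distrib_right)
  then show "x \<in> c \<star> U \<boxplus> d \<star> U" by (simp add: sumsetI dilI)
qed

lemma mult_cancel_F:
  assumes "\<not> p dvd c" "x \<in> F" "y \<in> F" "c * x mod p = c * y mod p"
  shows "x = y"
proof -
  have "p dvd c * (x - y)" using assms(4) by (simp add: mod_eq_dvd_iff right_diff_distrib)
  then have "p dvd x - y" using assms(1) prime_p prime_dvd_mult_iff by blast
  then show ?thesis using assms(2,3) by (simp add: mod_eq_dvd_iff [symmetric])
qed

lemma card_dil:
  assumes "\<not> p dvd c" "U \<subseteq> F"
  shows "card (c \<star> U) = card U"
  unfolding dil_def
proof (rule card_image, rule inj_onI)
  fix x y assume "x \<in> U" "y \<in> U" "c * x mod p = c * y mod p"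
  with assms show "x = y" by (blast intro: mult_cancel_F)
qed

lemma add_cancel_F:
  assumes "x \<in> F" "y \<in> F" "(c + x) mod p = (c + y) mod p"
  shows "x = y"
proof -
  have "((c + x) mod p - c) mod p = ((c + y) mod p - c) mod p" using assms(3) by simp
  then show ?thesis using assms(1,2) by (simp add: mod_simps)
qed

lemma card_translate:
  assumes "U \<subseteq> F"
  shows "card ({c} \<boxplus> U) = card U"
proof -
  have "{c} \<boxplus> U = (\<lambda>u. (c + u) mod p) ` U" by (auto simp: sumset_def)
  moreover have "inj_on (\<lambda>u. (c + u) mod p) U"
    by (rule inj_onI) (use assms in \<open>blast intro: add_cancel_F\<close>)
  ultimately show ?thesis by (simp add: card_image)
qed

lemma card_sumset_ge:
  assumes "U \<subseteq> F" "V \<noteq> {}"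
  shows "card U \<le> card (V \<boxplus> U)"
proof -
  obtain v where "v \<in> V" using assms by auto
  then have "card ({v} \<boxplus> U) \<le> card (V \<boxplus> U)"
    by (intro card_mono sumset_mono) auto
  then show ?thesis using card_translate assms by simp
qed

section \<open>The Ruzsa triangle inequality and Pluennecke-type bounds\<close>

lemma diff_cancel_F:
  assumes "x \<in> F" "y \<in> F" "(c - x) mod p = (c - y) mod p"
  shows "x = y"
proof -
  have "(c - (c - x) mod p) mod p = (c - (c - y) mod p) mod p" using assms(3) by simp
  then show ?thesis using assms(1,2) by (simp add: mod_simps)
qed

text \<open>Fix for each \<open>x\<close> one representation u + w. The map sending (v, x) to (u -
  v, v + w) is injective.\<close>

lemma ruzsa_triangle:
  assumes "U \<subseteq> F" "V \<subseteq> F" "W \<subseteq> F"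
  shows "card V * card (U \<boxplus> W) \<le> card (U \<boxplus> -1 \<star> V) * card (V \<boxplus> W)"
proof -
  define g where "g x = (SOME (u, w). u \<in> U \<and> w \<in> W \<and> x = (u + w) mod p)" for x
  have g: "fst (g x) \<in> U \<and> snd (g x) \<in> W \<and> x = (fst (g x) + snd (g x)) mod p" if "x \<in> U \<boxplus> W" for x
  proof -
    obtain u w where "u \<in> U" "w \<in> W" "x = (u + w) mod p" using \<open>x \<in> U \<boxplus> W\<close> by (auto simp: sumset_iff)
    then have "(case (u, w) of (u, w) \<Rightarrow> u \<in> U \<and> w \<in> W \<and> x = (u + w) mod p)" by simp
    then have "case (g x) of (u, w) \<Rightarrow> u \<in> U \<and> w \<in> W \<and> x = (u + w) mod p"
      unfolding g_def by (rule someI)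
    then show ?thesis by (simp add: case_prod_beta)
  qed
  define h where "h = (\<lambda>(v, x). ((fst (g x) - v) mod p, (v + snd (g x)) mod p))"
  have "inj_on h (V \<times> (U \<boxplus> W))"
  proof (rule inj_onI, clarify)
    fix v x v' x' assume *: "v \<in> V" "x \<in> U \<boxplus> W" "v' \<in> V" "x' \<in> U \<boxplus> W" "h (v, x) = h (v', x')"
    have e: "(fst (g x) - v) mod p = (fst (g x') - v') mod p" "(v + snd (g x)) mod p = (v' + snd (g x')) mod p"
      using * by (auto simp: h_def)
    \<comment> \<open>The two coordinates add up to \<open>x\<close>; this fixes the chosen
      representation, and then the first coordinate gives back \<open>v\<close>.\<close>
    have "x = ((fst (g x) - v) mod p + (v + snd (g x)) mod p) mod p"
      using g[OF *(2)] by (simp add: mod_simps)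
    also have "\<dots> = x'" unfolding e using g[OF *(4)] by (simp add: mod_simps)
    finally have "x = x'" .
    moreover have "v = v'"
      by (rule diff_cancel_F[where c = "fst (g x)"]) (use e \<open>x = x'\<close> * assms in \<open>auto dest: subsetD\<close>)
    ultimately show "v = v' \<and> x = x'" by simp
  qed
  moreover have "h ` (V \<times> (U \<boxplus> W)) \<subseteq> (U \<boxplus> -1 \<star> V) \<times> (V \<boxplus> W)"
  proof (clarsimp simp: h_def)
    fix v x assume "v \<in> V" "x \<in> U \<boxplus> W"
    then show "(fst (g x) - v) mod p \<in> U \<boxplus> -1 \<star> V \<and> (v + snd (g x)) mod p \<in> V \<boxplus> W"
      using g[of x] sumsetI[of "fst (g x)" U "-1 * v mod p" "-1 \<star> V"] dilI[of v V "-1"] sumsetI[of v V "snd (g x)" W]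
      by (simp add: mod_simps)
  qed
  ultimately have "card (V \<times> (U \<boxplus> W)) \<le> card ((U \<boxplus> -1 \<star> V) \<times> (V \<boxplus> W))"
    by (intro card_inj_on_le) auto
  then show ?thesis by (simp add: card_cartesian_product)
qed

text \<open>Petridis: minimality of the ratio over subsets of \<open>Z\<close> lets the sumset with \<open>Y\<close> be
  controlled after adding an arbitrary third set.\<close>

lemma petridis:
  fixes \<kappa> :: real
  assumes Z: "Z \<subseteq> F" and Y: "Y \<subseteq> F" and fW: "finite W" and WF: "W \<subseteq> F"
    and eq: "real (card (Z \<boxplus> Y)) = \<kappa> * card Z"
    and min: "\<And>Z'. Z' \<subseteq> Z \<Longrightarrow> \<kappa> * card Z' \<le> card (Z' \<boxplus> Y)"
  shows "real (card (Z \<boxplus> Y \<boxplus> W)) \<le> \<kappa> * card (Z \<boxplus> W)"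
  using fW WF
proof (induction W)
  case empty
  then show ?case by (simp add: sumset_def)
next
  case (insert w W)
  have fin: "finite Z" "finite (Z \<boxplus> Y)" using Z finite_F_subset by auto
  \<comment> \<open>The elements \<open>z\<close> for which w + z + Y is already covered by Z + Y +
    W, so that adding \<open>w\<close> gains at most |Z + Y| - |Z' + Y| elements.\<close>
  define Z' where "Z' = {z \<in> Z. {(w + z) mod p} \<boxplus> Y \<subseteq> Z \<boxplus> Y \<boxplus> W}"
  have "Z \<boxplus> Y \<boxplus> insert w W \<subseteq> (Z \<boxplus> Y \<boxplus> W) \<union> ({w} \<boxplus> (Z \<boxplus> Y) - {w} \<boxplus> (Z' \<boxplus> Y))"
  proof
    fix x assume x: "x \<in> Z \<boxplus> Y \<boxplus> insert w W"
    show "x \<in> (Z \<boxplus> Y \<boxplus> W) \<union> ({w} \<boxplus> (Z \<boxplus> Y) - {w} \<boxplus> (Z' \<boxplus> Y))"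
    proof (cases "x \<in> Z \<boxplus> Y \<boxplus> W")
      case False
      then have "x \<in> Z \<boxplus> Y \<boxplus> {w}" using x by (auto simp: sumset_iff)
      then have 1: "x \<in> {w} \<boxplus> (Z \<boxplus> Y)" by (simp add: sumset_commute)
      have "x \<notin> {w} \<boxplus> (Z' \<boxplus> Y)"
      proof
        assume "x \<in> {w} \<boxplus> (Z' \<boxplus> Y)"
        then obtain z y where zy: "z \<in> Z'" "y \<in> Y" "x = ((w + z) mod p + y) mod p"
          by (auto simp: sumset_iff mod_simps add.assoc)
        then have "x \<in> {(w + z) mod p} \<boxplus> Y" by (simp add: sumsetI)
        then show False using zy False by (auto simp: Z'_def)
      qed
      then show ?thesis using 1 by blast
    qed blast
  qed
  then have "card (Z \<boxplus> Y \<boxplus> insert w W) \<le> card ((Z \<boxplus> Y \<boxplus> W) \<union> ({w} \<boxplus> (Z \<boxplus> Y) - {w} \<boxplus> (Z' \<boxplus> Y)))"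
    by (intro card_mono) auto
  also have "\<dots> \<le> card (Z \<boxplus> Y \<boxplus> W) + card ({w} \<boxplus> (Z \<boxplus> Y) - {w} \<boxplus> (Z' \<boxplus> Y))"
    by (rule card_Un_le)
  also have "card ({w} \<boxplus> (Z \<boxplus> Y) - {w} \<boxplus> (Z' \<boxplus> Y)) = card ({w} \<boxplus> (Z \<boxplus> Y)) - card ({w} \<boxplus> (Z' \<boxplus> Y))"
    by (intro card_Diff_subset sumset_mono) (auto simp: Z'_def)
  also have "\<dots> = card (Z \<boxplus> Y) - card (Z' \<boxplus> Y)" by (simp add: card_translate)
  finally have 1: "card (Z \<boxplus> Y \<boxplus> insert w W) \<le> card (Z \<boxplus> Y \<boxplus> W) + (card (Z \<boxplus> Y) - card (Z' \<boxplus> Y))" .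
  have le: "card (Z' \<boxplus> Y) \<le> card (Z \<boxplus> Y)" by (intro card_mono sumset_mono) (auto simp: Z'_def)
  have Z'Z: "Z' \<subseteq> Z" by (auto simp: Z'_def)
  \<comment> \<open>The elements whose translate by \<open>w\<close> is not new in Z + W, so that Z
    + W gains exactly |Z| - |Z''|. From z + w = z1 + w1 follows z + w + Y = z1 + Y + w1, hence Z''
    \<subseteq> Z', and the two gains compare with factor \<open>\<kappa>\<close>.\<close>
  define Z'' where "Z'' = {z \<in> Z. (z + w) mod p \<in> Z \<boxplus> W}"
  have "Z'' \<subseteq> Z'"
  proof
    fix z assume "z \<in> Z''"
    then obtain z1 w1 where 2: "z \<in> Z" "z1 \<in> Z" "w1 \<in> W" "(w + z) mod p = (z1 + w1) mod p"
      by (auto simp: Z''_def sumset_iff add.commute)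
    have "{(w + z) mod p} \<boxplus> Y \<subseteq> Z \<boxplus> Y \<boxplus> W"
    proof
      fix x assume "x \<in> {(w + z) mod p} \<boxplus> Y"
      then obtain y where "y \<in> Y" "x = ((z1 + w1) mod p + y) mod p" by (auto simp: sumset_iff 2)
      then have "y \<in> Y" "x = ((z1 + y) mod p + w1) mod p" by (auto simp: mod_simps algebra_simps)
      then show "x \<in> Z \<boxplus> Y \<boxplus> W" using 2 by (simp add: sumsetI)
    qed
    then show "z \<in> Z'" using 2 by (simp add: Z'_def)
  qed
  have "card Z'' \<le> card Z'" using \<open>Z'' \<subseteq> Z'\<close> Z'Z fin(1) by (meson card_mono finite_subset)
  have inj: "inj_on (\<lambda>z. (w + z) mod p) Z" by (rule inj_onI) (use Z in \<open>blast intro: add_cancel_F\<close>)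
  have "Z \<boxplus> insert w W = (Z \<boxplus> W) \<union> (\<lambda>z. (w + z) mod p) ` (Z - Z'')"
    by (auto simp: sumset_iff Z''_def add.commute image_iff; blast)
  moreover have "(Z \<boxplus> W) \<inter> (\<lambda>z. (w + z) mod p) ` (Z - Z'') = {}"
    by (auto simp: Z''_def add.commute)
  ultimately have "card (Z \<boxplus> insert w W) = card (Z \<boxplus> W) + card ((\<lambda>z. (w + z) mod p) ` (Z - Z''))"
    using fin by (simp add: card_Un_disjoint)
  also have "card ((\<lambda>z. (w + z) mod p) ` (Z - Z'')) = card (Z - Z'')"
    by (intro card_image inj_on_subset[OF inj]) auto
  also have "\<dots> = card Z - card Z''"
    by (intro card_Diff_subset) (use fin in \<open>auto simp: Z''_def\<close>)
  finally have 3: "card (Z \<boxplus> insert w W) = card (Z \<boxplus> W) + (card Z - card Z'')" .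
  have 4: "card Z'' \<le> card Z" by (rule card_mono) (use fin in \<open>auto simp: Z''_def\<close>)
  have IH: "real (card (Z \<boxplus> Y \<boxplus> W)) \<le> \<kappa> * card (Z \<boxplus> W)" using insert by simp
  show ?case
  proof (cases "Z = {}")
    case True then show ?thesis by (simp add: sumset_def)
  next
    case False
    then have "card Z > 0" using fin by (simp add: card_gt_0_iff)
    then have k0: "\<kappa> \<ge> 0" using eq by (metis of_nat_0_le_iff of_nat_0_less_iff zero_le_mult_iff not_le)
    have "real (card (Z \<boxplus> Y \<boxplus> insert w W)) \<le> card (Z \<boxplus> Y \<boxplus> W) + (real (card (Z \<boxplus> Y)) - card (Z' \<boxplus> Y))"
      using 1 le by linarith
    also have "\<dots> \<le> \<kappa> * card (Z \<boxplus> W) + \<kappa> * card Z - \<kappa> * card Z'"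
      using IH eq min[OF Z'Z] by linarith
    also have "\<dots> \<le> \<kappa> * card (Z \<boxplus> W) + \<kappa> * card Z - \<kappa> * card Z''"
      using k0 \<open>card Z'' \<le> card Z'\<close> by (simp add: mult_left_mono)
    also have "\<dots> = \<kappa> * card (Z \<boxplus> insert w W)" using 3 4 by (simp add: algebra_simps of_nat_diff)
    finally show ?thesis .
  qed
qed

text \<open>With Y = -X, choose a nonempty Z \<subseteq> X of least ratio |Z + Y| / |Z|.
  \<open>petridis\<close> with W = Y gives |Z + Y + Y| \<le> \<kappa>^2 |Z|. The triangle inequality
  with Z as the middle set passes from Z back to X, since X + X - Z is the negative of Z + Y +
  Y.\<close>

lemma pluennecke:
  fixes K :: real
  assumes X: "X \<subseteq> F" "X \<noteq> {}" and K: "real (card (X \<boxplus> -1 \<star> X)) \<le> K * card X"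
  shows "real (card (X \<boxplus> -1 \<star> X \<boxplus> X)) \<le> K ^ 3 * card X"
    and "real (card (X \<boxplus> -1 \<star> X \<boxplus> (X \<boxplus> -1 \<star> X))) \<le> K ^ 4 * card X"
proof -
  define Y where "Y = -1 \<star> X"
  have YF: "Y \<subseteq> F" by (simp add: Y_def)
  have finX: "finite X" using X finite_F_subset by auto
  define ratio where "ratio Z = real (card (Z \<boxplus> Y)) / card Z" for Z
  obtain Z where Z: "Z \<in> Pow X - {{}}" and Zmin: "\<And>Z'. Z' \<in> Pow X - {{}} \<Longrightarrow> ratio Z \<le> ratio Z'"
    using ex_is_arg_min_if_finite[of "Pow X - {{}}" ratio] finX X by (auto simp: is_arg_min_linorder)
  have ZX: "Z \<subseteq> X" "Z \<noteq> {}" "Z \<subseteq> F" "finite Z" using Z X finX by (auto intro: finite_subset)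
  have cZ: "card Z > 0" using ZX by (simp add: card_gt_0_iff)
  have cX: "card X > 0" using X finX by (simp add: card_gt_0_iff)
  define \<kappa> where "\<kappa> = ratio Z"
  have k0: "\<kappa> \<ge> 0" by (simp add: \<kappa>_def ratio_def)
  have "\<kappa> \<le> ratio X" using Zmin[of X] X by (simp add: \<kappa>_def)
  also have "\<dots> \<le> K" using K cX by (simp add: ratio_def Y_def field_simps)
  finally have kK: "\<kappa> \<le> K" .
  have eq: "real (card (Z \<boxplus> Y)) = \<kappa> * card Z" using cZ by (simp add: \<kappa>_def ratio_def)
  have min: "\<kappa> * card Z' \<le> card (Z' \<boxplus> Y)" if "Z' \<subseteq> Z" for Z'
  proof (cases "Z' = {}")
    case False
    then have "card Z' > 0" using that ZX by (meson card_gt_0_iff finite_subset)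
    moreover have "\<kappa> \<le> ratio Z'" using Zmin[of Z'] that False ZX by (auto simp: \<kappa>_def)
    ultimately show ?thesis by (simp add: ratio_def field_simps)
  qed simp
  have "real (card (Z \<boxplus> Y \<boxplus> Y)) \<le> \<kappa> * card (Z \<boxplus> Y)"
    by (rule petridis) (use ZX YF eq min finite_F_subset in auto)
  then have zyy: "real (card (Z \<boxplus> (Y \<boxplus> Y))) \<le> \<kappa>^2 * card Z" by (simp add: eq power2_eq_square sumset_assoc)
  have neg: "-1 \<star> Y = X" using X by (simp add: Y_def dil_dil dil_one)
  have negc: "card (-1 \<star> W) = card W" if "W \<subseteq> F" for W
    by (rule card_dil) (use that p_gt_1 in auto)
  have "real (card Z) * card (X \<boxplus> X \<boxplus> Y) \<le> real (card (X \<boxplus> X \<boxplus> -1 \<star> Z)) * card (Z \<boxplus> Y)"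
    using ruzsa_triangle[of "X \<boxplus> X" Z Y] ZX YF unfolding of_nat_mult [symmetric] of_nat_le_iff by simp
  also have "card (X \<boxplus> X \<boxplus> -1 \<star> Z) = card (-1 \<star> (Z \<boxplus> (Y \<boxplus> Y)))"
    by (simp add: dil_sumset neg sumset_commute)
  also have "\<dots> = card (Z \<boxplus> (Y \<boxplus> Y))" by (simp add: negc)
  also have "real (card (Z \<boxplus> (Y \<boxplus> Y))) * card (Z \<boxplus> Y) \<le> (\<kappa>^2 * card Z) * (\<kappa> * card Z)"
    using zyy eq k0 by (intro mult_mono) auto
  finally have "real (card (X \<boxplus> X \<boxplus> Y)) \<le> \<kappa>^3 * card Z" using cZ
    by (simp add: power2_eq_square power3_eq_cube mult.assoc mult.left_commute)
  also have "\<dots> \<le> K^3 * card X"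
    using kK k0 ZX finX by (intro mult_mono power_mono) (auto intro: card_mono)
  finally show "real (card (X \<boxplus> -1 \<star> X \<boxplus> X)) \<le> K ^ 3 * card X"
    by (simp add: Y_def sumset_ac)
  have "real (card Z) * card (X \<boxplus> X \<boxplus> (Y \<boxplus> Y)) \<le> real (card (X \<boxplus> X \<boxplus> -1 \<star> Z)) * card (Z \<boxplus> (Y \<boxplus> Y))"
    using ruzsa_triangle[of "X \<boxplus> X" Z "Y \<boxplus> Y"] ZX unfolding of_nat_mult [symmetric] of_nat_le_iff by simp
  also have "card (X \<boxplus> X \<boxplus> -1 \<star> Z) = card (-1 \<star> (Z \<boxplus> (Y \<boxplus> Y)))"
    by (simp add: dil_sumset neg sumset_commute)
  also have "\<dots> = card (Z \<boxplus> (Y \<boxplus> Y))" by (simp add: negc)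
  also have "real (card (Z \<boxplus> (Y \<boxplus> Y))) * card (Z \<boxplus> (Y \<boxplus> Y)) \<le> (\<kappa>^2 * card Z) * (\<kappa>^2 * card Z)"
    using zyy k0 by (intro mult_mono) auto
  finally have "real (card (X \<boxplus> X \<boxplus> (Y \<boxplus> Y))) \<le> \<kappa>^4 * card Z" using cZ
    by (simp add: power2_eq_square power4_eq_xxxx mult.assoc mult.left_commute)
  also have "\<dots> \<le> K^4 * card X"
    using kK k0 ZX finX by (intro mult_mono power_mono) (auto intro: card_mono)
  finally show "real (card (X \<boxplus> -1 \<star> X \<boxplus> (X \<boxplus> -1 \<star> X))) \<le> K ^ 4 * card X"
    by (simp add: Y_def sumset_ac)
qed

end

subsection \<open>Counting collisions\<close>

lemma sum_card_fibres:
  assumes "finite S" "finite T" "f ` S \<subseteq> T"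
  shows "(\<Sum>y\<in>T. card {s\<in>S. f s = y}) = card S"
proof -
  have "(\<Sum>y\<in>T. \<Sum>s\<in>{s\<in>S. f s = y}. (1::nat)) = (\<Sum>s\<in>S. 1)"
    by (rule sum.group) (use assms in auto)
  then show ?thesis by simp
qed

lemma sum_card_fibres_square:
  assumes "finite S" "finite T" "f ` S \<subseteq> T"
  shows "(\<Sum>y\<in>T. (card {s\<in>S. f s = y})\<^sup>2) = card {(s, t) \<in> S \<times> S. f s = f t}"
proof -
  have "card {(s, t) \<in> S \<times> S. f s = f t} = card (\<Union>y\<in>T. {s\<in>S. f s = y} \<times> {s\<in>S. f s = y})"
    by (rule arg_cong[where f = card]) (use assms in auto)
  also have "\<dots> = (\<Sum>y\<in>T. card ({s\<in>S. f s = y} \<times> {s\<in>S. f s = y}))"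
    by (rule card_UN_disjoint) (use assms in auto)
  finally show ?thesis by (simp add: card_cartesian_product power2_eq_square)
qed

text \<open>Cauchy-Schwarz for the fibre sizes: few collisions force a large image.\<close>

lemma card_square_le_image_collisions:
  assumes "finite S"
  shows "(card S)\<^sup>2 \<le> card (f ` S) * card {(s, t) \<in> S \<times> S. f s = f t}"
proof -
  let ?r = "\<lambda>y. real (card {s\<in>S. f s = y})"
  have "(\<Sum>y\<in>f ` S. ?r y)\<^sup>2 \<le> (\<Sum>y\<in>f ` S. (?r y)\<^sup>2) * card (f ` S)"
    by (rule sum_squared_le_sum_of_squares)
  moreover have "(\<Sum>y\<in>f ` S. ?r y) = card S"
    using sum_card_fibres[of S "f ` S" f] assms by (simp flip: of_nat_sum)
  moreover have "(\<Sum>y\<in>f ` S. (?r y)\<^sup>2) = card {(s, t) \<in> S \<times> S. f s = f t}"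
    using sum_card_fibres_square[of S "f ` S" f] assms by (simp flip: of_nat_sum of_nat_power)
  ultimately have "real ((card S)\<^sup>2) \<le> real (card (f ` S) * card {(s, t) \<in> S \<times> S. f s = f t})"
    by (simp add: mult.commute)
  then show ?thesis by (simp only: of_nat_le_iff)
qed

context prime_modulus begin

section \<open>Units modulo \<open>p\<close> and the exchange of overlapping dilates\<close>

lemma not_dvd_F: "x \<in> F \<Longrightarrow> x \<noteq> 0 \<Longrightarrow> \<not> p dvd x"
  using zdvd_imp_le[of p x] by auto

lemma not_dvd_diff_F:
  assumes "x \<in> F" "y \<in> F" "x \<noteq> y"
  shows "\<not> p dvd x - y"
proof
  assume "p dvd x - y"
  then show False using assms by (simp add: mod_eq_dvd_iff [symmetric])
qed

text \<open>Triangle inequality through the intersection I of the two dilates: |I| |cX + W| \<le>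
  |cX - I| |I + W| \<le> |cX - cX| |dX + W|. Inside a sumset, cX may thus be exchanged for dX at the
  price of a factor |X - X| / N.\<close>

lemma replace_dilate:
  assumes X: "X \<subseteq> F" and W: "W \<subseteq> F" and c: "\<not> p dvd c"
    and N: "N \<le> card (c \<star> X \<inter> d \<star> X)"
  shows "N * card (c \<star> X \<boxplus> W) \<le> card (X \<boxplus> -1 \<star> X) * card (d \<star> X \<boxplus> W)"
proof -
  let ?I = "c \<star> X \<inter> d \<star> X"
  have IF: "?I \<subseteq> F" by (rule order_trans[OF Int_lower1 dil_F])
  have "N * card (c \<star> X \<boxplus> W) \<le> card ?I * card (c \<star> X \<boxplus> W)" using N by simp
  also have "\<dots> \<le> card (c \<star> X \<boxplus> -1 \<star> ?I) * card (?I \<boxplus> W)"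
    by (rule ruzsa_triangle) (use IF W in auto)
  also have "\<dots> \<le> card (c \<star> X \<boxplus> -1 \<star> (c \<star> X)) * card (d \<star> X \<boxplus> W)"
    by (intro mult_mono card_mono sumset_mono dil_mono) auto
  also have "c \<star> X \<boxplus> -1 \<star> (c \<star> X) = c \<star> (X \<boxplus> -1 \<star> X)"
    by (simp add: dil_sumset dil_dil)
  also have "card \<dots> = card (X \<boxplus> -1 \<star> X)" by (simp add: card_dil[OF c])
  finally show ?thesis .
qed

lemma card_inter_neg:
  assumes "N \<le> card (c \<star> X \<inter> d \<star> X)"
  shows "N \<le> card ((-c) \<star> X \<inter> (-d) \<star> X)"
proof -
  have "c \<star> X \<inter> d \<star> X \<subseteq> F" by (rule order_trans[OF Int_lower1 dil_F])
  then have "card (c \<star> X \<inter> d \<star> X) = card (-1 \<star> (c \<star> X \<inter> d \<star> X))"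
    using card_dil[of "-1"] p_gt_1 by simp
  also have "\<dots> \<le> card (-1 \<star> (c \<star> X) \<inter> -1 \<star> (d \<star> X))"
    by (intro card_mono Int_greatest dil_mono) auto
  finally show ?thesis using assms by (simp add: dil_dil)
qed

text \<open>Splitting both differences leaves four dilates of \<open>X\<close>, with signs. Each is
  exchanged for dX or -dX, and what remains is the dilate by \<open>d\<close> of X - X + X -
  X.\<close>

lemma card_two_dilates:
  assumes X: "X \<subseteq> F" and d: "\<not> p dvd d"
    and P: "\<And>a. a \<in> P \<Longrightarrow> \<not> p dvd a \<and> N \<le> card (a \<star> X \<inter> d \<star> X)"
    and a: "a1 \<in> P" "a2 \<in> P" "a3 \<in> P" "a4 \<in> P"
  shows "N ^ 4 * card ((a3 - a4) \<star> X \<boxplus> (a1 - a2) \<star> X)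
    \<le> card (X \<boxplus> -1 \<star> X) ^ 4 * card (X \<boxplus> -1 \<star> X \<boxplus> (X \<boxplus> -1 \<star> X))"
proof -
  let ?K = "card (X \<boxplus> -1 \<star> X)"
  have pos: "N * card (c \<star> X \<boxplus> W) \<le> ?K * card (d \<star> X \<boxplus> W)" if "c \<in> P" "W \<subseteq> F" for c W
    using replace_dilate[OF X that(2), of c N d] P[OF that(1)] by simp
  have neg: "N * card ((-c) \<star> X \<boxplus> W) \<le> ?K * card ((-d) \<star> X \<boxplus> W)" if "c \<in> P" "W \<subseteq> F" for c W
    using replace_dilate[OF X that(2), of "-c" N "-d"] P[OF that(1)] card_inter_neg[of N c X d] by simp
  let ?S = "a3 \<star> X \<boxplus> ((-a4) \<star> X \<boxplus> (a1 \<star> X \<boxplus> (-a2) \<star> X))"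
  have "(a3 - a4) \<star> X \<boxplus> (a1 - a2) \<star> X \<subseteq> ?S"
    using sumset_mono[OF dil_add_subset[of a3 "-a4" X] dil_add_subset[of a1 "-a2" X]] by (simp add: sumset_assoc)
  then have "N ^ 4 * card ((a3 - a4) \<star> X \<boxplus> (a1 - a2) \<star> X) \<le> N ^ 3 * (N * card ?S)"
    by (simp add: power_eq_if card_mono)
  also have "\<dots> \<le> N ^ 3 * (?K * card (d \<star> X \<boxplus> ((-a4) \<star> X \<boxplus> (a1 \<star> X \<boxplus> (-a2) \<star> X))))"
    using pos[OF a(3)] by (intro mult_left_mono) auto
  also have "\<dots> = N ^ 2 * ?K * (N * card ((-a4) \<star> X \<boxplus> (d \<star> X \<boxplus> (a1 \<star> X \<boxplus> (-a2) \<star> X))))"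
    by (subst sumset_left_commute) (simp add: power_eq_if)
  also have "\<dots> \<le> N ^ 2 * ?K * (?K * card ((-d) \<star> X \<boxplus> (d \<star> X \<boxplus> (a1 \<star> X \<boxplus> (-a2) \<star> X))))"
    using neg[OF a(4)] by (intro mult_left_mono) auto
  also have "(-d) \<star> X \<boxplus> (d \<star> X \<boxplus> (a1 \<star> X \<boxplus> (-a2) \<star> X)) = a1 \<star> X \<boxplus> ((-a2) \<star> X \<boxplus> (d \<star> X \<boxplus> (-d) \<star> X))"
    by (simp only: sumset_ac)
  also have "N ^ 2 * ?K * (?K * card (a1 \<star> X \<boxplus> ((-a2) \<star> X \<boxplus> (d \<star> X \<boxplus> (-d) \<star> X))))
    = N * ?K ^ 2 * (N * card (a1 \<star> X \<boxplus> ((-a2) \<star> X \<boxplus> (d \<star> X \<boxplus> (-d) \<star> X))))"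
    by (simp add: power2_eq_square)
  also have "\<dots> \<le> N * ?K ^ 2 * (?K * card (d \<star> X \<boxplus> ((-a2) \<star> X \<boxplus> (d \<star> X \<boxplus> (-d) \<star> X))))"
    using pos[OF a(1)] by (intro mult_left_mono) auto
  also have "\<dots> = ?K ^ 3 * (N * card ((-a2) \<star> X \<boxplus> (d \<star> X \<boxplus> (d \<star> X \<boxplus> (-d) \<star> X))))"
    by (subst sumset_left_commute) (simp add: power_eq_if)
  also have "\<dots> \<le> ?K ^ 3 * (?K * card ((-d) \<star> X \<boxplus> (d \<star> X \<boxplus> (d \<star> X \<boxplus> (-d) \<star> X))))"
    using neg[OF a(2)] by (intro mult_left_mono) auto
  also have "(-d) \<star> X \<boxplus> (d \<star> X \<boxplus> (d \<star> X \<boxplus> (-d) \<star> X)) = d \<star> (X \<boxplus> -1 \<star> X \<boxplus> (X \<boxplus> -1 \<star> X))"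
    by (simp add: dil_sumset dil_dil sumset_ac)
  also have "card \<dots> = card (X \<boxplus> -1 \<star> X \<boxplus> (X \<boxplus> -1 \<star> X))" by (simp add: card_dil[OF d])
  finally show ?thesis by (simp add: power_eq_if)
qed

subsection \<open>The pivot argument\<close>

text \<open>The quotients (a1 - a2) / (a3 - a4) of differences, written as a congruence so that no
  inverse appears.\<close>

definition ratios :: "int set \<Rightarrow> int set" where
  "ratios P = {\<xi> \<in> F. \<exists>a1\<in>P. \<exists>a2\<in>P. \<exists>a3\<in>P. \<exists>a4\<in>P. a3 \<noteq> a4 \<and> [\<xi> * (a3 - a4) = a1 - a2] (mod p)}"

text \<open>A collision u + \<eta>v = u' + \<eta>v' with v \<noteq> v' would exhibit \<eta> as the
  ratio (u' - u) / (v - v'), so all sums are distinct.\<close>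

lemma card_add_dilate_not_ratio:
  assumes P: "P \<subseteq> F" and \<eta>: "\<eta> \<in> F" "\<eta> \<notin> ratios P"
  shows "card (P \<boxplus> \<eta> \<star> P) = (card P)\<^sup>2"
proof -
  let ?h = "\<lambda>(u, v). (u + \<eta> * v mod p) mod p"
  have "inj_on ?h (P \<times> P)"
  proof (rule inj_onI, clarify)
    fix u v u' v' assume uv: "u \<in> P" "v \<in> P" "u' \<in> P" "v' \<in> P"
      and e: "(u + \<eta> * v mod p) mod p = (u' + \<eta> * v' mod p) mod p"
    have v: "v = v'"
    proof (rule ccontr)
      assume "v \<noteq> v'"
      have "[u + \<eta> * v = u' + \<eta> * v'] (mod p)" using e by (simp add: cong_def mod_simps)
      then have "[\<eta> * (v - v') = u' - u] (mod p)"
        by (simp add: cong_iff_dvd_diff algebra_simps)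
      then have "\<eta> \<in> ratios P" unfolding ratios_def using uv \<open>v \<noteq> v'\<close> \<eta>(1) by blast
      then show False using \<eta> by simp
    qed
    have "(\<eta> * v mod p + u) mod p = (\<eta> * v mod p + u') mod p"
      using e v by (simp add: add.commute)
    then have "u = u'" using add_cancel_F P uv by blast
    then show "u = u' \<and> v = v'" using v by simp
  qed
  moreover have "P \<boxplus> \<eta> \<star> P = ?h ` (P \<times> P)"
    by (auto simp: sumset_iff bex_dil image_iff; blast)
  ultimately show ?thesis by (simp add: card_image card_cartesian_product power2_eq_square)
qed

text \<open>1 generates the additive group of a prime field. Over other finite fields a proper
  subfield would be closed under adding 1.\<close>

lemma ratios_eq_F_if_Suc_closed:
  assumes "0 \<in> S" "S \<subseteq> F" "\<And>\<xi>. \<xi> \<in> S \<Longrightarrow> (\<xi> + 1) mod p \<in> S"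
  shows "S = F"
proof -
  have "int n mod p \<in> S" for n
  proof (induction n)
    case (Suc n)
    then show ?case using assms(3)[OF Suc] by (simp add: mod_simps add.commute)
  qed (use assms in simp)
  then have "x \<in> S" if "x \<in> F" for x
    using that by (metis F_mod atLeastLessThan_iff zero_le_imp_eq_int)
  then show ?thesis using assms(2) by blast
qed

text \<open>Averaging over \<xi>: the diagonal contributes |P|^2 for each \<xi>, and every other
  pair collides for at most one \<xi>, which adds on average at most |P|^4 / p \<le> |P|^2.\<close>

lemma exists_few_collisions:
  assumes P: "P \<subseteq> F" and le: "int ((card P)\<^sup>2) \<le> p"
  shows "\<exists>\<xi>\<in>F. card {(s, t) \<in> (P \<times> P) \<times> (P \<times> P).
    (fst s + \<xi> * snd s) mod p = (fst t + \<xi> * snd t) mod p} \<le> 2 * (card P)\<^sup>2"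
proof (rule ccontr)
  define S where "S \<xi> = {(s, t) \<in> (P \<times> P) \<times> (P \<times> P).
    (fst s + \<xi> * snd s) mod p = (fst t + \<xi> * snd t) mod p}" for \<xi>
  have finP: "finite P" using P finite_F_subset by auto
  then have finS: "finite (S \<xi>)" for \<xi>
    by (intro finite_subset[of "S \<xi>" "(P \<times> P) \<times> (P \<times> P)"]) (auto simp: S_def)
  have cF: "int (card F) = p" using less_imp_le[OF p_pos] by simp
  assume na: "\<not> ?thesis"
  then have gt: "2 * (card P)\<^sup>2 + 1 \<le> card (S \<xi>)" if "\<xi> \<in> F" for \<xi>
  proof -
    have "\<not> card (S \<xi>) \<le> 2 * (card P)\<^sup>2" using na that unfolding S_def by blast
    then show ?thesis by simp
  qed
  \<comment> \<open>Diagonal pairs collide for every \<xi>. A collision with equal second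
    coordinates is diagonal, so all others lie in \<open>Q\<close>.\<close>
  define D where "D = {(s, t) \<in> (P \<times> P) \<times> (P \<times> P). s = t}"
  define Q where "Q = {(s, t) \<in> (P \<times> P) \<times> (P \<times> P). snd s \<noteq> snd t}"
  have finD: "finite D" "finite Q" using finP
    by (auto simp: D_def Q_def intro: finite_subset[of _ "(P \<times> P) \<times> (P \<times> P)"])
  have sub: "S \<xi> \<subseteq> D \<union> (Q \<inter> S \<xi>)" for \<xi>
  proof (clarsimp simp: S_def D_def Q_def)
    fix u v u' assume *: "u \<in> P" "u' \<in> P" "(u + \<xi> * v) mod p = (u' + \<xi> * v) mod p"
    have "(\<xi> * v + u) mod p = (\<xi> * v + u') mod p"
      using *(3) by (simp only: add.commute[of "\<xi> * v"])
    then show "u = u'" using add_cancel_F[of u u' "\<xi> * v"] P *(1,2) by blast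
  qed
  have "card D = card ((\<lambda>s. (s, s)) ` (P \<times> P))"
    by (rule arg_cong[where f = card]) (auto simp: D_def)
  also have "\<dots> = (card P)\<^sup>2"
    by (subst card_image) (auto simp: inj_on_def card_cartesian_product power2_eq_square)
  finally have cD: "card D = (card P)\<^sup>2" .
  have "card Q \<le> card ((P \<times> P) \<times> (P \<times> P))"
    by (rule card_mono) (use finP in \<open>auto simp: Q_def\<close>)
  then have cO: "card Q \<le> (card P)\<^sup>2 * (card P)\<^sup>2" by (simp add: card_cartesian_product power2_eq_square)
  have "(\<Sum>\<xi>\<in>F. card (Q \<inter> S \<xi>)) = card (SIGMA \<xi>:F. Q \<inter> S \<xi>)"
    using finD by simp
  \<comment> \<open>Two different \<xi> for the same pair would force equal second coordinates, so
    forgetting \<xi> is injective.\<close>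
  also have "\<dots> \<le> card Q"
  proof (rule card_inj_on_le[of snd])
    show "inj_on snd (SIGMA \<xi>:F. Q \<inter> S \<xi>)"
    proof (rule inj_onI)
      fix x y assume xy: "x \<in> (SIGMA \<xi>:F. Q \<inter> S \<xi>)" "y \<in> (SIGMA \<xi>:F. Q \<inter> S \<xi>)" "snd x = snd y"
      obtain \<xi> s1 s2 t1 t2 where x: "x = (\<xi>, (s1, s2), (t1, t2))" by (cases x) auto
      obtain \<xi>' where y: "y = (\<xi>', (s1, s2), (t1, t2))" using xy(3) x by (cases y) auto
      have *: "\<xi> \<in> F" "\<xi>' \<in> F" "((s1, s2), (t1, t2)) \<in> Q"
        "((s1, s2), (t1, t2)) \<in> S \<xi>" "((s1, s2), (t1, t2)) \<in> S \<xi>'"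
        using xy unfolding x y by blast+
      have "[s1 + \<xi> * s2 = t1 + \<xi> * t2] (mod p)" "[s1 + \<xi>' * s2 = t1 + \<xi>' * t2] (mod p)"
        using * by (auto simp: S_def cong_def)
      then have "[s1 + \<xi> * s2 - (s1 + \<xi>' * s2) = t1 + \<xi> * t2 - (t1 + \<xi>' * t2)] (mod p)"
        by (rule cong_diff)
      then have "p dvd (s2 - t2) * \<xi> - (s2 - t2) * \<xi>'"
        by (simp add: cong_iff_dvd_diff algebra_simps)
      then have "(s2 - t2) * \<xi> mod p = (s2 - t2) * \<xi>' mod p" by (simp add: mod_eq_dvd_iff)
      moreover have "\<not> p dvd s2 - t2"
        by (rule not_dvd_diff_F) (use * P in \<open>auto simp: Q_def dest: subsetD\<close>)
      ultimately have "\<xi> = \<xi>'" using mult_cancel_F * by blast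
      then show "x = y" by (simp add: x y)
    qed
  qed (use finD in auto)
  also note cO
  finally have sO: "(\<Sum>\<xi>\<in>F. card (Q \<inter> S \<xi>)) \<le> (card P)\<^sup>2 * (card P)\<^sup>2" .
  have Pp: "(card P)\<^sup>2 \<le> card F" using le cF by linarith
  \<comment> \<open>By assumption every \<xi> has one collision more than 2|P|^2; summed over the
    field, this surplus contradicts the average.\<close>
  have "card F * (2 * (card P)\<^sup>2 + 1) \<le> (\<Sum>\<xi>\<in>F. card (S \<xi>))"
    using sum_mono[of F "\<lambda>_. 2 * (card P)\<^sup>2 + 1" "\<lambda>\<xi>. card (S \<xi>)"] gt by simp
  also have "\<dots> \<le> (\<Sum>\<xi>\<in>F. card D + card (Q \<inter> S \<xi>))"
  proof (rule sum_mono)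
    fix \<xi>
    have "card (S \<xi>) \<le> card (D \<union> (Q \<inter> S \<xi>))" by (rule card_mono) (use sub finD in auto)
    also have "\<dots> \<le> card D + card (Q \<inter> S \<xi>)" by (rule card_Un_le)
    finally show "card (S \<xi>) \<le> card D + card (Q \<inter> S \<xi>)" .
  qed
  also have "\<dots> = card F * (card P)\<^sup>2 + (\<Sum>\<xi>\<in>F. card (Q \<inter> S \<xi>))" by (simp add: sum.distrib cD)
  also have "\<dots> \<le> card F * (card P)\<^sup>2 + (card P)\<^sup>2 * (card P)\<^sup>2" using sO by simp
  also have "\<dots> \<le> card F * (card P)\<^sup>2 + card F * (card P)\<^sup>2"
    by (intro add_left_mono mult_right_mono Pp) auto
  finally have "card F = 0" by (simp add: algebra_simps)
  then show False using cF p_pos by linarith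
qed

text \<open>If every residue is a ratio, one with few collisions is used. Otherwise some ratio \<open>\<xi>\<close> has
  \<open>\<xi> + 1\<close> not a ratio, and \<open>P \<boxplus> (\<xi> + 1) \<star> P\<close> has no collisions at all.\<close>

lemma pivot:
  assumes P: "P \<subseteq> F" and two: "2 \<le> card P" and le: "int ((card P)\<^sup>2) \<le> p"
  shows "\<exists>a1\<in>P. \<exists>a2\<in>P. \<exists>a3\<in>P. \<exists>a4\<in>P. a3 \<noteq> a4 \<and>
    (card P)\<^sup>2 \<le> 2 * card ((a3 - a4) \<star> (P \<boxplus> P) \<boxplus> (a1 - a2) \<star> P)"
proof -
  have finP: "finite P" using P finite_F_subset by auto
  have ratio: "(c * \<xi>) \<star> P = (a1 - a2) \<star> P" if "[\<xi> * c = a1 - a2] (mod p)" for c \<xi> a1 a2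
    by (rule dil_cong) (use that in \<open>simp add: mult.commute\<close>)
  obtain u v where uv: "u \<in> P" "v \<in> P" "u \<noteq> v"
    using two finP card_le_Suc0_iff_eq[of P] by auto
  show ?thesis
  proof (cases "ratios P = F")
    case True
    obtain \<xi> where \<xi>: "\<xi> \<in> F" and few: "card {(s, t) \<in> (P \<times> P) \<times> (P \<times> P).
      (fst s + \<xi> * snd s) mod p = (fst t + \<xi> * snd t) mod p} \<le> 2 * (card P)\<^sup>2"
      using exists_few_collisions[OF P le] by blast
    obtain a1 a2 a3 a4 where a: "a1 \<in> P" "a2 \<in> P" "a3 \<in> P" "a4 \<in> P" "a3 \<noteq> a4"
      "[\<xi> * (a3 - a4) = a1 - a2] (mod p)"
      using \<xi> True unfolding ratios_def by blast
    have im: "(\<lambda>s. (fst s + \<xi> * snd s) mod p) ` (P \<times> P) = P \<boxplus> \<xi> \<star> P"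
      by (rule Set.set_eqI) (simp add: sumset_iff bex_dil image_iff mod_simps)
    have "(card (P \<times> P))\<^sup>2 \<le> card (P \<boxplus> \<xi> \<star> P) * card {(s, t) \<in> (P \<times> P) \<times> (P \<times> P).
      (fst s + \<xi> * snd s) mod p = (fst t + \<xi> * snd t) mod p}"
      unfolding im[symmetric] by (rule card_square_le_image_collisions) (use finP in simp)
    also have "\<dots> \<le> card (P \<boxplus> \<xi> \<star> P) * (2 * (card P)\<^sup>2)" by (intro mult_le_mono2 few)
    finally have "(card (P \<times> P))\<^sup>2 \<le> card (P \<boxplus> \<xi> \<star> P) * (2 * (card P)\<^sup>2)" .
    then have *: "(card P)\<^sup>2 * (card P)\<^sup>2 \<le> (card P)\<^sup>2 * (2 * card (P \<boxplus> \<xi> \<star> P))"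
      by (simp add: card_cartesian_product power2_eq_square mult_ac)
    have "(card P)\<^sup>2 \<le> 2 * card (P \<boxplus> \<xi> \<star> P)"
      by (rule mult_left_le_imp_le[OF *]) (use two in simp)
    also have "card (P \<boxplus> \<xi> \<star> P) = card ((a3 - a4) \<star> (P \<boxplus> \<xi> \<star> P))"
      by (rule card_dil[symmetric]) (use not_dvd_diff_F[of a3 a4] a P in blast, simp)
    also have "(a3 - a4) \<star> (P \<boxplus> \<xi> \<star> P) = (a3 - a4) \<star> P \<boxplus> (a1 - a2) \<star> P"
      using ratio[OF a(6)] by (simp add: dil_sumset dil_dil)
    finally have 1: "(card P)\<^sup>2 \<le> 2 * card ((a3 - a4) \<star> P \<boxplus> (a1 - a2) \<star> P)" .
    \<comment> \<open>The additional copy of (a3 - a4)P only brings this case into the form that the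
      other case requires.\<close>
    have "card ((a3 - a4) \<star> P \<boxplus> (a1 - a2) \<star> P) \<le> card ((a3 - a4) \<star> P \<boxplus> ((a3 - a4) \<star> P \<boxplus> (a1 - a2) \<star> P))"
      by (rule card_sumset_ge) (use uv in \<open>auto simp: dil_def\<close>)
    also have "\<dots> = card ((a3 - a4) \<star> (P \<boxplus> P) \<boxplus> (a1 - a2) \<star> P)"
      by (simp add: dil_sumset sumset_assoc)
    finally have "(card P)\<^sup>2 \<le> 2 * card ((a3 - a4) \<star> (P \<boxplus> P) \<boxplus> (a1 - a2) \<star> P)"
      using 1 by linarith
    then show ?thesis using a(1-5)
      by - (rule bexI[of _ a1], rule bexI[of _ a2], rule bexI[of _ a3], rule bexI[of _ a4], rule conjI)
  next
    case False
    have "[0 * (u - v) = u - u] (mod p)" by simp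
    moreover have "0 \<in> F" by simp
    ultimately have "0 \<in> ratios P" using uv unfolding ratios_def by blast
    \<comment> \<open>0 is a ratio and some residue is not, so closure under adding 1 fails
      somewhere.\<close>
    then obtain \<xi> where \<xi>: "\<xi> \<in> ratios P" "(\<xi> + 1) mod p \<notin> ratios P"
      using ratios_eq_F_if_Suc_closed[of "ratios P"] False unfolding ratios_def by blast
    obtain a1 a2 a3 a4 where a: "a1 \<in> P" "a2 \<in> P" "a3 \<in> P" "a4 \<in> P" "a3 \<noteq> a4"
      "[\<xi> * (a3 - a4) = a1 - a2] (mod p)"
      using \<xi>(1) unfolding ratios_def by blast
    have "(card P)\<^sup>2 = card (P \<boxplus> ((\<xi> + 1) mod p) \<star> P)"
      by (rule card_add_dilate_not_ratio[symmetric]) (use P \<xi> in auto)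
    also have "((\<xi> + 1) mod p) \<star> P = (1 + \<xi>) \<star> P" by (rule dil_cong) (simp add: cong_def add.commute)
    \<comment> \<open>Splitting 1 + \<xi> creates a second copy of P. After scaling by a3 - a4, this
      is the origin of \<open>P \<boxplus> P\<close> in the statement.\<close>
    also have "card (P \<boxplus> (1 + \<xi>) \<star> P) \<le> card (P \<boxplus> (1 \<star> P \<boxplus> \<xi> \<star> P))"
      by (intro card_mono sumset_mono dil_add_subset) auto
    also have "\<dots> = card ((a3 - a4) \<star> (P \<boxplus> (1 \<star> P \<boxplus> \<xi> \<star> P)))"
      by (rule card_dil[symmetric]) (use not_dvd_diff_F[of a3 a4] a P in blast, simp)
    also have "(a3 - a4) \<star> (P \<boxplus> (1 \<star> P \<boxplus> \<xi> \<star> P)) = (a3 - a4) \<star> (P \<boxplus> P) \<boxplus> (a1 - a2) \<star> P"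
      using ratio[OF a(6)] P by (simp add: dil_sumset dil_dil sumset_assoc)
    finally have "(card P)\<^sup>2 \<le> 2 * card ((a3 - a4) \<star> (P \<boxplus> P) \<boxplus> (a1 - a2) \<star> P)" by simp
    then show ?thesis using a(1-5)
      by - (rule bexI[of _ a1], rule bexI[of _ a2], rule bexI[of _ a3], rule bexI[of _ a4], rule conjI)
  qed
qed

end

subsection \<open>Multiplicative energy\<close>

lemma card_common_values:
  assumes "finite S" "finite T"
  shows "card {(s, t) \<in> S \<times> T. f s = g t}
    = (\<Sum>y\<in>f ` S \<union> g ` T. card {s\<in>S. f s = y} * card {t\<in>T. g t = y})"
proof -
  have "card {(s, t) \<in> S \<times> T. f s = g t}
    = card (\<Union>y\<in>f ` S \<union> g ` T. {s\<in>S. f s = y} \<times> {t\<in>T. g t = y})"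
    by (rule arg_cong[where f = card]) auto
  also have "\<dots> = (\<Sum>y\<in>f ` S \<union> g ` T. card ({s\<in>S. f s = y} \<times> {t\<in>T. g t = y}))"
    by (rule card_UN_disjoint) (use assms in auto)
  finally show ?thesis by (simp add: card_cartesian_product)
qed

text \<open>Cauchy-Schwarz for the fibre sizes of \<open>f\<close> and \<open>g\<close> over their
  joint range.\<close>

lemma card_common_values_le:
  assumes "finite S" "finite T"
  shows "(card {(s, t) \<in> S \<times> T. f s = g t})\<^sup>2
    \<le> card {(s, s') \<in> S \<times> S. f s = f s'} * card {(t, t') \<in> T \<times> T. g t = g t'}"
proof -
  let ?Y = "f ` S \<union> g ` T"
  let ?a = "\<lambda>y. real (card {s\<in>S. f s = y})"
  let ?b = "\<lambda>y. real (card {t\<in>T. g t = y})"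
  have "(\<Sum>y\<in>?Y. ?a y * ?b y)\<^sup>2 \<le> (\<Sum>y\<in>?Y. (?a y)\<^sup>2) * (\<Sum>y\<in>?Y. (?b y)\<^sup>2)"
    by (rule Cauchy_Schwarz_ineq_sum)
  moreover have "(\<Sum>y\<in>?Y. ?a y * ?b y) = card {(s, t) \<in> S \<times> T. f s = g t}"
    unfolding card_common_values[OF assms] by simp
  moreover have "(\<Sum>y\<in>?Y. (?a y)\<^sup>2) = card {(s, s') \<in> S \<times> S. f s = f s'}"
    using sum_card_fibres_square[of S ?Y f] assms by (simp flip: of_nat_sum of_nat_power)
  moreover have "(\<Sum>y\<in>?Y. (?b y)\<^sup>2) = card {(t, t') \<in> T \<times> T. g t = g t'}"
    using sum_card_fibres_square[of T ?Y g] assms by (simp flip: of_nat_sum of_nat_power)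
  ultimately have "real ((card {(s, t) \<in> S \<times> T. f s = g t})\<^sup>2)
    \<le> real (card {(s, s') \<in> S \<times> S. f s = f s'} * card {(t, t') \<in> T \<times> T. g t = g t'})"
    by simp
  then show ?thesis by (simp only: of_nat_le_iff)
qed

text \<open>Telescoping, from 1/k^2 \<le> 1/(k - 1) - 1/k.\<close>

lemma sum_inverse_squares_le:
  assumes "0 < n"
  shows "(\<Sum>k\<in>{n<..n + m}. 1 / (real k)\<^sup>2) \<le> 1 / real n - 1 / (real n + real m)"
proof (induction m)
  case (Suc m)
  have "{n<..n + Suc m} = insert (n + Suc m) {n<..n + m}" by auto
  then have "(\<Sum>k\<in>{n<..n + Suc m}. 1 / (real k)\<^sup>2) \<le> 1 / (real (n + Suc m))\<^sup>2 + (1 / n - 1 / (n + m))"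
    using Suc by simp
  also have "1 / (real (n + Suc m))\<^sup>2 \<le> 1 / (real (n + m) * real (n + Suc m))"
    using assms by (intro divide_left_mono) (auto simp: power2_eq_square)
  also have "\<dots> = 1 / (n + m) - 1 / (n + Suc m)"
    using assms by (simp add: field_simps)
  finally show ?case by (simp add: add_ac)
qed simp

text \<open>The two bounds x and T/k^2 cross at q = \<surd>(T/x). The terms up to q, rounded up,
  give at most 2qx, the tail at most T/q, and both qx and T/q equal \<surd>(xT). The hypothesis x
  \<le> T makes q \<ge> 1, so that rounding up at most doubles it.\<close>

lemma sum_le_of_truncated_inverse_square:
  fixes c :: "nat \<Rightarrow> real"
  assumes "0 < x" and xT: "x \<le> T" and c1: "\<And>k. c k \<le> x" and c2: "\<And>k. 0 < k \<Longrightarrow> c k * (real k)\<^sup>2 \<le> T"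
    and nonneg: "\<And>k. 0 \<le> c k"
  shows "(\<Sum>k=1..M. c k) \<le> 3 * sqrt (x * T)"
proof -
  define q where "q = sqrt (T / x)"
  have q1: "1 \<le> q" using assms by (simp add: q_def)
  define n where "n = nat \<lceil>q\<rceil>"
  have n: "q \<le> n" "n \<le> 2 * q" "0 < n" using q1 by (simp_all add: n_def) linarith+
  have "(\<Sum>k=1..M. c k) \<le> (\<Sum>k\<in>{1..n} \<union> {n<..n + M}. c k)"
    by (rule sum_mono2) (auto simp: nonneg)
  also have "\<dots> = (\<Sum>k\<in>{1..n}. c k) + (\<Sum>k\<in>{n<..n + M}. c k)"
    by (rule sum.union_disjoint) auto
  also have "(\<Sum>k\<in>{1..n}. c k) \<le> n * x"
    using sum_mono[of "{1..n}" c "\<lambda>_. x"] c1 by simp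
  also have "(\<Sum>k\<in>{n<..n + M}. c k) \<le> (\<Sum>k\<in>{n<..n + M}. T * (1 / (real k)\<^sup>2))"
    by (rule sum_mono) (use c2 in \<open>auto simp: field_simps\<close>)
  also have "\<dots> = T * (\<Sum>k\<in>{n<..n + M}. 1 / (real k)\<^sup>2)" by (simp add: sum_distrib_left)
  also have "\<dots> \<le> T * (1 / n)"
  proof (rule mult_left_mono)
    have "(\<Sum>k\<in>{n<..n + M}. 1 / (real k)\<^sup>2) \<le> 1 / real n - 1 / (real n + real M)"
      by (rule sum_inverse_squares_le) (rule n)
    also have "\<dots> \<le> 1 / n" by simp
    finally show "(\<Sum>k\<in>{n<..n + M}. 1 / (real k)\<^sup>2) \<le> 1 / n" .
  qed (use assms in linarith)
  also have "T * (1 / n) \<le> T / q"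
    using n q1 assms by (simp add: frac_le)
  finally have "(\<Sum>k=1..M. c k) \<le> n * x + T / q" by simp
  moreover have "real n * x \<le> 2 * (q * x)" using n assms by simp
  moreover have "q * x = sqrt (x * T)"
    using assms by (simp add: q_def real_sqrt_divide real_sqrt_mult field_simps)
  moreover have "T / q = sqrt (x * T)"
  proof -
    have "sqrt T * sqrt T = T" "sqrt T > 0" "sqrt x > 0" using assms by auto
    then show ?thesis
      by (simp add: q_def real_sqrt_divide real_sqrt_mult field_simps)
  qed
  ultimately show ?thesis by linarith
qed

context prime_modulus begin

definition mult_energy :: "int set \<Rightarrow> int set \<Rightarrow> nat" where
  "mult_energy X D = card {(s, t) \<in> (X \<times> D) \<times> (X \<times> D). fst s * snd s mod p = fst t * snd t mod p}"

text \<open>\<open>q (u, v)\<close> is the quotient v/u. The equation xd = x'd' becomes x'/x = d/d',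
  which separates the variables of the two sets.\<close>

lemma ex_quotient:
  "\<exists>q :: int \<times> int \<Rightarrow> int. \<forall>x\<in>F - {0}. \<forall>x'\<in>F - {0}. \<forall>d\<in>F - {0}. \<forall>d'\<in>F - {0}.
    x * d mod p = x' * d' mod p \<longleftrightarrow> q (x, x') = q (d', d)"
proof -
  have "\<exists>w. \<forall>u\<in>F - {0}. [u * w u = 1] (mod p)"
  proof (rule bchoice, rule ballI)
    fix u assume "u \<in> F - {0}"
    then have "coprime u p" using not_dvd_F[of u] prime_imp_coprime[OF prime_p] coprime_commute by blast
    then show "\<exists>w. [u * w = 1] (mod p)" using cong_solve_coprime_int by blast
  qed
  then obtain w where w: "\<And>u. u \<in> F \<Longrightarrow> u \<noteq> 0 \<Longrightarrow> [u * w u = 1] (mod p)" by blast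
  have key: "[v = l * u] (mod p)" if "u \<in> F" "u \<noteq> 0" "[w u * v = l] (mod p)" for u v l
  proof -
    have "[l * u = (w u * v) * u] (mod p)" by (rule cong_scalar_right[OF cong_sym[OF that(3)]])
    also have "(w u * v) * u = (u * w u) * v" by simp
    also have "[\<dots> = 1 * v] (mod p)" using w that by (intro cong_scalar_right) auto
    finally show ?thesis by (simp add: cong_sym)
  qed
  show ?thesis
  proof (intro exI[of _ "\<lambda>(u, v). w u * v mod p"] ballI)
    fix x x' d d' assume nz: "x \<in> F - {0}" "x' \<in> F - {0}" "d \<in> F - {0}" "d' \<in> F - {0}"
    show "x * d mod p = x' * d' mod p \<longleftrightarrow> (case (x, x') of (u, v) \<Rightarrow> w u * v mod p) = (case (d', d) of (u, v) \<Rightarrow> w u * v mod p)"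
    proof
      assume "x * d mod p = x' * d' mod p"
      then have e: "[x * d = x' * d'] (mod p)" by (simp add: cong_def)
      have "[w x * x' = w x * x' * (d' * w d')] (mod p)"
        using cong_mult[OF cong_refl w[of d'], of "w x * x'"] nz by (simp add: cong_sym)
      also have "w x * x' * (d' * w d') = (x' * d') * (w x * w d')" by simp
      also have "[\<dots> = (x * d) * (w x * w d')] (mod p)" by (rule cong_scalar_right[OF cong_sym[OF e]])
      also have "(x * d) * (w x * w d') = (x * w x) * (w d' * d)" by simp
      also have "[\<dots> = 1 * (w d' * d)] (mod p)" using nz w by (intro cong_scalar_right) auto
      finally show "(case (x, x') of (u, v) \<Rightarrow> w u * v mod p) = (case (d', d) of (u, v) \<Rightarrow> w u * v mod p)"
        by (simp add: cong_def)
    next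
      assume "(case (x, x') of (u, v) \<Rightarrow> w u * v mod p) = (case (d', d) of (u, v) \<Rightarrow> w u * v mod p)"
      then have e: "[w x * x' = w d' * d] (mod p)" by (simp add: cong_def)
      have 1: "[x' = (w d' * d) * x] (mod p)" using key e nz by blast
      have 2: "[d = (w d' * d) * d'] (mod p)" using key[of d' d] nz by simp
      have "[x * d = x * ((w d' * d) * d')] (mod p)" using 2 by (rule cong_scalar_left)
      also have "x * ((w d' * d) * d') = (w d' * d) * x * d'" by simp
      also have "[\<dots> = x' * d'] (mod p)" using cong_sym[OF 1] by (rule cong_scalar_right)
      finally show "x * d mod p = x' * d' mod p" by (simp add: cong_def)
    qed
  qed
qed

text \<open>In the form x'/x = d/d' the energy counts common values of two functions, one on pairs
  from \<open>X\<close> and one on pairs from \<open>D\<close>; Cauchy-Schwarz then separates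
  them.\<close>

lemma mult_energy_le:
  assumes "X \<subseteq> F - {0}" "D \<subseteq> F - {0}"
  shows "(mult_energy X D)\<^sup>2 \<le> mult_energy X X * mult_energy D D"
proof -
  obtain q :: "int \<times> int \<Rightarrow> int" where q: "\<forall>x\<in>F - {0}. \<forall>x'\<in>F - {0}. \<forall>d\<in>F - {0}. \<forall>d'\<in>F - {0}.
    x * d mod p = x' * d' mod p \<longleftrightarrow> q (x, x') = q (d', d)" using ex_quotient by (rule exE)
  have fin: "finite Y" if "Y \<subseteq> F - {0}" for Y by (rule finite_subset[OF that]) simp
  have eq: "mult_energy X Y = card {(s, t) \<in> (X \<times> X) \<times> (Y \<times> Y). q s = q t}"
    if XY: "X \<subseteq> F - {0}" "Y \<subseteq> F - {0}" for X Y
  proof -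
    have *: "x * d mod p = x' * d' mod p \<longleftrightarrow> q (x, x') = q (d', d)" if "x \<in> X" "x' \<in> X" "d \<in> Y" "d' \<in> Y" for x x' d d'
      by (intro q[rule_format] subsetD[OF XY(1)] subsetD[OF XY(2)] that)
    define A where "A = {(s, t) \<in> (X \<times> Y) \<times> (X \<times> Y). fst s * snd s mod p = fst t * snd t mod p}"
    define B where "B = {(s, t) \<in> (X \<times> X) \<times> (Y \<times> Y). q s = q t}"
    have A: "((x, d), (x', d')) \<in> A \<longleftrightarrow> x \<in> X \<and> d \<in> Y \<and> x' \<in> X \<and> d' \<in> Y \<and> q (x, x') = q (d', d)" for x d x' d'
      unfolding A_def using *[of x x' d d'] by (simp only: mem_Collect_eq case_prod_conv mem_Times_iff fst_conv snd_conv) blast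
    have B: "((x, x'), (d', d)) \<in> B \<longleftrightarrow> x \<in> X \<and> d \<in> Y \<and> x' \<in> X \<and> d' \<in> Y \<and> q (x, x') = q (d', d)" for x d x' d'
      unfolding B_def by (simp only: mem_Collect_eq case_prod_conv mem_Times_iff fst_conv snd_conv) blast
    have "bij_betw (\<lambda>((x, d), (x', d')). ((x, x'), (d', d))) A B"
    proof (rule bij_betw_byWitness[where f' = "\<lambda>((x, x'), (d', d)). ((x, d), (x', d'))"])
    qed (auto simp: A B)
    then have "bij_betw (\<lambda>((x, d), (x', d')). ((x, x'), (d', d)))
      {(s, t) \<in> (X \<times> Y) \<times> (X \<times> Y). fst s * snd s mod p = fst t * snd t mod p}
      {(s, t) \<in> (X \<times> X) \<times> (Y \<times> Y). q s = q t}" unfolding A_def B_def .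
    then show ?thesis unfolding mult_energy_def by (rule bij_betw_same_card)
  qed
  show ?thesis unfolding eq[OF assms] eq[OF assms(1,1)] eq[OF assms(2,2)]
    by (rule card_common_values_le) (intro finite_cartesian_product fin assms)+
qed

text \<open>Three of the four variables determine the last one, zero being excluded.\<close>

lemma mult_energy_self_le:
  assumes "D \<subseteq> F - {0}"
  shows "mult_energy D D \<le> card D ^ 3"
proof -
  let ?S = "{(s, t) \<in> (D \<times> D) \<times> (D \<times> D). fst s * snd s mod p = fst t * snd t mod p}"
  have fin: "finite D" using assms finite_F_subset by blast
  have "card ?S \<le> card ((D \<times> D) \<times> D)"
  proof (rule card_inj_on_le[of "\<lambda>(s, t). (s, fst t)"])
    show "inj_on (\<lambda>(s, t). (s, fst t)) ?S"
    proof (rule inj_onI, clarsimp)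
      fix x d x' d' e' assume *: "x' \<in> D" "d' \<in> D" "e' \<in> D" "x' * d' mod p = x' * e' mod p"
      then have "\<not> p dvd x'" using assms not_dvd_F[of x'] by blast
      then show "d' = e'" using mult_cancel_F * assms by blast
    qed
  qed (use fin in auto)
  then show ?thesis by (simp add: mult_energy_def card_cartesian_product power3_eq_cube)
qed

text \<open>A solution of au = dv yields a common point of aX and dX; for given \<open>a\<close> and
  \<open>d\<close>, this point determines \<open>u\<close> and \<open>v\<close>.\<close>

lemma mult_energy_le_sum_intersections:
  assumes X: "X \<subseteq> F - {0}"
  shows "mult_energy X X \<le> (\<Sum>d\<in>X. \<Sum>a\<in>X. card (a \<star> X \<inter> d \<star> X))"
proof -
  have fin: "finite X" using X finite_F_subset by blast
  let ?S = "{(s, t) \<in> (X \<times> X) \<times> (X \<times> X). fst s * snd s mod p = fst t * snd t mod p}"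
  let ?T = "SIGMA d:X. SIGMA a:X. a \<star> X \<inter> d \<star> X"
  have "card ?S \<le> card ?T"
  proof (rule card_inj_on_le[of "\<lambda>(s, t). (fst t, fst s, fst s * snd s mod p)"])
    show "inj_on (\<lambda>(s, t). (fst t, fst s, fst s * snd s mod p)) ?S"
    proof (rule inj_onI)
      fix x y assume x: "x \<in> ?S" and y: "y \<in> ?S"
        and e: "(\<lambda>(s, t). (fst t, fst s, fst s * snd s mod p)) x = (\<lambda>(s, t). (fst t, fst s, fst s * snd s mod p)) y"
      obtain a u d v where x': "x = ((a, u), (d, v))" by (metis surj_pair)
      obtain a' u' d' v' where y': "y = ((a', u'), (d', v'))" by (metis surj_pair)
      have *: "a \<in> X" "u \<in> X" "d \<in> X" "v \<in> X" "a * u mod p = d * v mod p"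
        "u' \<in> X" "v' \<in> X" "a * u' mod p = d * v' mod p" "a' = a" "d' = d" "a * u mod p = a * u' mod p"
        using x y e by (auto simp: x' y')
      have nd: "\<not> p dvd a" "\<not> p dvd d" using not_dvd_F * X by blast+
      have "u = u'" by (rule mult_cancel_F[OF nd(1)]) (use * X in blast)+
      moreover have "v = v'" by (rule mult_cancel_F[OF nd(2)]) (use * X \<open>u = u'\<close> in \<open>simp_all add: subset_iff\<close>)
      ultimately show "x = y" by (simp add: x' y' *)
    qed
    show "(\<lambda>(s, t). (fst t, fst s, fst s * snd s mod p)) ` ?S \<subseteq> ?T"
    proof (clarsimp, intro conjI)
      fix a u d v assume "a \<in> X" "u \<in> X" "d \<in> X" "v \<in> X" and e: "a * u mod p = d * v mod p"
      then show "d * v mod p \<in> a \<star> X" "d * v mod p \<in> d \<star> X" using dilI[of u X a] dilI[of v X d] by simp_all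
    qed
  qed (use fin in auto)
  also have "card ?T = (\<Sum>d\<in>X. card (SIGMA a:X. a \<star> X \<inter> d \<star> X))"
    by (rule card_SigmaI) (use fin in auto)
  also have "\<dots> = (\<Sum>d\<in>X. \<Sum>a\<in>X. card (a \<star> X \<inter> d \<star> X))"
    by (intro sum.cong card_SigmaI) (use fin in auto)
  finally show ?thesis by (simp add: mult_energy_def)
qed

text \<open>Let P be the set of such \<open>a\<close>. The pivot makes |P|^2 at most twice the size
  of e(P + P) + fP, where e and f are differences of elements of P. Enlarging P to X, the bounds on
  iterated sumsets cost K^3 to remove one copy of eX and K^8 |X|^5 / N^4 to bound |eX + fX|.\<close>

lemma many_intersecting_dilates_le:
  fixes K :: real
  assumes X: "X \<subseteq> F - {0}" and le: "int ((card X)\<^sup>2) \<le> p" and d: "d \<in> X"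
    and K: "real (card (X \<boxplus> -1 \<star> X)) \<le> K * card X" and N: "0 < N"
  shows "(real (card {a \<in> X. N \<le> card (a \<star> X \<inter> d \<star> X)}))\<^sup>2 * N ^ 4 \<le> 2 * K ^ 11 * card X ^ 5"
proof -
  define P where "P = {a \<in> X. N \<le> card (a \<star> X \<inter> d \<star> X)}"
  have XF: "X \<subseteq> F" using X by blast
  have fin: "finite X" using XF finite_F_subset by blast
  have PX: "P \<subseteq> X" by (auto simp: P_def)
  have PF: "P \<subseteq> F" using PX XF by blast
  have Xne: "X \<noteq> {}" using d by blast
  have x0: "0 < card X" using Xne fin by (simp add: card_gt_0_iff)
  have nd: "\<not> p dvd a" if "a \<in> X" for a using not_dvd_F X that by blast
  have nX: "card (-1 \<star> X) = card X" by (rule card_dil) (use p_gt_1 XF in auto)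
  have "card X \<le> card (X \<boxplus> -1 \<star> X)"
    using card_sumset_ge[of "-1 \<star> X" X] Xne nX by simp
  then have "real (card X) \<le> K * card X" using K by linarith
  then have K1: "1 \<le> K" using x0 by simp
  show ?thesis
  proof (cases "2 \<le> card P")
    \<comment> \<open>The pivot needs two elements. With at most one, N \<le> |X| suffices.\<close>
    case False
    have NX: "N \<le> card X" if "a \<in> P" for a
    proof -
      have "N \<le> card (a \<star> X \<inter> d \<star> X)" using that by (simp add: P_def)
      also have "\<dots> \<le> card (d \<star> X)" by (rule card_mono) auto
      finally show ?thesis using card_dil[OF nd[OF d] XF] by simp
    qed
    have "(real (card P))\<^sup>2 * N ^ 4 \<le> real (card X) ^ 5"
    proof (cases "P = {}")
      case False
      then obtain a where "a \<in> P" by blast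
      have "(real (card P))\<^sup>2 \<le> 1" using \<open>\<not> 2 \<le> card P\<close> by (simp add: power_le_one)
      moreover have "real N ^ 4 \<le> real (card X) ^ 4" using NX[OF \<open>a \<in> P\<close>] by (intro power_mono) auto
      ultimately have "(real (card P))\<^sup>2 * N ^ 4 \<le> 1 * real (card X) ^ 4" by (intro mult_mono) auto
      also have "\<dots> \<le> real (card X) ^ 5" using x0 by (simp add: power_increasing)
      finally show ?thesis .
    qed simp
    also have "\<dots> \<le> (2 * K ^ 11) * card X ^ 5"
      using one_le_power[OF K1, of 11] mult_right_mono[of 1 "2 * K ^ 11" "real (card X) ^ 5"] by simp
    finally show ?thesis by (simp add: P_def)
  next
    case True
    have "card P \<le> card X" using PX fin by (rule card_mono[rotated])
    then have "(card P)\<^sup>2 \<le> (card X)\<^sup>2" by (rule power_mono) simp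
    then have "int ((card P)\<^sup>2) \<le> p" using le by linarith
    then obtain a1 a2 a3 a4 where a: "a1 \<in> P" "a2 \<in> P" "a3 \<in> P" "a4 \<in> P" "a3 \<noteq> a4"
      and piv: "(card P)\<^sup>2 \<le> 2 * card ((a3 - a4) \<star> (P \<boxplus> P) \<boxplus> (a1 - a2) \<star> P)"
      using pivot[OF PF True] by blast
    define e f where "e = a3 - a4" and "f = a1 - a2"
    have nde: "\<not> p dvd e" unfolding e_def by (rule not_dvd_diff_F) (use a PF in blast)+
    define S2 where "S2 = card (X \<boxplus> -1 \<star> X \<boxplus> (X \<boxplus> -1 \<star> X))"
    define M where "M = card (e \<star> X \<boxplus> f \<star> X)"
    \<comment> \<open>Triangle inequality with eX in the middle: it reduces e(X + X) + fX to eX +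
      fX, at the price of |X + X - X| / |X|.\<close>
    have "card X * card (e \<star> (P \<boxplus> P) \<boxplus> f \<star> P) \<le> card X * card (e \<star> (X \<boxplus> X) \<boxplus> f \<star> X)"
      using PX by (intro mult_left_mono card_mono sumset_mono dil_mono) auto
    also have "\<dots> = card (e \<star> X) * card (e \<star> (X \<boxplus> X) \<boxplus> f \<star> X)" by (simp add: card_dil[OF nde XF])
    also have "\<dots> \<le> card (e \<star> (X \<boxplus> X) \<boxplus> -1 \<star> (e \<star> X)) * card (e \<star> X \<boxplus> f \<star> X)"
      by (rule ruzsa_triangle) auto
    also have "e \<star> (X \<boxplus> X) \<boxplus> -1 \<star> (e \<star> X) = e \<star> (X \<boxplus> -1 \<star> X \<boxplus> X)"
      by (simp add: dil_sumset dil_dil sumset_ac)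
    also have "card \<dots> = card (X \<boxplus> -1 \<star> X \<boxplus> X)" by (simp add: card_dil[OF nde])
    finally have "card X * card (e \<star> (P \<boxplus> P) \<boxplus> f \<star> P) \<le> card (X \<boxplus> -1 \<star> X \<boxplus> X) * M"
      by (simp add: M_def)
    then have "real (card X) * card (e \<star> (P \<boxplus> P) \<boxplus> f \<star> P) \<le> real (card (X \<boxplus> -1 \<star> X \<boxplus> X)) * M"
      unfolding of_nat_mult [symmetric] of_nat_le_iff .
    also have "\<dots> \<le> (K ^ 3 * card X) * M"
      using pluennecke(1)[OF XF Xne K] by (rule mult_right_mono) simp
    finally have "real (card X) * card (e \<star> (P \<boxplus> P) \<boxplus> f \<star> P) \<le> real (card X) * (K ^ 3 * M)"
      by (simp add: mult_ac)
    then have 1: "real (card (e \<star> (P \<boxplus> P) \<boxplus> f \<star> P)) \<le> K ^ 3 * M" using x0 by simp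
    have "(real (card P))\<^sup>2 \<le> 2 * real (card (e \<star> (P \<boxplus> P) \<boxplus> f \<star> P))"
      using piv unfolding e_def f_def by (metis of_nat_le_iff of_nat_mult of_nat_numeral of_nat_power)
    then have P2: "(real (card P))\<^sup>2 \<le> 2 * (K ^ 3 * M)" using 1 by linarith
    \<comment> \<open>Every element of \<open>P\<close> has a dilate overlapping dX in at least
      \<open>N\<close> points, which is what the exchange of dilates needs.\<close>
    have "N ^ 4 * M \<le> card (X \<boxplus> -1 \<star> X) ^ 4 * S2"
      unfolding M_def S2_def e_def f_def
      by (rule card_two_dilates[where d = d and P = P]) (use XF nd d a PX in \<open>auto simp: P_def\<close>)
    then have "real N ^ 4 * M \<le> real (card (X \<boxplus> -1 \<star> X)) ^ 4 * S2"
      by (metis of_nat_le_iff of_nat_mult of_nat_power)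
    also have "\<dots> \<le> (K * card X) ^ 4 * (K ^ 4 * card X)"
      unfolding S2_def using K pluennecke(2)[OF XF Xne K] K1 by (intro mult_mono power_mono) auto
    also have "\<dots> = K ^ 8 * card X ^ 5" by (simp add: power_mult_distrib power_eq_if)
    finally have M4: "real N ^ 4 * M \<le> K ^ 8 * card X ^ 5" .
    have "(real (card P))\<^sup>2 * N ^ 4 \<le> (2 * (K ^ 3 * M)) * N ^ 4" by (rule mult_right_mono[OF P2]) simp
    also have "\<dots> = (2 * K ^ 3) * (N ^ 4 * M)" by simp
    also have "\<dots> \<le> (2 * K ^ 3) * (K ^ 8 * card X ^ 5)"
      using M4 K1 by (intro mult_left_mono) auto
    also have "\<dots> = 2 * K ^ 11 * card X ^ 5" by (simp add: power_add[symmetric] mult.assoc[symmetric])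
    finally show ?thesis by (simp add: P_def)
  qed
qed

text \<open>For fixed \<open>d\<close>, the number of \<open>a\<close> whose dilate meets dX in at
  least N points is at most min(|X|, T/N^2). Summation over N gives at most 3\<surd>(|X|T) for each
  \<open>d\<close>, so the energy is at most 3|X|\<surd>(|X|T); its fourth power contains 81 T^2,
  and T^2 = 2 K^11 |X|^5.\<close>

lemma mult_energy_le_if_small_difference_set:
  fixes K :: real
  assumes X: "X \<subseteq> F - {0}" and le: "int ((card X)\<^sup>2) \<le> p"
    and K: "real (card (X \<boxplus> -1 \<star> X)) \<le> K * card X"
  shows "real (mult_energy X X) ^ 4 \<le> 162 * K ^ 11 * card X ^ 11"
proof (cases "X = {}")
  case True then show ?thesis by (simp add: mult_energy_def)
next
  case False
  have XF: "X \<subseteq> F" using X by blast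
  have fin: "finite X" using XF finite_F_subset by blast
  define x where "x = real (card X)"
  have x1: "1 \<le> x" using False fin by (simp add: x_def Suc_le_eq card_gt_0_iff)
  have "card (-1 \<star> X) = card X" by (rule card_dil) (use p_gt_1 XF in auto)
  then have "card X \<le> card (X \<boxplus> -1 \<star> X)"
    using card_sumset_ge[of "-1 \<star> X" X] False by simp
  then have "x \<le> K * x" using K by (simp add: x_def)
  then have K1: "1 \<le> K" using x1 by simp
  define T where "T = sqrt (2 * K ^ 11 * x ^ 5)"
  have T0: "0 \<le> T" by (simp add: T_def) (use K1 x1 in auto)
  have TT: "T\<^sup>2 = 2 * K ^ 11 * x ^ 5" using K1 x1 by (simp add: T_def)
  have "x\<^sup>2 \<le> x ^ 5" using x1 by (intro power_increasing) auto
  also have "\<dots> \<le> (2 * K ^ 11) * x ^ 5"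
    using one_le_power[OF K1, of 11] x1 mult_right_mono[of 1 "2 * K ^ 11" "x ^ 5"] by simp
  finally have xT: "x \<le> T" unfolding T_def by (rule real_le_rsqrt)
  have row: "real (\<Sum>a\<in>X. card (a \<star> X \<inter> d \<star> X)) \<le> 3 * sqrt (x * T)" if d: "d \<in> X" for d
  proof -
    define c where "c N = real (card {a \<in> X. N \<le> card (a \<star> X \<inter> d \<star> X)})" for N
    have le_x: "card (a \<star> X \<inter> d \<star> X) \<le> card X" for a
    proof -
      have "card (a \<star> X \<inter> d \<star> X) \<le> card (d \<star> X)" by (rule card_mono) auto
      also have "\<dots> \<le> card X" unfolding dil_def by (rule card_image_le[OF fin])
      finally show ?thesis .
    qed
    \<comment> \<open>The size of an overlap is the number of thresholds N \<ge> 1 that it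
      reaches.\<close>
    have "real (\<Sum>a\<in>X. card (a \<star> X \<inter> d \<star> X)) = (\<Sum>a\<in>X. \<Sum>N=1..card X. if N \<le> card (a \<star> X \<inter> d \<star> X) then 1 else 0)"
    proof (simp add: sum.If_cases, rule sum.cong[OF refl])
      fix a
      have "{Suc 0..card X} \<inter> {N. N \<le> card (a \<star> X \<inter> d \<star> X)} = {1..card (a \<star> X \<inter> d \<star> X)}"
        using le_x[of a] by auto
      then show "real (card (a \<star> X \<inter> d \<star> X)) = real (card ({Suc 0..card X} \<inter> {N. N \<le> card (a \<star> X \<inter> d \<star> X)}))"
        by simp
    qed
    also have "\<dots> = (\<Sum>N=1..card X. \<Sum>a\<in>X. if N \<le> card (a \<star> X \<inter> d \<star> X) then 1 else 0)"
      by (rule sum.swap)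
    also have "\<dots> = (\<Sum>N=1..card X. c N)"
      by (intro sum.cong) (auto simp: c_def sum.If_cases[OF fin] Int_def)
    also have "\<dots> \<le> 3 * sqrt (x * T)"
    proof (rule sum_le_of_truncated_inverse_square)
      fix N
      show "c N \<le> x" unfolding c_def x_def by (simp add: card_mono fin)
      show "c N * (real N)\<^sup>2 \<le> T" if "0 < N"
      proof -
        have "(c N * (real N)\<^sup>2)\<^sup>2 = (c N)\<^sup>2 * real N ^ 4" by (simp add: power_mult_distrib flip: power_mult)
        also have "\<dots> \<le> 2 * K ^ 11 * x ^ 5"
          using many_intersecting_dilates_le[OF X le d K that] by (simp add: c_def x_def)
        finally show ?thesis unfolding T_def by (rule real_le_rsqrt)
      qed
    qed (use x1 xT in \<open>auto simp: c_def\<close>)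
    finally show ?thesis .
  qed
  have "real (mult_energy X X) \<le> real (\<Sum>d\<in>X. \<Sum>a\<in>X. card (a \<star> X \<inter> d \<star> X))"
    using mult_energy_le_sum_intersections[OF X] by (simp only: of_nat_le_iff)
  also have "\<dots> = (\<Sum>d\<in>X. real (\<Sum>a\<in>X. card (a \<star> X \<inter> d \<star> X)))" by simp
  also have "\<dots> \<le> (\<Sum>d\<in>X. 3 * sqrt (x * T))" by (rule sum_mono) (rule row)
  also have "\<dots> = x * (3 * sqrt (x * T))" by (simp add: x_def)
  finally have "real (mult_energy X X) ^ 4 \<le> (x * (3 * sqrt (x * T))) ^ 4" by (rule power_mono) simp
  also have "\<dots> = 81 * x ^ 4 * ((sqrt (x * T))\<^sup>2)\<^sup>2" by (simp add: power_mult_distrib flip: power_mult)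
  also have "\<dots> = 81 * x ^ 6 * T\<^sup>2" using x1 T0 by (simp add: power_mult_distrib flip: power_add)
  also have "\<dots> = 162 * K ^ 11 * x ^ 11" unfolding TT by (simp flip: power_add)
  finally show ?thesis by (simp add: x_def)
qed

subsection \<open>Balog-Szemeredi-Gowers\<close>

text \<open>Read B as the edge condition of a graph joining a residue x to those u in Y with x - u
  in B. The neighbourhood of a suitable x is large and most of its pairs have many common
  neighbours. After the exceptional vertices are deleted, every difference has many representations
  by four elements of B, so there are few differences.\<close>

lemma balog_szemeredi_gowers:
  fixes \<kappa> :: real
  assumes B: "B \<subseteq> F" "B \<noteq> {}" and Y: "Y \<subseteq> F" "Y \<noteq> {}" and \<kappa>: "0 < \<kappa>"
    and energy: "\<kappa> * card B * (real (card Y))\<^sup>2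
      \<le> card {(s, t) \<in> (B \<times> Y) \<times> (B \<times> Y). (fst s + snd s) mod p = (fst t + snd t) mod p}"
  shows "\<exists>Z\<subseteq>Y. Z \<noteq> {} \<and> \<kappa> * card Y \<le> 8 * card Z \<and>
    card (Z \<boxplus> -1 \<star> Z) * card Z * \<kappa>\<^sup>2 \<le> 512 * (real (card B))\<^sup>2"
proof -
  have fin: "finite B" "finite Y" using B Y finite_F_subset by auto
  have b0: "0 < card B" and y0: "0 < card Y" using fin B Y by (auto simp: card_gt_0_iff)
  define b y where "b = real (card B)" and "y = real (card Y)"
  have by0: "0 < b" "0 < y" using b0 y0 by (simp_all add: b_def y_def)
  define S where "S x = {u \<in> Y. (x - u) mod p \<in> B}" for x
  define R where "R u v = {x \<in> F. u \<in> S x \<and> v \<in> S x}" for u v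
  \<comment> \<open>With 1/16, the weight 8 on bad pairs costs half of the energy; the term for
    small neighbourhoods costs a quarter, and a quarter is left over.\<close>
  define \<rho> where "\<rho> = \<kappa> / 16"
  have finS: "finite (S x)" for x using fin by (simp add: S_def)
  have finR: "finite (R u v)" for u v by (rule finite_subset[of _ F]) (auto simp: R_def)
  have SY: "S x \<subseteq> Y" for x by (auto simp: S_def)
  have fibre: "card {s \<in> B \<times> Y. (fst s + snd s) mod p = x} = card (S x)" if "x \<in> F" for x
  proof -
    have "bij_betw snd {s \<in> B \<times> Y. (fst s + snd s) mod p = x} (S x)"
    proof (rule bij_betw_byWitness[where f' = "\<lambda>u. ((x - u) mod p, u)"])
      show "\<forall>s\<in>{s \<in> B \<times> Y. (fst s + snd s) mod p = x}. ((x - snd s) mod p, snd s) = s"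
      proof clarsimp
        fix c u assume "c \<in> B"
        then show "((c + u) mod p - u) mod p = c" using B by (auto simp: mod_simps)
      qed
      show "snd ` {s \<in> B \<times> Y. (fst s + snd s) mod p = x} \<subseteq> S x"
      proof clarsimp
        fix c u assume "c \<in> B" "u \<in> Y"
        moreover have "((c + u) mod p - u) mod p = c" using B \<open>c \<in> B\<close> by (auto simp: mod_simps)
        ultimately show "u \<in> S ((c + u) mod p)" by (simp add: S_def)
      qed
    qed (use that in \<open>auto simp: S_def mod_simps\<close>)
    then show ?thesis by (rule bij_betw_same_card)
  qed
  have im: "(\<lambda>s. (fst s + snd s) mod p) ` (B \<times> Y) \<subseteq> F" by auto
  have "(\<Sum>x\<in>F. card (S x)) = card (B \<times> Y)"
    using sum_card_fibres[OF _ _ im] fin fibre by simp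
  then have sum1: "(\<Sum>x\<in>F. real (card (S x))) = b * y"
    by (simp add: card_cartesian_product b_def y_def flip: of_nat_sum)
  have "(\<Sum>x\<in>F. (card (S x))\<^sup>2)
      = card {(s, t) \<in> (B \<times> Y) \<times> (B \<times> Y). (fst s + snd s) mod p = (fst t + snd t) mod p}"
    using sum_card_fibres_square[OF _ _ im] fin fibre by simp
  then have sum2: "(\<Sum>x\<in>F. (real (card (S x)))\<^sup>2) \<ge> \<kappa> * b * y\<^sup>2"
    using energy by (simp add: b_def y_def flip: of_nat_sum of_nat_power)
  \<comment> \<open>Pairs in the neighbourhood of \<open>x\<close> with few common neighbours.
    Summed over \<open>x\<close>, such a pair is counted once per common neighbour, hence fewer than
    \<rho>b times.\<close>
  define U where "U x = {(u, v) \<in> S x \<times> S x. real (card (R u v)) < \<rho> * b}" for x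
  have finU: "finite (U x)" for x by (rule finite_subset[of _ "S x \<times> S x"]) (auto simp: U_def finS)
  have "(\<Sum>x\<in>F. card (U x)) = card (SIGMA x:F. U x)"
    by (rule card_SigmaI[symmetric]) (auto simp: finU)
  also have "\<dots> = card ((\<lambda>(x, q). (q, x)) ` (SIGMA x:F. U x))"
    by (rule card_image[symmetric]) (auto simp: inj_on_def)
  also have "\<dots> \<le> card (SIGMA q:{q \<in> Y \<times> Y. real (card (R (fst q) (snd q))) < \<rho> * b}. R (fst q) (snd q))"
    by (rule card_mono) (use fin finR SY in \<open>auto simp: U_def R_def\<close>)
  also have "\<dots> = (\<Sum>q\<in>{q \<in> Y \<times> Y. real (card (R (fst q) (snd q))) < \<rho> * b}. card (R (fst q) (snd q)))"
    by (rule card_SigmaI) (use fin finR in auto)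
  finally have "(\<Sum>x\<in>F. card (U x)) \<le> (\<Sum>q\<in>{q \<in> Y \<times> Y. real (card (R (fst q) (snd q))) < \<rho> * b}. card (R (fst q) (snd q)))" .
  then have "(\<Sum>x\<in>F. real (card (U x))) \<le> (\<Sum>q\<in>{q \<in> Y \<times> Y. real (card (R (fst q) (snd q))) < \<rho> * b}. real (card (R (fst q) (snd q))))"
    by (simp flip: of_nat_sum)
  also have "\<dots> \<le> (\<Sum>q\<in>{q \<in> Y \<times> Y. real (card (R (fst q) (snd q))) < \<rho> * b}. \<rho> * b)"
    by (rule sum_mono) auto
  also have "\<dots> \<le> (\<Sum>q\<in>Y \<times> Y. \<rho> * b)"
    by (rule sum_mono2) (use fin \<kappa> by0 in \<open>auto simp: \<rho>_def\<close>)
  also have "\<dots> = y\<^sup>2 * (\<rho> * b)" by (simp add: card_cartesian_product y_def power2_eq_square)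
  finally have sumU: "(\<Sum>x\<in>F. real (card (U x))) \<le> y\<^sup>2 * (\<rho> * b)" .
  \<comment> \<open>The linear term forces |S x| \<ge> \<kappa>y/4, the other one forces at most |S
    x|^2 / 8 bad pairs.\<close>
  have "\<exists>x\<in>F. S x \<noteq> {} \<and> 8 * real (card (U x)) + (\<kappa> * y / 4) * card (S x) \<le> (real (card (S x)))\<^sup>2"
  proof (rule ccontr)
    assume na: "\<not> ?thesis"
    have "\<kappa> * b * y\<^sup>2 \<le> (\<Sum>x\<in>F. (real (card (S x)))\<^sup>2)" by (rule sum2)
    also have "\<dots> \<le> (\<Sum>x\<in>F. 8 * real (card (U x)) + (\<kappa> * y / 4) * card (S x))"
    proof (rule sum_mono)
      fix x assume "x \<in> F"
      show "(real (card (S x)))\<^sup>2 \<le> 8 * real (card (U x)) + (\<kappa> * y / 4) * card (S x)"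
      proof (cases "S x = {}")
        case False
        then have "\<not> 8 * real (card (U x)) + (\<kappa> * y / 4) * card (S x) \<le> (real (card (S x)))\<^sup>2"
          using na \<open>x \<in> F\<close> by blast
        then show ?thesis by linarith
      qed simp
    qed
    also have "\<dots> = 8 * (\<Sum>x\<in>F. real (card (U x))) + (\<kappa> * y / 4) * (b * y)"
      by (simp only: sum.distrib sum1[symmetric] sum_distrib_left)
    also have "\<dots> \<le> 8 * (y\<^sup>2 * (\<rho> * b)) + (\<kappa> * y / 4) * (b * y)" using sumU by simp
    also have "\<dots> = 3 / 4 * (\<kappa> * b * y\<^sup>2)" by (simp add: \<rho>_def power2_eq_square algebra_simps)
    finally have "\<kappa> * b * y\<^sup>2 \<le> 0" by simp
    moreover have "0 < \<kappa> * b * y\<^sup>2" using by0 \<kappa> by simp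
    ultimately show False by simp
  qed
  then obtain x where x: "S x \<noteq> {}"
    "8 * real (card (U x)) + (\<kappa> * y / 4) * card (S x) \<le> (real (card (S x)))\<^sup>2" by blast
  define n where "n = real (card (S x))"
  have n0: "0 < n" using x(1) finS by (simp add: n_def card_gt_0_iff)
  have "(\<kappa> * y / 4) * n \<le> n * n" using x(2) by (simp add: n_def power2_eq_square)
  then have n1: "\<kappa> * y / 4 \<le> n" using n0 by simp
  have "0 \<le> (\<kappa> * y / 4) * n" using \<kappa> by0 n0 by simp
  then have U8: "8 * real (card (U x)) \<le> n\<^sup>2" using x(2) unfolding n_def by linarith
  define bad where "bad u = {v \<in> S x. real (card (R u v)) < \<rho> * b}" for u
  \<comment> \<open>At most |S x|^2 / 8 bad pairs leave at most half of the vertices with more than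
    n/4 bad partners.\<close>
  define Z where "Z = {u \<in> S x. 4 * real (card (bad u)) \<le> n}"
  have ZS: "Z \<subseteq> S x" and ZY: "Z \<subseteq> Y" using SY by (auto simp: Z_def)
  have finZ: "finite Z" using ZS finS finite_subset by blast
  have "(\<Sum>u\<in>S x - Z. n / 4) \<le> (\<Sum>u\<in>S x - Z. real (card (bad u)))"
    by (rule sum_mono) (auto simp: Z_def)
  also have "\<dots> \<le> (\<Sum>u\<in>S x. real (card (bad u)))"
    by (rule sum_mono2) (use finS in auto)
  also have "\<dots> = real (card (SIGMA u:S x. bad u))"
    using finS by (subst card_SigmaI) (auto simp: bad_def)
  also have "(SIGMA u:S x. bad u) = U x" by (auto simp: bad_def U_def)
  finally have "card (S x - Z) * n \<le> 4 * real (card (U x))" by simp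
  then have "2 * (card (S x - Z) * n) \<le> n\<^sup>2" using U8 by linarith
  then have "(2 * card (S x - Z)) * n \<le> n * n" by (simp add: power2_eq_square mult_ac)
  then have "2 * card (S x - Z) \<le> n" using n0 by simp
  moreover have "real (card (S x - Z)) = n - card Z"
    using card_Diff_subset[OF finZ ZS] card_mono[OF finS ZS] by (simp add: n_def of_nat_diff)
  ultimately have Zn: "n \<le> 2 * card Z" by linarith
  have Zne: "Z \<noteq> {}" using Zn n0 by auto
  \<comment> \<open>Vertices forming a good pair with both \<open>z\<close> and \<open>z'\<close>;
    each of the two excludes at most n/4.\<close>
  define W where "W z z' = S x - bad z - bad z'" for z z'
  have Wn: "n / 2 \<le> card (W z z')" if "z \<in> Z" "z' \<in> Z" for z z'
  proof -
    have "S x \<subseteq> W z z' \<union> (bad z \<union> bad z')" by (auto simp: W_def)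
    then have "card (S x) \<le> card (W z z' \<union> (bad z \<union> bad z'))"
      by (intro card_mono) (auto simp: W_def bad_def finS)
    also have "\<dots> \<le> card (W z z') + (card (bad z) + card (bad z'))"
      by (meson add_left_mono card_Un_le le_trans)
    finally have "n \<le> real (card (W z z')) + (real (card (bad z)) + real (card (bad z')))"
      unfolding n_def by (simp flip: of_nat_add)
    moreover have "4 * real (card (bad z)) \<le> n" "4 * real (card (bad z')) \<le> n" using that by (auto simp: Z_def)
    ultimately show ?thesis by linarith
  qed
  have "\<exists>g. \<forall>e\<in>Z \<boxplus> -1 \<star> Z. fst (g e) \<in> Z \<and> snd (g e) \<in> Z \<and> e = (fst (g e) - snd (g e)) mod p"
  proof (rule bchoice, rule ballI)
    fix e assume "e \<in> Z \<boxplus> -1 \<star> Z"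
    then obtain z z' where "z \<in> Z" "z' \<in> Z" "e = (z - z') mod p"
      by (auto simp: sumset_iff bex_dil mod_simps)
    then show "\<exists>q. fst q \<in> Z \<and> snd q \<in> Z \<and> e = (fst q - snd q) mod p" by (intro exI[of _ "(z, z')"]) simp
  qed
  then obtain g where g: "\<And>e. e \<in> Z \<boxplus> -1 \<star> Z \<Longrightarrow> fst (g e) \<in> Z \<and> snd (g e) \<in> Z \<and> e = (fst (g e) - snd (g e)) mod p"
    by blast
  define T where "T e = (SIGMA w:W (fst (g e)) (snd (g e)). R (fst (g e)) w \<times> R (snd (g e)) w)" for e
  have finT: "finite (T e)" for e by (auto simp: T_def W_def finS finR)
  have Tcard: "(n / 2) * (\<rho> * b)\<^sup>2 \<le> card (T e)" if "e \<in> Z \<boxplus> -1 \<star> Z" for e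
  proof -
    have "(n / 2) * (\<rho> * b)\<^sup>2 \<le> card (W (fst (g e)) (snd (g e))) * (\<rho> * b)\<^sup>2"
      using Wn g[OF that] by (intro mult_right_mono) auto
    also have "\<dots> = (\<Sum>w\<in>W (fst (g e)) (snd (g e)). (\<rho> * b) * (\<rho> * b))" by (simp add: power2_eq_square)
    also have "\<dots> \<le> (\<Sum>w\<in>W (fst (g e)) (snd (g e)). real (card (R (fst (g e)) w)) * real (card (R (snd (g e)) w)))"
      by (intro sum_mono mult_mono) (use \<kappa> by0 in \<open>auto simp: W_def bad_def \<rho>_def\<close>)
    also have "\<dots> = card (T e)"
      unfolding T_def by (subst card_SigmaI) (auto simp: W_def finS finR card_cartesian_product)
    finally show ?thesis .
  qed
  \<comment> \<open>The identity used is z - z' = ((x1 - w) - (x1 - z)) - ((x2 - w) - (x2 - z')),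
    all four inner differences lying in \<open>B\<close>. They determine the difference
    \<open>e\<close>, hence its chosen z and z', and then x1, x2 and w.\<close>
  let ?h = "\<lambda>(e, w, x1, x2). ((x1 - fst (g e)) mod p, (x1 - w) mod p, (x2 - snd (g e)) mod p, (x2 - w) mod p)"
  have "card (SIGMA e:Z \<boxplus> -1 \<star> Z. T e) \<le> card (B \<times> B \<times> B \<times> B)"
  proof (rule card_inj_on_le[of ?h])
    show "inj_on ?h (SIGMA e:Z \<boxplus> -1 \<star> Z. T e)"
    proof (rule inj_onI)
      fix s t assume s: "s \<in> (SIGMA e:Z \<boxplus> -1 \<star> Z. T e)" and t: "t \<in> (SIGMA e:Z \<boxplus> -1 \<star> Z. T e)" and st: "?h s = ?h t"
      obtain e w x1 x2 where s': "s = (e, w, x1, x2)" by (metis surj_pair)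
      obtain e' w' y1 y2 where t': "t = (e', w', y1, y2)" by (metis surj_pair)
      have F1: "w \<in> F" "w' \<in> F" "x1 \<in> F" "x2 \<in> F" "y1 \<in> F" "y2 \<in> F"
        using s t Y SY unfolding s' t' T_def W_def R_def by blast+
      have e: "e \<in> Z \<boxplus> -1 \<star> Z" "e' \<in> Z \<boxplus> -1 \<star> Z" using s t unfolding s' t' by blast+
      have eqs: "(x1 - fst (g e)) mod p = (y1 - fst (g e')) mod p" "(x1 - w) mod p = (y1 - w') mod p"
        "(x2 - snd (g e)) mod p = (y2 - snd (g e')) mod p" "(x2 - w) mod p = (y2 - w') mod p"
        using st unfolding s' t' by auto
      have diff: "(((u - v) mod p - (u - z) mod p) - ((u' - v) mod p - (u' - z') mod p)) mod p = (z - z') mod p" for u u' v z z'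
      proof -
        have "[((u - v) mod p - (u - z) mod p) - ((u' - v) mod p - (u' - z') mod p)
          = ((u - v) - (u - z)) - ((u' - v) - (u' - z'))] (mod p)"
          by (intro cong_diff) (simp_all add: cong_def)
        then show ?thesis by (simp add: cong_def)
      qed
      have "e = (fst (g e) - snd (g e)) mod p" using g[OF e(1)] by blast
      also have "\<dots> = (((x1 - w) mod p - (x1 - fst (g e)) mod p) - ((x2 - w) mod p - (x2 - snd (g e)) mod p)) mod p"
        by (rule diff[symmetric])
      also have "\<dots> = (fst (g e') - snd (g e')) mod p" unfolding eqs by (rule diff)
      also have "\<dots> = e'" using g[OF e(2)] by simp
      finally have ee: "e = e'" .
      have "x1 = ((x1 - fst (g e)) mod p + fst (g e)) mod p" using F1 by (simp add: mod_simps)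
      also have "\<dots> = y1" unfolding eqs using F1 ee by (simp add: mod_simps)
      finally have x1: "x1 = y1" .
      have "x2 = ((x2 - snd (g e)) mod p + snd (g e)) mod p" using F1 by (simp add: mod_simps)
      also have "\<dots> = y2" unfolding eqs using F1 ee by (simp add: mod_simps)
      finally have x2: "x2 = y2" .
      have "w = w'" by (rule diff_cancel_F[of w w' x1]) (use F1 eqs x1 in auto)
      then show "s = t" by (simp add: s' t' ee x1 x2)
    qed
    show "?h ` (SIGMA e:Z \<boxplus> -1 \<star> Z. T e) \<subseteq> B \<times> B \<times> B \<times> B"
      by (auto simp: T_def R_def S_def)
  qed (use fin in auto)
  also have "card (SIGMA e:Z \<boxplus> -1 \<star> Z. T e) = (\<Sum>e\<in>Z \<boxplus> -1 \<star> Z. card (T e))"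
    by (rule card_SigmaI) (auto simp: finT)
  finally have "(\<Sum>e\<in>Z \<boxplus> -1 \<star> Z. real (card (T e))) \<le> b ^ 4"
    by (simp add: card_cartesian_product b_def power_eq_if flip: of_nat_sum of_nat_mult)
  moreover have "(\<Sum>e\<in>Z \<boxplus> -1 \<star> Z. (n / 2) * (\<rho> * b)\<^sup>2) \<le> (\<Sum>e\<in>Z \<boxplus> -1 \<star> Z. real (card (T e)))"
    by (rule sum_mono) (rule Tcard)
  ultimately have "card (Z \<boxplus> -1 \<star> Z) * ((n / 2) * (\<rho> * b)\<^sup>2) \<le> b ^ 4" by simp
  then have "(card (Z \<boxplus> -1 \<star> Z) * n * \<kappa>\<^sup>2) * b\<^sup>2 \<le> (512 * b\<^sup>2) * b\<^sup>2"
    by (simp add: \<rho>_def power2_eq_square power4_eq_xxxx mult_ac)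
  then have "card (Z \<boxplus> -1 \<star> Z) * n * \<kappa>\<^sup>2 \<le> 512 * b\<^sup>2" using by0 by simp
  moreover have "card (Z \<boxplus> -1 \<star> Z) * real (card Z) * \<kappa>\<^sup>2 \<le> card (Z \<boxplus> -1 \<star> Z) * n * \<kappa>\<^sup>2"
    unfolding n_def using card_mono[OF finS ZS] by (intro mult_right_mono mult_left_mono) auto
  ultimately have "card (Z \<boxplus> -1 \<star> Z) * real (card Z) * \<kappa>\<^sup>2 \<le> 512 * b\<^sup>2" by linarith
  moreover have "\<kappa> * y \<le> 8 * card Z" using n1 Zn by linarith
  ultimately show ?thesis using ZY Zne by (intro exI[of _ Z]) (simp add: b_def y_def)
qed

end

subsection \<open>Character sums\<close>

locale multiplicative_character = prime_modulus +
  fixes \<psi> :: "int \<Rightarrow> complex"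
  assumes psi_mult_unit: "x \<in> F - {0} \<Longrightarrow> y \<in> F - {0} \<Longrightarrow> \<psi> (x * y mod p) = \<psi> x * \<psi> y"
    and psi_zero [simp]: "\<psi> 0 = 0"
    and psi_nonzero: "x \<in> F - {0} \<Longrightarrow> \<psi> x \<noteq> 0"
    and psi_nontrivial: "\<exists>x\<in>F - {0}. \<psi> x \<noteq> 1"
begin

lemma mult_unit_F: "x \<in> F - {0} \<Longrightarrow> y \<in> F - {0} \<Longrightarrow> x * y mod p \<in> F - {0}"
  using not_dvd_F[of x] not_dvd_F[of y] prime_p by (auto simp: dvd_eq_mod_eq_0[symmetric] prime_dvd_mult_iff)

text \<open>Squaring an argument of maximal modulus M gives M^2 \<le> M, hence M \<le> 1; squaring
  one of minimal modulus shows in the same way that the minimum is at least 1.\<close>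

lemma norm_psi_unit:
  assumes "x \<in> F - {0}"
  shows "norm (\<psi> x) = 1"
proof -
  let ?N = "(\<lambda>x. norm (\<psi> x)) ` (F - {0})"
  have fin: "finite ?N" and ne: "?N \<noteq> {}" using assms by auto
  obtain y where y: "y \<in> F - {0}" "Max ?N = norm (\<psi> y)" using Max_in[OF fin ne] by (rule imageE)
  obtain z where z: "z \<in> F - {0}" "Min ?N = norm (\<psi> z)" using Min_in[OF fin ne] by (rule imageE)
  have mem: "norm (\<psi> u) \<in> ?N" if "u \<in> F - {0}" for u using that by (rule imageI)
  have "norm (\<psi> (y * y mod p)) \<le> Max ?N" by (intro Max_ge fin mem mult_unit_F y)
  then have "norm (\<psi> y) * norm (\<psi> y) \<le> norm (\<psi> y)" by (simp only: psi_mult_unit[OF y(1,1)] norm_mult y(2))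
  then have "norm (\<psi> y) \<le> 1" using psi_nonzero[OF y(1)] by simp
  moreover have "norm (\<psi> x) \<le> norm (\<psi> y)" unfolding y(2)[symmetric] by (intro Max_ge fin mem assms)
  moreover have "Min ?N \<le> norm (\<psi> (z * z mod p))" by (intro Min_le fin mem mult_unit_F z)
  then have "norm (\<psi> z) \<le> norm (\<psi> z) * norm (\<psi> z)" by (simp only: psi_mult_unit[OF z(1,1)] norm_mult z(2))
  then have "1 \<le> norm (\<psi> z)" using psi_nonzero[OF z(1)] by simp
  moreover have "norm (\<psi> z) \<le> norm (\<psi> x)" unfolding z(2)[symmetric] by (intro Min_le fin mem assms)
  ultimately show ?thesis by linarith
qed

lemma norm_psi_le: "x \<in> F \<Longrightarrow> norm (\<psi> x) \<le> 1"
  using norm_psi_unit[of x] by (cases "x = 0") auto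

lemma psi_mult:
  assumes "x \<in> F" "y \<in> F"
  shows "\<psi> (x * y mod p) = \<psi> x * \<psi> y"
  using psi_mult_unit[of x y] assms by (cases "x = 0 \<or> y = 0") auto

lemma psi_mult_cnj: "x \<in> F - {0} \<Longrightarrow> \<psi> x * cnj (\<psi> x) = 1"
  using norm_psi_unit[of x] by (simp add: complex_norm_square[symmetric])

lemma bij_mult_F:
  assumes "h \<in> F - {0}"
  shows "bij_betw (\<lambda>z. h * z mod p) F F"
proof -
  have "inj_on (\<lambda>z. h * z mod p) F"
    by (rule inj_onI) (use assms mult_cancel_F[of h] not_dvd_F[of h] in blast)
  moreover have "(\<lambda>z. h * z mod p) ` F \<subseteq> F" by auto
  ultimately show ?thesis
    by (intro bij_betw_imageI endo_inj_surj) auto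
qed

lemma bij_add_F: "bij_betw (\<lambda>z. (h + z) mod p) F F"
proof -
  have "inj_on (\<lambda>z. (h + z) mod p) F"
    by (rule inj_onI) (use add_cancel_F in blast)
  moreover have "(\<lambda>z. (h + z) mod p) ` F \<subseteq> F" by auto
  ultimately show ?thesis
    by (intro bij_betw_imageI endo_inj_surj) auto
qed

lemma sum_psi: "(\<Sum>x\<in>F. \<psi> x) = 0"
proof -
  obtain u where u: "u \<in> F - {0}" "\<psi> u \<noteq> 1" using psi_nontrivial by blast
  have "(\<Sum>x\<in>F. \<psi> x) = (\<Sum>x\<in>F. \<psi> (u * x mod p))"
    by (rule sum.reindex_bij_betw[OF bij_mult_F[OF u(1)], symmetric])
  also have "\<dots> = \<psi> u * (\<Sum>x\<in>F. \<psi> x)"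
    unfolding sum_distrib_left
  proof (rule sum.cong[OF refl])
    fix x assume "x \<in> F"
    then show "\<psi> (u * x mod p) = \<psi> u * \<psi> x" using u(1) by (intro psi_mult) auto
  qed
  finally have *: "(\<Sum>x\<in>F. \<psi> x) = \<psi> u * (\<Sum>x\<in>F. \<psi> x)" .
  have "(\<psi> u - 1) * (\<Sum>x\<in>F. \<psi> x) = \<psi> u * (\<Sum>x\<in>F. \<psi> x) - (\<Sum>x\<in>F. \<psi> x)"
    by (simp add: left_diff_distrib)
  also have "\<dots> = 0" by (subst *[symmetric]) (rule diff_self)
  finally show ?thesis using u(2) by simp
qed

text \<open>The correlation at a nonzero shift does not depend on the shift (rescale), and the sum over all
  shifts vanishes.\<close>

lemma psi_correlation:
  assumes "h \<in> F"
  shows "(\<Sum>z\<in>F. \<psi> ((z + h) mod p) * cnj (\<psi> z)) = (if h = 0 then of_int (p - 1) else -1)"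
proof -
  define G where "G h = (\<Sum>z\<in>F. \<psi> ((z + h) mod p) * cnj (\<psi> z))" for h
  have F0: "F = insert 0 (F - {0})" using p_pos by auto
  have cF: "of_nat (card (F - {0})) = (of_int (p - 1) :: complex)"
    using p_gt_1 by (simp add: of_nat_diff)
  have "G 0 = (\<Sum>z\<in>F. \<psi> z * cnj (\<psi> z))"
    unfolding G_def by (rule sum.cong) auto
  also have "\<dots> = (\<Sum>z\<in>F - {0}. \<psi> z * cnj (\<psi> z))"
    by (subst F0, subst sum.insert) auto
  also have "\<dots> = (\<Sum>z\<in>F - {0}. 1)" by (rule sum.cong[OF refl]) (rule psi_mult_cnj)
  also have "\<dots> = of_int (p - 1)" using cF by simp
  finally have G0: "G 0 = of_int (p - 1)" .
  have G1: "G h = G 1" if h: "h \<in> F - {0}" for h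
  proof -
    have "G h = (\<Sum>z\<in>F. \<psi> ((h * z mod p + h) mod p) * cnj (\<psi> (h * z mod p)))"
      unfolding G_def by (rule sum.reindex_bij_betw[OF bij_mult_F[OF h], symmetric])
    also have "\<dots> = G 1" unfolding G_def
    proof (rule sum.cong[OF refl])
      fix z assume z: "z \<in> F"
      have "(h * z mod p + h) mod p = h * ((z + 1) mod p) mod p" by (simp add: mod_simps algebra_simps)
      then have "\<psi> ((h * z mod p + h) mod p) * cnj (\<psi> (h * z mod p))
        = (\<psi> h * cnj (\<psi> h)) * (\<psi> ((z + 1) mod p) * cnj (\<psi> z))"
        using psi_mult[of h "(z + 1) mod p"] psi_mult[of h z] h z by simp
      then show "\<psi> ((h * z mod p + h) mod p) * cnj (\<psi> (h * z mod p)) = \<psi> ((z + 1) mod p) * cnj (\<psi> z)"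
        using psi_mult_cnj[OF h] by simp
    qed
    finally show ?thesis .
  qed
  have "(\<Sum>h\<in>F. G h) = (\<Sum>z\<in>F. \<Sum>h\<in>F. \<psi> ((z + h) mod p) * cnj (\<psi> z))"
    unfolding G_def by (rule sum.swap)
  also have "\<dots> = (\<Sum>z\<in>F. (\<Sum>h\<in>F. \<psi> ((z + h) mod p)) * cnj (\<psi> z))"
    by (simp only: sum_distrib_right)
  also have "\<dots> = 0"
  proof (rule sum.neutral, rule ballI)
    fix z
    have "(\<Sum>h\<in>F. \<psi> ((z + h) mod p)) = (\<Sum>h\<in>F. \<psi> h)"
      by (rule sum.reindex_bij_betw[OF bij_add_F])
    then show "(\<Sum>h\<in>F. \<psi> ((z + h) mod p)) * cnj (\<psi> z) = 0" by (simp add: sum_psi)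
  qed
  finally have "G 0 + (\<Sum>h\<in>F - {0}. G h) = 0"
    by (subst (asm) F0, subst (asm) sum.insert) auto
  moreover have "(\<Sum>h\<in>F - {0}. G h) = of_int (p - 1) * G 1"
  proof -
    have "(\<Sum>h\<in>F - {0}. G h) = (\<Sum>h\<in>F - {0}. G 1)" by (rule sum.cong[OF refl G1])
    then show ?thesis by (simp only: sum_constant cF)
  qed
  ultimately have "of_int (p - 1) * (1 + G 1) = 0" by (simp add: G0 algebra_simps)
  moreover have "of_int (p - 1) \<noteq> (0::complex)" using p_gt_1 by simp
  ultimately have "G 1 = -1" by (metis add.commute add_eq_0_iff mult_eq_0_iff)
  then show ?thesis using G0 G1[of h] assms by (auto simp: G_def[symmetric])
qed

text \<open>Expanding the square, each diagonal pair contributes p - 1 and each other pair -1, in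
  total |A|(p - |A|).\<close>

lemma psi_second_moment:
  assumes A: "A \<subseteq> F"
  shows "(\<Sum>y\<in>F. (norm (\<Sum>a\<in>A. \<psi> ((y + a) mod p)))\<^sup>2) \<le> real_of_int p * card A"
proof -
  have fin: "finite A" using A finite_F_subset by auto
  have pair: "(\<Sum>y\<in>F. \<psi> ((y + a) mod p) * cnj (\<psi> ((y + a') mod p))) = (if a = a' then of_int (p - 1) else -1)"
    if "a \<in> A" "a' \<in> A" for a a'
  proof -
    have "(\<Sum>y\<in>F. \<psi> ((y + a) mod p) * cnj (\<psi> ((y + a') mod p)))
      = (\<Sum>y\<in>F. \<psi> (((a' + y) mod p + (a - a') mod p) mod p) * cnj (\<psi> ((a' + y) mod p)))"
      by (rule sum.cong[OF refl]) (simp add: mod_simps add.commute)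
    also have "\<dots> = (\<Sum>z\<in>F. \<psi> ((z + (a - a') mod p) mod p) * cnj (\<psi> z))"
      by (rule sum.reindex_bij_betw[OF bij_add_F])
    also have "\<dots> = (if (a - a') mod p = 0 then of_int (p - 1) else -1)"
      by (rule psi_correlation) simp
    also have "(a - a') mod p = 0 \<longleftrightarrow> a = a'"
    proof
      assume "(a - a') mod p = 0"
      then have "p dvd a - a'" by (rule mod_0_imp_dvd)
      then show "a = a'" using not_dvd_diff_F[OF subsetD[OF A that(1)] subsetD[OF A that(2)]] by blast
    qed simp
    finally show ?thesis .
  qed
  have "complex_of_real (\<Sum>y\<in>F. (norm (\<Sum>a\<in>A. \<psi> ((y + a) mod p)))\<^sup>2)
    = (\<Sum>y\<in>F. \<Sum>a\<in>A. \<Sum>a'\<in>A. \<psi> ((y + a) mod p) * cnj (\<psi> ((y + a') mod p)))"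
    by (simp only: of_real_sum complex_norm_square sum_product cnj_sum)
  also have "\<dots> = (\<Sum>a\<in>A. \<Sum>a'\<in>A. \<Sum>y\<in>F. \<psi> ((y + a) mod p) * cnj (\<psi> ((y + a') mod p)))"
    by (subst sum.swap, intro sum.cong[OF refl], rule sum.swap)
  also have "\<dots> = (\<Sum>a\<in>A. \<Sum>a'\<in>A. if a = a' then of_int (p - 1) else -1)"
    by (intro sum.cong[OF refl] pair)
  also have "\<dots> = (\<Sum>a\<in>A. complex_of_real (p - card A))"
  proof (rule sum.cong[OF refl])
    fix a assume a: "a \<in> A"
    have "(\<Sum>a'\<in>A. if a = a' then of_int (p - 1) else -1 :: complex) = of_int (p - 1) + (\<Sum>a'\<in>A - {a}. -1)"
      using a by (subst sum.remove[OF fin a]) (auto intro!: sum.cong)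
    also have "\<dots> = complex_of_real (p - card A)"
      using a fin card_gt_0_iff[of A] by (auto simp: of_nat_diff)
    finally show "(\<Sum>a'\<in>A. if a = a' then of_int (p - 1) else -1) = complex_of_real (p - card A)" .
  qed
  also have "\<dots> = complex_of_real (card A * (real_of_int p - card A))" by simp
  finally have "(\<Sum>y\<in>F. (norm (\<Sum>a\<in>A. \<psi> ((y + a) mod p)))\<^sup>2) = card A * (real_of_int p - card A)"
    by (simp only: of_real_eq_iff)
  also have "\<dots> \<le> real_of_int p * card A" by (simp add: algebra_simps)
  finally show ?thesis .
qed

text \<open>Group the indices by residue and apply Cauchy-Schwarz over the whole field: the squared
  multiplicities add up to the collision count. The index set is arbitrary because it serves both
  for B \<times> Y with \<open>d\<close> fixed and for X \<times> D with \<open>b\<close>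
  fixed.\<close>

lemma bilinear_bound:
  assumes A: "A \<subseteq> F" and I: "finite I"
  shows "(norm (\<Sum>i\<in>I. \<Sum>a\<in>A. \<psi> ((g i + a) mod p)))\<^sup>2
    \<le> real_of_int p * card A * card {(i, j) \<in> I \<times> I. g i mod p = g j mod p}"
proof -
  define h where "h y = (\<Sum>a\<in>A. \<psi> ((y + a) mod p))" for y
  define r where "r y = real (card {i \<in> I. g i mod p = y})" for y
  have im: "(\<lambda>i. g i mod p) ` I \<subseteq> F" by auto
  have "(\<Sum>i\<in>I. \<Sum>a\<in>A. \<psi> ((g i + a) mod p)) = (\<Sum>i\<in>I. h (g i mod p))"
    by (simp add: h_def mod_simps)
  also have "\<dots> = (\<Sum>y\<in>F. \<Sum>i\<in>{i \<in> I. g i mod p = y}. h (g i mod p))"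
    by (rule sum.group[OF I _ im, symmetric]) simp
  also have "\<dots> = (\<Sum>y\<in>F. r y * h y)" by (intro sum.cong[OF refl]) (simp add: r_def)
  finally have "norm (\<Sum>i\<in>I. \<Sum>a\<in>A. \<psi> ((g i + a) mod p)) \<le> (\<Sum>y\<in>F. norm (r y * h y))"
    by (simp only: norm_sum)
  also have "\<dots> = (\<Sum>y\<in>F. r y * norm (h y))" by (simp add: norm_mult r_def)
  finally have "(norm (\<Sum>i\<in>I. \<Sum>a\<in>A. \<psi> ((g i + a) mod p)))\<^sup>2 \<le> (\<Sum>y\<in>F. r y * norm (h y))\<^sup>2"
    by (rule power_mono) simp
  also have "\<dots> \<le> (\<Sum>y\<in>F. (r y)\<^sup>2) * (\<Sum>y\<in>F. (norm (h y))\<^sup>2)" by (rule Cauchy_Schwarz_ineq_sum)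
  also have "(\<Sum>y\<in>F. (r y)\<^sup>2) = card {(i, j) \<in> I \<times> I. g i mod p = g j mod p}"
    using sum_card_fibres_square[OF I _ im] by (simp add: r_def flip: of_nat_sum of_nat_power)
  also have "card {(i, j) \<in> I \<times> I. g i mod p = g j mod p} * (\<Sum>y\<in>F. (norm (h y))\<^sup>2)
    \<le> card {(i, j) \<in> I \<times> I. g i mod p = g j mod p} * (real_of_int p * card A)"
    unfolding h_def by (rule mult_left_mono[OF psi_second_moment[OF A]]) simp
  finally show ?thesis by (simp add: mult_ac)
qed

end

subsection \<open>Extracting a structured piece\<close>

lemma ex_norm_ge_average:
  fixes g :: "'a \<Rightarrow> complex" and M :: real
  assumes "finite I" "I \<noteq> {}" "M * card I \<le> norm (\<Sum>i\<in>I. g i)"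
  shows "\<exists>i\<in>I. M \<le> norm (g i)"
proof (rule ccontr)
  assume "\<not> ?thesis"
  then have "(\<Sum>i\<in>I. norm (g i)) < (\<Sum>i\<in>I. M)"
    using assms by (intro sum_strict_mono) (auto simp: not_le)
  then show False using assms(3) norm_sum[of g I] by (simp add: mult.commute)
qed

text \<open>Deleting one point at a time: the sums over C - {x} add up to |C| - 1 times the sum over
  C, so for some x the density does not drop.\<close>

lemma ex_subset_same_density:
  fixes f :: "'a \<Rightarrow> complex"
  assumes "finite C" "0 < m" "m \<le> card C"
  shows "\<exists>Z\<subseteq>C. card Z = m \<and> norm (sum f C) * m \<le> norm (sum f Z) * card C"
  using assms
proof (induction "card C - m" arbitrary: C)
  case 0
  then show ?case by (intro exI[of _ C]) auto
next
  case (Suc k)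
  have c: "2 \<le> card C" "C \<noteq> {}" using Suc by auto
  define M where "M = norm (sum f C) * (real (card C) - 1) / card C"
  have "(\<Sum>x\<in>C. sum f (C - {x})) = (\<Sum>x\<in>C. sum f C - f x)"
    using Suc by (intro sum.cong) (auto simp: sum_diff1)
  also have "\<dots> = complex_of_real (real (card C) - 1) * sum f C"
    by (simp add: sum_subtractf algebra_simps)
  finally have "norm (\<Sum>x\<in>C. sum f (C - {x})) = \<bar>real (card C) - 1\<bar> * norm (sum f C)"
    by (simp only: norm_mult norm_of_real)
  then have "M * card C \<le> norm (\<Sum>x\<in>C. sum f (C - {x}))" using c by (simp add: M_def)
  then obtain x where x: "x \<in> C" "M \<le> norm (sum f (C - {x}))"
    using ex_norm_ge_average[of C M "\<lambda>x. sum f (C - {x})"] Suc c by blast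
  have cx: "card (C - {x}) = card C - 1" using x Suc by simp
  then have "k = card (C - {x}) - m" "finite (C - {x})" "m \<le> card (C - {x})"
    using Suc.hyps(2) Suc.prems by auto
  then obtain Z where Z: "Z \<subseteq> C - {x}" "card Z = m"
    "norm (sum f (C - {x})) * m \<le> norm (sum f Z) * card (C - {x})"
    using Suc.hyps(1)[of "C - {x}"] \<open>0 < m\<close> by blast
  have "norm (sum f C) * m * (real (card C) - 1) = (M * m) * card C"
    using c by (simp add: M_def)
  also have "\<dots> \<le> (norm (sum f (C - {x})) * m) * card C" using x by (intro mult_right_mono) auto
  also have "\<dots> \<le> (norm (sum f Z) * card (C - {x})) * card C" using Z by (intro mult_right_mono) auto
  also have "real (card (C - {x})) = real (card C) - 1" using cx c by (simp add: of_nat_diff)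
  finally have "(norm (sum f C) * m) * (real (card C) - 1) \<le> (norm (sum f Z) * card C) * (real (card C) - 1)"
    by (simp add: mult_ac)
  then have "norm (sum f C) * m \<le> norm (sum f Z) * card C" using c by simp
  then show ?case using Z by blast
qed

text \<open>Remove pieces satisfying \<open>P\<close> until the remainder is negligible: one of the pieces must
  carry its share of the sum.\<close>

lemma ex_piece_with_large_sum:
  fixes f :: "'a \<Rightarrow> complex" and w \<theta> :: real
  assumes fin: "finite C" and bound: "\<And>c. c \<in> C \<Longrightarrow> norm (f c) \<le> w" and \<theta>: "0 < \<theta>" and w: "0 \<le> w"
    and big: "2 * \<theta> * w * card C < norm (sum f C)"
    and piece: "\<And>Y. Y \<subseteq> C \<Longrightarrow> Y \<noteq> {} \<Longrightarrow> \<theta> * card C \<le> card Y \<Longrightarrow> \<theta> * w * card Y \<le> norm (sum f Y) \<Longrightarrow>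
      \<exists>Z\<subseteq>Y. Z \<noteq> {} \<and> P Z"
  shows "\<exists>Z\<subseteq>C. Z \<noteq> {} \<and> P Z \<and> \<theta> * w * card Z \<le> norm (sum f Z)"
proof (rule ccontr)
  assume na: "\<not> ?thesis"
  \<comment> \<open>The first term pays for the remainder at which removal stops because it is too
    small. The second pays for the removed pieces, or for a remainder whose own sum is small. For Y
    = C the total contradicts \<open>big\<close>.\<close>
  have "norm (sum f Y) \<le> \<theta> * w * card C + \<theta> * w * card Y" if "Y \<subseteq> C" for Y
    using finite_subset[OF that fin] that
  proof (induction Y rule: finite_psubset_induct)
    case (psubset Y)
    have nn: "0 \<le> \<theta> * w * card C" "0 \<le> \<theta> * w * card Y" using \<theta> w by simp_all
    show ?case
    proof (cases "Y = {} \<or> card Y < \<theta> * card C \<or> norm (sum f Y) < \<theta> * w * card Y")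
      case True
      have "norm (sum f Y) \<le> card Y * w"
        by (rule sum_norm_bound) (use bound psubset in auto)
      moreover have "card Y * w \<le> \<theta> * w * card C" if "card Y < \<theta> * card C"
        using mult_right_mono[OF less_imp_le[OF that] w] by (simp add: mult_ac)
      ultimately show ?thesis using True nn by auto
    next
      case False
      then obtain Z where Z: "Z \<subseteq> Y" "Z \<noteq> {}" "P Z" using piece[of Y] psubset by auto
      then have "norm (sum f Z) < \<theta> * w * card Z" using na psubset by (meson not_le order_trans)
      moreover have "norm (sum f (Y - Z)) \<le> \<theta> * w * card C + \<theta> * w * card (Y - Z)"
        using psubset Z by (intro psubset.IH) auto
      moreover have "sum f Y = sum f Z + sum f (Y - Z)"
        using sum.subset_diff[OF Z(1) psubset.hyps, of f] by (simp add: add.commute)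
      then have "norm (sum f Y) \<le> norm (sum f Z) + norm (sum f (Y - Z))" by (simp add: norm_triangle_ineq)
      moreover have "real (card Y) = card Z + real (card (Y - Z))"
        using Z psubset.hyps card_mono[OF psubset.hyps Z(1)] by (simp add: card_Diff_subset finite_subset of_nat_diff)
      ultimately show ?thesis by (simp add: algebra_simps)
    qed
  qed
  from this[of C] show False using big by simp
qed

text \<open>E is eliminated by the fourth power of \<open>h1\<close>, K by multiplying with the
  eleventh power of the factor in \<open>h3\<close>. This leaves x^27 on the left, which the 27th
  power of \<open>h4\<close> replaces.\<close>

lemma combine_inequalities:
  fixes \<theta> a b c d x P E K :: real
  assumes pos: "0 < \<theta>" "0 < a" "0 < b" "0 < c" "0 < d" "0 < x" "0 < P" "0 \<le> E"
    and h1: "\<theta> ^ 4 * a\<^sup>2 * x ^ 4 * d \<le> P\<^sup>2 * E"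
    and h2: "E ^ 4 \<le> 162 * K ^ 11 * x ^ 11"
    and h3: "K * (\<theta> ^ 4 * a\<^sup>2 * x\<^sup>2) = 512 * P\<^sup>2"
    and h4: "\<theta> ^ 3 * a * b * c \<le> 8 * P * x"
  shows "\<theta> ^ 141 * a ^ 57 * b ^ 27 * c ^ 27 * d ^ 4 \<le> 162 * 512 ^ 11 * 8 ^ 27 * P ^ 57"
proof -
  let ?u = "\<theta> ^ 4 * a\<^sup>2 * x\<^sup>2"
  have u0: "0 < ?u" using pos by simp
  have "(\<theta> ^ 4 * a\<^sup>2 * x ^ 4 * d) ^ 4 \<le> (P\<^sup>2 * E) ^ 4"
    using pos by (intro power_mono h1) auto
  also have "\<dots> = P ^ 8 * E ^ 4" by (simp add: power_mult_distrib flip: power_mult)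
  also have "\<dots> \<le> P ^ 8 * (162 * K ^ 11 * x ^ 11)" using pos by (intro mult_left_mono h2) auto
  finally have "(\<theta> ^ 4 * a\<^sup>2 * x ^ 4 * d) ^ 4 * ?u ^ 11 \<le> P ^ 8 * (162 * K ^ 11 * x ^ 11) * ?u ^ 11"
    using u0 by (intro mult_right_mono) auto
  also have "\<dots> = 162 * P ^ 8 * x ^ 11 * (K * ?u) ^ 11" by (simp only: power_mult_distrib mult_ac)
  also have "\<dots> = (162 * 512 ^ 11 * P ^ 30) * x ^ 11" unfolding h3
    by (simp add: power_mult_distrib flip: power_mult power_add)
  also have "(\<theta> ^ 4 * a\<^sup>2 * x ^ 4 * d) ^ 4 * ?u ^ 11 = (\<theta> ^ 60 * a ^ 30 * x ^ 27 * d ^ 4) * x ^ 11"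
    by (simp add: power_mult_distrib mult_ac flip: power_mult power_add)
  finally have 1: "\<theta> ^ 60 * a ^ 30 * x ^ 27 * d ^ 4 \<le> 162 * 512 ^ 11 * P ^ 30"
    by (rule mult_right_le_imp_le) (use pos in simp)
  have "(\<theta> ^ 3 * a * b * c) ^ 27 \<le> (8 * P * x) ^ 27"
    using pos by (intro power_mono h4) auto
  then have "(\<theta> ^ 3 * a * b * c) ^ 27 * (\<theta> ^ 60 * a ^ 30 * d ^ 4) \<le> (8 * P * x) ^ 27 * (\<theta> ^ 60 * a ^ 30 * d ^ 4)"
    using pos by (intro mult_right_mono) auto
  also have "\<dots> = 8 ^ 27 * P ^ 27 * (\<theta> ^ 60 * a ^ 30 * x ^ 27 * d ^ 4)"
    by (simp only: power_mult_distrib mult_ac)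
  also have "\<dots> \<le> 8 ^ 27 * P ^ 27 * (162 * 512 ^ 11 * P ^ 30)"
    using pos by (intro mult_left_mono 1) auto
  also have "\<dots> = 162 * 512 ^ 11 * 8 ^ 27 * P ^ 57" by (simp add: mult_ac flip: power_add)
  also have "(\<theta> ^ 3 * a * b * c) ^ 27 * (\<theta> ^ 60 * a ^ 30 * d ^ 4) = \<theta> ^ 141 * a ^ 57 * b ^ 27 * c ^ 27 * d ^ 4"
    by (simp add: power_mult_distrib mult_ac flip: power_mult power_add)
  finally show ?thesis .
qed

section \<open>The quadrilinear sum: small difference sets against multiplicative energy\<close>

context multiplicative_character begin

text \<open>The order of summation is chosen for the argument: with \<open>C\<close> outermost the
  sum is additive over subsets of \<open>C\<close>, as the extraction of pieces requires, and the
  innermost sum over \<open>A\<close> is the one bounded by its second moment.\<close>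

definition quad_sum :: "int set \<Rightarrow> int set \<Rightarrow> int set \<Rightarrow> int set \<Rightarrow> complex" where
  "quad_sum A B C D = (\<Sum>c\<in>C. \<Sum>b\<in>B. \<Sum>d\<in>D. \<Sum>a\<in>A. \<psi> ((b + c * d + a) mod p))"

lemma finite_F_units_subset: "U \<subseteq> F - {0} \<Longrightarrow> finite U"
  by (rule finite_F_subset) blast

lemma collisions_dilate:
  assumes Y: "Y \<subseteq> F" and d: "\<not> p dvd d"
  shows "card {(s, t) \<in> (B \<times> Y) \<times> (B \<times> Y). (fst s + d * snd s) mod p = (fst t + d * snd t) mod p}
    = card {(s, t) \<in> (B \<times> (d \<star> Y)) \<times> (B \<times> (d \<star> Y)). (fst s + snd s) mod p = (fst t + snd t) mod p}"
proof -
  define \<phi> where "\<phi> = (\<lambda>(s, t). ((fst s :: int, d * snd s mod p), (fst t :: int, d * snd t mod p)))"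
  let ?S = "{(s, t) \<in> (B \<times> Y) \<times> (B \<times> Y). (fst s + d * snd s) mod p = (fst t + d * snd t) mod p}"
  let ?T = "{(s, t) \<in> (B \<times> (d \<star> Y)) \<times> (B \<times> (d \<star> Y)). (fst s + snd s) mod p = (fst t + snd t) mod p}"
  have inj: "inj_on \<phi> ?S"
  proof (rule inj_onI)
    fix q r assume qr: "q \<in> ?S" "r \<in> ?S" "\<phi> q = \<phi> r"
    obtain b1 y1 b2 y2 where q: "q = ((b1, y1), (b2, y2))" by (metis surj_pair)
    obtain b3 y3 b4 y4 where r: "r = ((b3, y3), (b4, y4))" by (metis surj_pair)
    have "y1 \<in> Y" "y2 \<in> Y" "y3 \<in> Y" "y4 \<in> Y" using qr(1,2) unfolding q r by simp_all
    then have "y1 \<in> F" "y2 \<in> F" "y3 \<in> F" "y4 \<in> F" by (blast intro: subsetD[OF Y])+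
    moreover have "b1 = b3" "b2 = b4" "d * y1 mod p = d * y3 mod p" "d * y2 mod p = d * y4 mod p"
      using qr(3) by (auto simp: \<phi>_def q r)
    moreover have "y1 = y3" "y2 = y4" by (rule mult_cancel_F[OF d]; fact)+
    ultimately show "q = r" by (simp only: q r)
  qed
  have im: "\<phi> ` ?S = ?T"
  proof
    show "\<phi> ` ?S \<subseteq> ?T"
    proof (rule image_subsetI)
      fix q assume q: "q \<in> ?S"
      obtain b1 y1 b2 y2 where q': "q = ((b1, y1), (b2, y2))" by (metis surj_pair)
      show "\<phi> q \<in> ?T" using q unfolding q' \<phi>_def by (simp add: dilI mod_simps)
    qed
    show "?T \<subseteq> \<phi> ` ?S"
    proof
      fix q assume q: "q \<in> ?T"
      obtain b1 z1 b2 z2 where q': "q = ((b1, z1), (b2, z2))" by (metis surj_pair)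
      obtain y1 y2 where y: "y1 \<in> Y" "z1 = d * y1 mod p" "y2 \<in> Y" "z2 = d * y2 mod p"
        using q unfolding q' by (auto simp: dil_iff)
      have "((b1, y1), (b2, y2)) \<in> ?S" using q y unfolding q' by (simp add: mod_simps)
      moreover have "q = \<phi> ((b1, y1), (b2, y2))" by (simp add: q' y \<phi>_def)
      ultimately show "q \<in> \<phi> ` ?S" by (rule rev_image_eqI)
    qed
  qed
  show ?thesis using card_image[OF inj] unfolding im by (rule sym)
qed

text \<open>Some \<open>d\<close> carries the average, and the second moment bound then shows that B
  and the dilate dY have additive energy at least \<kappa>|B||Y|^2. The piece of dY so obtained is
  pulled back to Y; its size and that of its difference set are unchanged, so \<open>d\<close>
  disappears from the conclusion.\<close>

lemma ex_small_difference_set: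
  fixes \<theta> \<kappa> :: real
  assumes A: "A \<subseteq> F" "A \<noteq> {}" and B: "B \<subseteq> F" "B \<noteq> {}" and Y: "Y \<subseteq> F" "Y \<noteq> {}"
    and D: "D \<subseteq> F - {0}" "D \<noteq> {}" and \<theta>: "0 < \<theta>"
    and big: "\<theta> * (real (card A) * card B * card D) * card Y \<le> norm (quad_sum A B Y D)"
    and \<kappa>_def: "\<kappa> = \<theta>\<^sup>2 * card A * card B / p"
  shows "\<exists>Z\<subseteq>Y. Z \<noteq> {} \<and> \<kappa> * card Y \<le> 8 * card Z \<and>
    card (Z \<boxplus> -1 \<star> Z) * card Z * \<kappa>\<^sup>2 \<le> 512 * (real (card B))\<^sup>2"
proof -
  have fin: "finite A" "finite B" "finite Y" "finite D"
    using A B Y D finite_F_subset finite_F_units_subset by blast+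
  have pos: "0 < card A" "0 < card B" using fin A B by (auto simp: card_gt_0_iff)
  define g where "g d = (\<Sum>s\<in>B \<times> Y. \<Sum>a\<in>A. \<psi> ((fst s + d * snd s + a) mod p))" for d
  have "quad_sum A B Y D = (\<Sum>c\<in>Y. \<Sum>d\<in>D. \<Sum>b\<in>B. \<Sum>a\<in>A. \<psi> ((b + c * d + a) mod p))"
    unfolding quad_sum_def by (rule sum.cong[OF refl], rule sum.swap)
  also have "\<dots> = (\<Sum>d\<in>D. \<Sum>c\<in>Y. \<Sum>b\<in>B. \<Sum>a\<in>A. \<psi> ((b + c * d + a) mod p))"
    by (rule sum.swap)
  also have "\<dots> = (\<Sum>d\<in>D. \<Sum>b\<in>B. \<Sum>c\<in>Y. \<Sum>a\<in>A. \<psi> ((b + c * d + a) mod p))"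
    by (rule sum.cong[OF refl], rule sum.swap)
  also have "\<dots> = (\<Sum>d\<in>D. g d)"
  proof (rule sum.cong[OF refl])
    fix d
    show "(\<Sum>b\<in>B. \<Sum>c\<in>Y. \<Sum>a\<in>A. \<psi> ((b + c * d + a) mod p)) = g d"
      unfolding g_def by (subst sum.cartesian_product) (simp add: case_prod_unfold mult.commute)
  qed
  finally have "(\<theta> * card A * card B * card Y) * card D \<le> norm (\<Sum>d\<in>D. g d)"
    using big by (simp add: mult_ac)
  then obtain d where d: "d \<in> D" "\<theta> * card A * card B * card Y \<le> norm (g d)"
    using ex_norm_ge_average fin D by blast
  have nd: "\<not> p dvd d" using d D not_dvd_F by blast
  define N where "N = card {(s, t) \<in> (B \<times> (d \<star> Y)) \<times> (B \<times> (d \<star> Y)). (fst s + snd s) mod p = (fst t + snd t) mod p}"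
  have "(\<theta> * card A * card B * card Y)\<^sup>2 \<le> (norm (g d))\<^sup>2" using d \<theta> by (intro power_mono) auto
  also have "\<dots> \<le> real_of_int p * card A * card {(s, t) \<in> (B \<times> Y) \<times> (B \<times> Y). (fst s + d * snd s) mod p = (fst t + d * snd t) mod p}"
    unfolding g_def by (rule bilinear_bound) (use A fin in auto)
  also have "\<dots> = real_of_int p * card A * N" unfolding N_def collisions_dilate[OF Y(1) nd] ..
  finally have "(\<theta>\<^sup>2 * card A * (real (card B))\<^sup>2 * (real (card Y))\<^sup>2) * card A \<le> (real_of_int p * N) * card A"
    by (simp add: power2_eq_square mult_ac)
  then have "\<theta>\<^sup>2 * card A * (real (card B))\<^sup>2 * (real (card Y))\<^sup>2 \<le> real_of_int p * N"
    by (rule mult_right_le_imp_le) (use pos in simp)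
  moreover have p0: "0 < real_of_int p" using p_pos by linarith
  ultimately have "\<kappa> * card B * (real (card Y))\<^sup>2 \<le> N"
    by (simp add: \<kappa>_def field_simps power2_eq_square)
  then have en: "\<kappa> * card B * (real (card (d \<star> Y)))\<^sup>2 \<le> N" by (simp add: card_dil[OF nd Y(1)])
  have k0: "0 < \<kappa>" using \<theta> pos p0 by (simp add: \<kappa>_def)
  obtain Z' where Z': "Z' \<subseteq> d \<star> Y" "Z' \<noteq> {}" "\<kappa> * card (d \<star> Y) \<le> 8 * card Z'"
    "card (Z' \<boxplus> -1 \<star> Z') * card Z' * \<kappa>\<^sup>2 \<le> 512 * (real (card B))\<^sup>2"
    using balog_szemeredi_gowers[OF B dil_F _ k0 en[unfolded N_def]] Y(2) by (auto simp: dil_def)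
  define Z where "Z = {y \<in> Y. d * y mod p \<in> Z'}"
  have ZY: "Z \<subseteq> Y" by (auto simp: Z_def)
  then have ZF: "Z \<subseteq> F" using Y by blast
  have im: "d \<star> Z = Z'" using Z'(1) by (auto simp: Z_def dil_def)
  have "card Z' = card Z" using card_dil[OF nd ZF] im by simp
  moreover have "Z' \<boxplus> -1 \<star> Z' = d \<star> (Z \<boxplus> -1 \<star> Z)" by (simp add: im[symmetric] dil_sumset dil_dil)
  then have "card (Z' \<boxplus> -1 \<star> Z') = card (Z \<boxplus> -1 \<star> Z)" by (simp add: card_dil[OF nd])
  moreover have "Z \<noteq> {}" using im Z'(2) by (auto simp: dil_def)
  ultimately show ?thesis using Z' ZY by (intro exI[of _ Z]) (simp add: card_dil[OF nd Y(1)])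
qed

text \<open>Some \<open>b\<close> carries the average, and it cancels from the collision condition b
  + xd = b + x'd'. This bounds the energy of the pair X, D from below; Cauchy-Schwarz and the
  trivial bound |D|^3 then isolate that of X.\<close>

lemma mult_energy_ge:
  fixes \<theta> :: real
  assumes A: "A \<subseteq> F" "A \<noteq> {}" and B: "B \<subseteq> F" "B \<noteq> {}" and X: "X \<subseteq> F - {0}" "X \<noteq> {}"
    and D: "D \<subseteq> F - {0}" "D \<noteq> {}" and \<theta>: "0 < \<theta>"
    and big: "\<theta> * (real (card A) * card B * card D) * card X \<le> norm (quad_sum A B X D)"
  shows "\<theta> ^ 4 * (real (card A))\<^sup>2 * real (card X) ^ 4 * card D \<le> (real_of_int p)\<^sup>2 * mult_energy X X"
proof -
  have fin: "finite A" "finite B" "finite X" "finite D"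
    using A B X D finite_F_subset finite_F_units_subset by blast+
  have pos: "0 < card A" "0 < card B" "0 < card D" using fin A B D by (auto simp: card_gt_0_iff)
  define g where "g b = (\<Sum>s\<in>X \<times> D. \<Sum>a\<in>A. \<psi> ((b + fst s * snd s + a) mod p))" for b
  have "(\<Sum>c\<in>X. \<Sum>d\<in>D. \<Sum>a\<in>A. \<psi> ((b + c * d + a) mod p)) = g b" for b
    unfolding g_def by (subst sum.cartesian_product) (simp add: case_prod_unfold)
  then have "quad_sum A B X D = (\<Sum>b\<in>B. g b)"
    unfolding quad_sum_def by (subst sum.swap) simp
  then have "(\<theta> * card A * card D * card X) * card B \<le> norm (\<Sum>b\<in>B. g b)"
    using big by (simp add: mult_ac)
  then obtain b where b: "b \<in> B" "\<theta> * card A * card D * card X \<le> norm (g b)"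
    using ex_norm_ge_average fin B by blast
  have "(\<theta> * card A * card D * card X)\<^sup>2 \<le> (norm (g b))\<^sup>2" using b \<theta> by (intro power_mono) auto
  also have "\<dots> \<le> real_of_int p * card A * card {(s, t) \<in> (X \<times> D) \<times> (X \<times> D). (b + fst s * snd s) mod p = (b + fst t * snd t) mod p}"
    unfolding g_def by (rule bilinear_bound) (use A fin in auto)
  also have "{(s, t) \<in> (X \<times> D) \<times> (X \<times> D). (b + fst s * snd s) mod p = (b + fst t * snd t) mod p}
    = {(s, t) \<in> (X \<times> D) \<times> (X \<times> D). fst s * snd s mod p = fst t * snd t mod p}"
    by (simp add: mod_eq_dvd_iff)
  finally have "(\<theta> * card A * card D * card X)\<^sup>2 \<le> real_of_int p * card A * mult_energy X D"
    unfolding mult_energy_def .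
  then have "(\<theta>\<^sup>2 * card A * (real (card D))\<^sup>2 * (real (card X))\<^sup>2) * card A \<le> (real_of_int p * mult_energy X D) * card A"
    by (simp add: power2_eq_square mult_ac)
  then have 1: "\<theta>\<^sup>2 * card A * (real (card D))\<^sup>2 * (real (card X))\<^sup>2 \<le> real_of_int p * mult_energy X D"
    by (rule mult_right_le_imp_le) (use pos in simp)
  have "(mult_energy X D)\<^sup>2 \<le> mult_energy X X * card D ^ 3"
    using mult_energy_le[OF X(1) D(1)] mult_energy_self_le[OF D(1)] by (meson le_trans mult_le_mono2)
  then have 2: "(real (mult_energy X D))\<^sup>2 \<le> real (mult_energy X X) * real (card D) ^ 3"
    by (metis of_nat_le_iff of_nat_mult of_nat_power)
  have "(\<theta> ^ 4 * (real (card A))\<^sup>2 * real (card X) ^ 4 * card D) * real (card D) ^ 3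
    = (\<theta>\<^sup>2 * card A * (real (card D))\<^sup>2 * (real (card X))\<^sup>2)\<^sup>2"
    by (simp add: power_eq_if)
  also have "\<dots> \<le> (real_of_int p * mult_energy X D)\<^sup>2" using 1 by (intro power_mono) auto
  also have "\<dots> \<le> (real_of_int p)\<^sup>2 * (real (mult_energy X X) * real (card D) ^ 3)"
    unfolding power_mult_distrib by (rule mult_left_mono[OF 2]) simp
  finally show ?thesis using pos by (simp add: mult.assoc[symmetric])
qed

text \<open>The piece found by greedy extraction has a small difference set and still carries its
  share of the sum, so both energy bounds apply to one and the same set.\<close>

lemma core_inequality:
  fixes \<theta> :: real
  assumes A: "A \<subseteq> F" "A \<noteq> {}" and B: "B \<subseteq> F" "B \<noteq> {}" and C: "C \<subseteq> F - {0}" "C \<noteq> {}"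
    and D: "D \<subseteq> F - {0}" "D \<noteq> {}" and C2: "int ((card C)\<^sup>2) \<le> p" and \<theta>: "0 < \<theta>"
    and big: "2 * \<theta> * (real (card A) * card B * card D) * card C < norm (quad_sum A B C D)"
  shows "\<theta> ^ 141 * real (card A) ^ 57 * real (card B) ^ 27 * real (card C) ^ 27 * real (card D) ^ 4
    \<le> 162 * 512 ^ 11 * 8 ^ 27 * real_of_int p ^ 57"
proof -
  have fin: "finite A" "finite B" "finite C" "finite D"
    using A B C D finite_F_subset finite_F_units_subset by blast+
  have pos: "0 < card A" "0 < card B" "0 < card C" "0 < card D" using fin A B C D by (auto simp: card_gt_0_iff)
  have p0: "0 < real_of_int p" using p_pos by linarith
  define \<kappa> where "\<kappa> = \<theta>\<^sup>2 * card A * card B / p"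
  have k0: "0 < \<kappa>" using \<theta> pos p0 by (simp add: \<kappa>_def)
  define f where "f c = (\<Sum>b\<in>B. \<Sum>d\<in>D. \<Sum>a\<in>A. \<psi> ((b + c * d + a) mod p))" for c
  have f: "sum f Y = quad_sum A B Y D" for Y by (simp add: f_def quad_sum_def)
  let ?w = "real (card A) * card B * card D"
  \<comment> \<open>The size bound refers to \<open>C\<close>, since the property of a piece may not
    depend on the remainder \<open>Y\<close> it is cut from; only remainders with |Y| \<ge>
    \<theta>|C| have to be treated.\<close>
  have "\<exists>X\<subseteq>C. X \<noteq> {} \<and> (\<kappa> * (\<theta> * card C) \<le> 8 * card X \<and>
      card (X \<boxplus> -1 \<star> X) * card X * \<kappa>\<^sup>2 \<le> 512 * (real (card B))\<^sup>2) \<and> \<theta> * ?w * card X \<le> norm (sum f X)"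
  proof (rule ex_piece_with_large_sum[OF fin(3) _ \<theta>])
    fix c
    have "norm (f c) \<le> (\<Sum>b\<in>B. \<Sum>d\<in>D. \<Sum>a\<in>A. 1)"
      unfolding f_def by (intro sum_norm_le norm_psi_le) auto
    then show "norm (f c) \<le> ?w" by (simp add: mult_ac)
  next
    fix Y assume Y: "Y \<subseteq> C" "Y \<noteq> {}" "\<theta> * card C \<le> card Y" "\<theta> * ?w * card Y \<le> norm (sum f Y)"
    have YF: "Y \<subseteq> F" using Y C by blast
    obtain Z where Z: "Z \<subseteq> Y" "Z \<noteq> {}" "\<kappa> * card Y \<le> 8 * card Z"
      "card (Z \<boxplus> -1 \<star> Z) * card Z * \<kappa>\<^sup>2 \<le> 512 * (real (card B))\<^sup>2"
      using ex_small_difference_set[OF A B YF Y(2) D \<theta> Y(4)[unfolded f] \<kappa>_def] by (elim exE conjE)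
    have "\<kappa> * (\<theta> * card C) \<le> \<kappa> * card Y" using Y(3) k0 by (intro mult_left_mono) auto
    then show "\<exists>Z\<subseteq>Y. Z \<noteq> {} \<and> \<kappa> * (\<theta> * card C) \<le> 8 * card Z \<and>
      card (Z \<boxplus> -1 \<star> Z) * card Z * \<kappa>\<^sup>2 \<le> 512 * (real (card B))\<^sup>2" using Z by (intro exI[of _ Z]) auto
  qed (use big in \<open>simp_all add: f\<close>)
  then obtain X where X: "X \<subseteq> C" "X \<noteq> {}" "\<kappa> * (\<theta> * card C) \<le> 8 * card X"
    "card (X \<boxplus> -1 \<star> X) * card X * \<kappa>\<^sup>2 \<le> 512 * (real (card B))\<^sup>2"
    "\<theta> * ?w * card X \<le> norm (quad_sum A B X D)" unfolding f by blast
  have XF: "X \<subseteq> F - {0}" using X C by blast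
  have finX: "finite X" using X fin finite_subset by blast
  have x0: "0 < real (card X)" using X finX by (simp add: card_gt_0_iff)
  \<comment> \<open>The difference set bound solved for |X - X| / |X|. Since \<kappa> contains |B|,
    the dependence on \<open>B\<close> cancels.\<close>
  define K where "K = 512 * (real (card B))\<^sup>2 / (\<kappa>\<^sup>2 * (real (card X))\<^sup>2)"
  have K: "real (card (X \<boxplus> -1 \<star> X)) \<le> K * card X"
    using X(4) k0 x0 by (simp add: K_def field_simps power2_eq_square)
  have "card X \<le> card C" by (rule card_mono[OF fin(3) X(1)])
  then have "(card X)\<^sup>2 \<le> (card C)\<^sup>2" by (rule power_mono) simp
  then have X2: "int ((card X)\<^sup>2) \<le> p" using C2 by linarith
  show ?thesis
  proof (rule combine_inequalities)
    show "\<theta> ^ 4 * (real (card A))\<^sup>2 * real (card X) ^ 4 * card D \<le> (real_of_int p)\<^sup>2 * mult_energy X X"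
      by (rule mult_energy_ge[OF A B XF X(2) D \<theta> X(5)])
    show "real (mult_energy X X) ^ 4 \<le> 162 * K ^ 11 * real (card X) ^ 11"
      using mult_energy_le_if_small_difference_set[OF XF X2 K] by simp
    show "K * (\<theta> ^ 4 * (real (card A))\<^sup>2 * (real (card X))\<^sup>2) = 512 * (real_of_int p)\<^sup>2"
      using x0 pos p0 \<theta> by (simp add: K_def \<kappa>_def field_simps power_eq_if)
    show "\<theta> ^ 3 * card A * card B * card C \<le> 8 * real_of_int p * card X"
      using X(3) p0 by (simp add: \<kappa>_def field_simps power_eq_if)
  qed (use pos x0 p0 \<theta> in auto)
qed

lemma quad_sum_commute: "quad_sum A B C D = quad_sum B A C D"
proof -
  have swap: "(\<Sum>b\<in>B. \<Sum>d\<in>D. \<Sum>a\<in>A. \<psi> ((b + c * d + a) mod p)) = (\<Sum>a\<in>A. \<Sum>d\<in>D. \<Sum>b\<in>B. \<psi> ((a + c * d + b) mod p))" for c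
  proof -
    have "(\<Sum>b\<in>B. \<Sum>d\<in>D. \<Sum>a\<in>A. \<psi> ((b + c * d + a) mod p)) = (\<Sum>d\<in>D. \<Sum>b\<in>B. \<Sum>a\<in>A. \<psi> ((b + c * d + a) mod p))"
      by (rule sum.swap)
    also have "\<dots> = (\<Sum>d\<in>D. \<Sum>a\<in>A. \<Sum>b\<in>B. \<psi> ((a + c * d + b) mod p))"
    proof (rule sum.cong[OF refl])
      fix d
      have "(\<Sum>b\<in>B. \<Sum>a\<in>A. \<psi> ((b + c * d + a) mod p)) = (\<Sum>a\<in>A. \<Sum>b\<in>B. \<psi> ((b + c * d + a) mod p))"
        by (rule sum.swap)
      then show "(\<Sum>b\<in>B. \<Sum>a\<in>A. \<psi> ((b + c * d + a) mod p)) = (\<Sum>a\<in>A. \<Sum>b\<in>B. \<psi> ((a + c * d + b) mod p))"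
        by (simp add: add.commute add.left_commute add.assoc)
    qed
    also have "\<dots> = (\<Sum>a\<in>A. \<Sum>d\<in>D. \<Sum>b\<in>B. \<psi> ((a + c * d + b) mod p))" by (rule sum.swap)
    finally show ?thesis .
  qed
  show ?thesis unfolding quad_sum_def swap ..
qed

lemma norm_quad_sum_le:
  "norm (quad_sum A B C D) \<le> real (card A) * card B * card C * card D"
proof -
  have "norm (quad_sum A B C D) \<le> (\<Sum>c\<in>C. \<Sum>b\<in>B. \<Sum>d\<in>D. \<Sum>a\<in>A. 1)"
    unfolding quad_sum_def by (intro sum_norm_le norm_psi_le) auto
  then show ?thesis by (simp add: mult_ac)
qed

subsection \<open>Power saving\<close>

text \<open>\<open>C\<close> is thinned to \<open>m\<close> elements at the same density. The 4 in
  \<open>\<theta>\<close> puts the sum strictly above the 2\<theta> that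
  \<open>core_inequality\<close> asks for, and |B| \<le> |A| trades one factor |A| for |B|.\<close>

lemma quad_sum_bound_ordered:
  assumes A: "A \<subseteq> F" "A \<noteq> {}" and B: "B \<subseteq> F" "B \<noteq> {}" and C: "C \<subseteq> F - {0}" "C \<noteq> {}"
    and D: "D \<subseteq> F - {0}" "D \<noteq> {}" and m: "0 < m" "m \<le> card C" "int (m\<^sup>2) \<le> p"
    and AB: "card B \<le> card A"
  defines "\<theta> \<equiv> norm (quad_sum A B C D) / (4 * (real (card A) * card B * card C * card D))"
  shows "\<theta> ^ 141 * (real (card A) ^ 56 * real (card B) ^ 28 * real m ^ 27 * real (card D) ^ 4)
    \<le> 162 * 512 ^ 11 * 8 ^ 27 * real_of_int p ^ 57"
proof (cases "quad_sum A B C D = 0")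
  case True
  then show ?thesis using less_imp_le[OF p_pos] by (simp add: \<theta>_def)
next
  case False
  have fin: "finite A" "finite B" "finite C" "finite D"
    using A B C D finite_F_subset finite_F_units_subset by blast+
  have pos: "0 < card A" "0 < card B" "0 < card C" "0 < card D" using fin A B C D by (auto simp: card_gt_0_iff)
  have \<theta>: "0 < \<theta>" using False pos by (simp add: \<theta>_def)
  define f where "f c = (\<Sum>b\<in>B. \<Sum>d\<in>D. \<Sum>a\<in>A. \<psi> ((b + c * d + a) mod p))" for c
  have f: "sum f Y = quad_sum A B Y D" for Y by (simp add: f_def quad_sum_def)
  obtain Z where Z: "Z \<subseteq> C" "card Z = m" "norm (quad_sum A B C D) * m \<le> norm (quad_sum A B Z D) * card C"
    using ex_subset_same_density[OF fin(3) m(1,2), of f] unfolding f by blast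
  have "norm (quad_sum A B C D) = 4 * \<theta> * (real (card A) * card B * card C * card D)"
    using pos by (simp add: \<theta>_def)
  then have "(4 * \<theta> * (real (card A) * card B * card D) * m) * card C \<le> norm (quad_sum A B Z D) * card C"
    using Z(3) by (simp add: mult_ac)
  then have "4 * \<theta> * (real (card A) * card B * card D) * m \<le> norm (quad_sum A B Z D)"
    by (rule mult_right_le_imp_le) (use pos in simp)
  moreover have "0 < \<theta> * (real (card A) * card B * card D) * m" using \<theta> pos m by simp
  then have "2 * \<theta> * (real (card A) * card B * card D) * m < 4 * \<theta> * (real (card A) * card B * card D) * m"
    by (simp add: mult_ac)
  ultimately have big: "2 * \<theta> * (real (card A) * card B * card D) * card Z < norm (quad_sum A B Z D)"
    unfolding Z(2) by linarith
  have "\<theta> ^ 141 * real (card A) ^ 57 * real (card B) ^ 27 * real (card Z) ^ 27 * real (card D) ^ 4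
    \<le> 162 * 512 ^ 11 * 8 ^ 27 * real_of_int p ^ 57"
    by (rule core_inequality[OF A B _ _ D _ \<theta> big]) (use Z C m in auto)
  moreover have "\<theta> ^ 141 * (real (card A) ^ 56 * real (card B) ^ 28 * real m ^ 27 * real (card D) ^ 4)
    \<le> \<theta> ^ 141 * real (card A) ^ 57 * real (card B) ^ 27 * real (card Z) ^ 27 * real (card D) ^ 4"
  proof -
    have "real (card A) ^ 56 * real (card B) ^ 28 = (real (card A) ^ 56 * real (card B) ^ 27) * card B"
      by (simp flip: power_Suc2)
    also have "\<dots> \<le> (real (card A) ^ 56 * real (card B) ^ 27) * card A"
      using AB by (intro mult_left_mono) auto
    also have "\<dots> = real (card A) ^ 57 * real (card B) ^ 27" using power_add[of "real (card A)" 56 1] by (simp add: mult_ac)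
    finally have "real (card A) ^ 56 * real (card B) ^ 28 \<le> real (card A) ^ 57 * real (card B) ^ 27" .
    then have "(real (card A) ^ 56 * real (card B) ^ 28) * (\<theta> ^ 141 * real m ^ 27 * real (card D) ^ 4)
      \<le> (real (card A) ^ 57 * real (card B) ^ 27) * (\<theta> ^ 141 * real m ^ 27 * real (card D) ^ 4)"
      using \<theta> by (intro mult_right_mono) auto
    then show ?thesis by (simp only: Z(2) mult_ac)
  qed
  ultimately show ?thesis by linarith
qed

text \<open>If \<open>B\<close> is the larger set, the roles of \<open>A\<close> and
  \<open>B\<close> are exchanged; moving the larger exponent to the larger set only increases the
  product.\<close>

lemma quad_sum_bound:
  assumes A: "A \<subseteq> F" "A \<noteq> {}" and B: "B \<subseteq> F" "B \<noteq> {}" and C: "C \<subseteq> F - {0}" "C \<noteq> {}"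
    and D: "D \<subseteq> F - {0}" "D \<noteq> {}" and m: "0 < m" "m \<le> card C" "int (m\<^sup>2) \<le> p"
  defines "\<theta> \<equiv> norm (quad_sum A B C D) / (4 * (real (card A) * card B * card C * card D))"
  shows "\<theta> ^ 141 * (real (card A) ^ 56 * real (card B) ^ 28 * real m ^ 27 * real (card D) ^ 4)
    \<le> 162 * 512 ^ 11 * 8 ^ 27 * real_of_int p ^ 57"
proof (cases "card B \<le> card A")
  case True
  then show ?thesis unfolding \<theta>_def by (intro quad_sum_bound_ordered assms)
next
  case False
  then have AB: "card A \<le> card B" by simp
  have \<theta>: "\<theta> = norm (quad_sum B A C D) / (4 * (real (card B) * card A * card C * card D))"
    unfolding \<theta>_def quad_sum_commute[of A] by (simp add: mult_ac)
  have \<theta>0: "0 \<le> \<theta>" by (simp add: \<theta>_def)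
  have "real (card A) ^ 56 * real (card B) ^ 28 = (real (card A) ^ 28 * real (card B) ^ 28) * real (card A) ^ 28"
    by (simp flip: power_add)
  also have "\<dots> \<le> (real (card A) ^ 28 * real (card B) ^ 28) * real (card B) ^ 28"
    using AB by (intro mult_left_mono power_mono) auto
  also have "\<dots> = real (card B) ^ 56 * real (card A) ^ 28" by (simp flip: power_add)
  finally have "real (card A) ^ 56 * real (card B) ^ 28 \<le> real (card B) ^ 56 * real (card A) ^ 28" .
  then have "\<theta> ^ 141 * (real (card A) ^ 56 * real (card B) ^ 28 * real m ^ 27 * real (card D) ^ 4)
    \<le> \<theta> ^ 141 * (real (card B) ^ 56 * real (card A) ^ 28 * real m ^ 27 * real (card D) ^ 4)"
    using \<theta>0 by (intro mult_left_mono mult_right_mono) auto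
  also have "\<dots> \<le> 162 * 512 ^ 11 * 8 ^ 27 * real_of_int p ^ 57"
    unfolding \<theta> by (intro quad_sum_bound_ordered assms AB)
  finally show ?thesis .
qed

text \<open>The terms with c = 0 or d = 0 are estimated trivially.\<close>

lemma quad_sum_remove_zero:
  assumes "finite C" "finite D" "C \<noteq> {}" "D \<noteq> {}"
  shows "norm (quad_sum A B C D) \<le> norm (quad_sum A B (C - {0}) (D - {0}))
    + real (card A) * card B * card C + real (card A) * card B * card D"
proof -
  have C: "quad_sum A B C D = quad_sum A B (C - {0}) D + quad_sum A B (C \<inter> {0}) D"
  proof -
    have "(C - {0}) \<union> (C \<inter> {0}) = C" by blast
    then show ?thesis unfolding quad_sum_def
      using sum.union_disjoint[of "C - {0}" "C \<inter> {0}" "\<lambda>c. \<Sum>b\<in>B. \<Sum>d\<in>D. \<Sum>a\<in>A. \<psi> ((b + c * d + a) mod p)"] assms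
      by auto
  qed
  have D: "quad_sum A B X D = quad_sum A B X (D - {0}) + quad_sum A B X (D \<inter> {0})" for X
  proof -
    have "(D - {0}) \<union> (D \<inter> {0}) = D" by blast
    then have "(\<Sum>d\<in>D. g d) = (\<Sum>d\<in>D - {0}. g d) + (\<Sum>d\<in>D \<inter> {0}. g d)" for g :: "int \<Rightarrow> complex"
      using sum.union_disjoint[of "D - {0}" "D \<inter> {0}" g] assms by auto
    then show ?thesis unfolding quad_sum_def by (simp only: sum.distrib)
  qed
  have one: "card (S \<inter> {0::int}) \<le> 1" for S by (rule order_trans[OF card_mono[of "{0}"]]) auto
  have "norm (quad_sum A B (C \<inter> {0}) D) \<le> real (card A) * card B * card (C \<inter> {0}) * card D"
    by (rule norm_quad_sum_le)
  also have "\<dots> \<le> real (card A) * card B * 1 * card D"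
    using one[of C] by (intro mult_right_mono mult_left_mono) auto
  finally have 1: "norm (quad_sum A B (C \<inter> {0}) D) \<le> real (card A) * card B * card D" by simp
  have "norm (quad_sum A B (C - {0}) (D \<inter> {0})) \<le> real (card A) * card B * card (C - {0}) * card (D \<inter> {0})"
    by (rule norm_quad_sum_le)
  also have "\<dots> \<le> real (card A) * card B * card C * 1"
    using one[of D] assms by (intro mult_mono card_mono) (auto intro!: card_mono)
  finally have 2: "norm (quad_sum A B (C - {0}) (D \<inter> {0})) \<le> real (card A) * card B * card C" by simp
  have "norm (quad_sum A B C D) \<le> norm (quad_sum A B (C - {0}) (D - {0}))
    + norm (quad_sum A B (C - {0}) (D \<inter> {0})) + norm (quad_sum A B (C \<inter> {0}) D)"
    unfolding C D[of "C - {0}"] by (meson add_right_mono norm_triangle_ineq order_trans)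
  then show ?thesis using 1 2 by linarith
qed

lemma quad_sum_power_saving:
  fixes \<delta> \<epsilon> :: real
  assumes A: "A \<subseteq> F" "A \<noteq> {}" and B: "B \<subseteq> F" "B \<noteq> {}" and C: "C \<subseteq> F" and D: "D \<subseteq> F"
    and \<delta>: "0 < \<delta>" and \<epsilon>: "0 < \<epsilon>"
    and cC: "real_of_int p powr \<delta> \<le> card C" and cD: "real_of_int p powr \<delta> \<le> card D"
    and large: "real_of_int p powr (57 + \<epsilon>) \<le> real (card A) ^ 56 * real (card B) ^ 28
      * min (card C) (sqrt (real_of_int p)) ^ 27 * real (card D) ^ 4"
  shows "norm (quad_sum A B C D) \<le> (4 * (2 ^ 31 * (162 * 512 ^ 11 * 8 ^ 27)) + 2)
    * (real (card A) * card B * card C * card D * real_of_int p powr (- min (\<epsilon> / 141) \<delta>))"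
proof -
  define P where "P = real_of_int p"
  define a b c d where "a = real (card A)" and "b = real (card B)" and "c = real (card C)" and "d = real (card D)"
  define K where "K = (2 ^ 31 * (162 * 512 ^ 11 * 8 ^ 27) :: real)"
  define \<tau> where "\<tau> = min (\<epsilon> / 141) \<delta>"
  have fin: "finite A" "finite B" "finite C" "finite D" using A B C D finite_F_subset by blast+
  have P1: "1 < P" using p_gt_1 by (simp add: P_def)
  have ab: "0 < a" "0 < b" using A B fin by (simp_all add: a_def b_def card_gt_0_iff)
  have Pd: "1 < P powr \<delta>" using P1 \<delta> by simp
  then have "1 < c" "1 < d" using cC cD by (simp_all add: c_def d_def P_def)
  then have cd2: "2 \<le> card C" "2 \<le> card D" by (simp_all add: c_def d_def)
  have card_minus: "card S - 1 \<le> card (S - {0::int})" for S using diff_card_le_card_Diff[of "{0}" S] by simp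
  define C' D' where "C' = C - {0}" and "D' = D - {0}"
  \<comment> \<open>Removing zero may cost \<open>C\<close> one element, and rounding down keeps m^2
    \<le> p.\<close>
  define m where "m = min (card C - 1) (nat \<lfloor>sqrt P\<rfloor>)"
  have s1: "1 \<le> sqrt P" using P1 by simp
  have fl: "real (nat \<lfloor>sqrt P\<rfloor>) = of_int \<lfloor>sqrt P\<rfloor>" using s1 by simp
  have "1 \<le> \<lfloor>sqrt P\<rfloor>" using s1 by simp
  then have m0: "0 < m" using cd2 by (simp add: m_def)
  have mC: "m \<le> card C'" using card_minus[of C] by (simp add: m_def C'_def)
  have "real m \<le> real (nat \<lfloor>sqrt P\<rfloor>)" by (simp add: m_def)
  also have "\<dots> \<le> sqrt P" using fl by simp
  finally have "real m \<le> sqrt P" .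
  then have "(real m)\<^sup>2 \<le> (sqrt P)\<^sup>2" by (rule power_mono) simp
  then have "real_of_int (int (m\<^sup>2)) \<le> real_of_int p" using P1 by (simp add: P_def)
  then have m2: "int (m\<^sup>2) \<le> p" by (simp only: of_int_le_iff)
  have "sqrt P / 2 \<le> of_int \<lfloor>sqrt P\<rfloor>" using \<open>1 \<le> \<lfloor>sqrt P\<rfloor>\<close> by linarith
  moreover have "c / 2 \<le> real (card C - 1)" using cd2 by (simp add: c_def of_nat_diff)
  ultimately have mhalf: "min c (sqrt P) / 2 \<le> m" unfolding m_def using fl by (simp add: min_def)
  have "card D - 1 \<le> card D'" using card_minus by (simp add: D'_def)
  then have dhalf: "d / 2 \<le> card D'" using cd2 by (simp add: d_def of_nat_diff)
  have C'D': "C' \<subseteq> F - {0}" "C' \<noteq> {}" "D' \<subseteq> F - {0}" "D' \<noteq> {}"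
  proof -
    show "C' \<noteq> {}" using m0 mC by auto
    show "D' \<noteq> {}" using \<open>card D - 1 \<le> card D'\<close> cd2 by auto
  qed (use C D in \<open>auto simp: C'_def D'_def\<close>)
  have pos': "0 < card C'" "0 < card D'" using C'D' finite_F_units_subset by (auto simp: card_gt_0_iff)
  define \<theta> where "\<theta> = norm (quad_sum A B C' D') / (4 * (a * b * card C' * card D'))"
  have \<theta>0: "0 \<le> \<theta>" using ab by (simp add: \<theta>_def)
  have "\<theta> ^ 141 * (a ^ 56 * b ^ 28 * real m ^ 27 * real (card D') ^ 4) \<le> 162 * 512 ^ 11 * 8 ^ 27 * P ^ 57"
    unfolding \<theta>_def a_def b_def P_def by (rule quad_sum_bound[OF A B C'D' m0 mC m2])
  moreover have "a ^ 56 * b ^ 28 * (min c (sqrt P) / 2) ^ 27 * (d / 2) ^ 4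
    \<le> a ^ 56 * b ^ 28 * real m ^ 27 * real (card D') ^ 4"
    using ab mhalf dhalf s1 by (intro mult_mono power_mono) (auto simp: c_def d_def)
  \<comment> \<open>Halving both \<open>min c (sqrt P)\<close> and \<open>d\<close> accounts for
    these losses; with exponents 27 and 4 this costs 2^31.\<close>
  moreover have "P powr (57 + \<epsilon>) / 2 ^ 31 \<le> a ^ 56 * b ^ 28 * (min c (sqrt P) / 2) ^ 27 * (d / 2) ^ 4"
    using large by (simp add: a_def b_def c_def d_def P_def power_divide)
  ultimately have "\<theta> ^ 141 * (P powr (57 + \<epsilon>) / 2 ^ 31) \<le> 162 * 512 ^ 11 * 8 ^ 27 * P ^ 57"
    using \<theta>0 by (meson mult_left_mono order_trans zero_le_power)
  then have "\<theta> ^ 141 * P powr (57 + \<epsilon>) \<le> K * P ^ 57" by (simp add: K_def)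
  also have "P powr (57 + \<epsilon>) = P ^ 57 * P powr \<epsilon>"
    using P1 by (simp add: powr_add powr_numeral)
  finally have "(\<theta> ^ 141 * P powr \<epsilon>) * P ^ 57 \<le> K * P ^ 57" by (simp add: mult_ac)
  then have "\<theta> ^ 141 * P powr \<epsilon> \<le> K" by (rule mult_right_le_imp_le) (use P1 in simp)
  then have "\<theta> ^ 141 \<le> K * P powr (- \<epsilon>)" using P1 by (simp add: powr_minus field_simps)
  \<comment> \<open>Since K \<ge> 1, the right-hand side may be made an exact 141st power.\<close>
  also have "\<dots> \<le> K ^ 141 * P powr (- \<epsilon>)"
  proof (rule mult_right_mono)
    have "1 \<le> K" by (simp add: K_def)
    then show "K \<le> K ^ 141" using power_increasing[of 1 141 K] by simp
  qed simp
  also have "\<dots> = (K * P powr (- (\<epsilon> / 141))) ^ 141"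
    using P1 by (simp add: power_mult_distrib powr_realpow[symmetric] powr_powr)
  finally have "\<theta> \<le> K * P powr (- (\<epsilon> / 141))"
    by (rule power_le_imp_le_base[of _ 140, simplified]) (simp add: K_def)
  also have "\<dots> \<le> K * P powr (- \<tau>)"
    using P1 by (intro mult_left_mono powr_mono) (auto simp: K_def \<tau>_def)
  finally have \<theta>K: "\<theta> \<le> K * P powr (- \<tau>)" .
  have "norm (quad_sum A B C' D') = 4 * \<theta> * (a * b * card C' * card D')"
    using ab pos' by (simp add: \<theta>_def)
  also have "\<dots> \<le> 4 * (K * P powr (- \<tau>)) * (a * b * c * d)"
    using \<theta>0 \<theta>K ab fin unfolding c_def d_def C'_def D'_def
    by (intro mult_mono) (auto intro!: card_mono)
  finally have main: "norm (quad_sum A B C' D') \<le> 4 * K * (a * b * c * d * P powr (- \<tau>))" by (simp add: mult_ac)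
  \<comment> \<open>The terms with a zero factor save only |C| or |D|, hence the second entry in the
    minimum \<tau>.\<close>
  have "P powr \<tau> \<le> P powr \<delta>" using P1 by (intro powr_mono) (auto simp: \<tau>_def)
  then have "P powr \<tau> \<le> c" "P powr \<tau> \<le> d" using cC cD unfolding c_def d_def P_def by linarith+
  then have "1 \<le> c * P powr (- \<tau>)" "1 \<le> d * P powr (- \<tau>)"
    using P1 by (simp_all add: powr_minus field_simps)
  then have "a * b * c * 1 \<le> a * b * c * (d * P powr (- \<tau>))" "a * b * d * 1 \<le> a * b * d * (c * P powr (- \<tau>))"
    using ab \<open>1 < c\<close> \<open>1 < d\<close> by (intro mult_left_mono; simp)+
  then have "a * b * c \<le> a * b * c * d * P powr (- \<tau>)" "a * b * d \<le> a * b * c * d * P powr (- \<tau>)"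
    by (simp_all add: mult_ac)
  moreover have "norm (quad_sum A B C D) \<le> norm (quad_sum A B C' D') + a * b * c + a * b * d"
    unfolding a_def b_def c_def d_def C'_def D'_def
    by (rule quad_sum_remove_zero) (use fin cd2 in auto)
  ultimately have "norm (quad_sum A B C D) \<le> (4 * K + 2) * (a * b * c * d * P powr (- \<tau>))"
    using main by (simp add: algebra_simps)
  then show ?thesis by (simp only: a_def b_def c_def d_def P_def K_def \<tau>_def)
qed

end

section \<open>From the residue ring to representatives, and the final exponents\<close>

lemma multiplicative_character_of_nontrivial:
  assumes p: "prime p" and chi: "nontrivial_mult_character p chi"
  shows "multiplicative_character (int p) chi"
proof -
  have "prime (int p)" using p by simp
  then have p1: "1 < int p" by (rule prime_gt_1_int)
  then interpret residues "int p" "residue_ring (int p)" by unfold_locales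
  have F: "carrier (mult_of (residue_ring (int p))) = {0..<int p} - {0}"
    by (auto simp: carrier_mult_of residue_ring_def)
  have mult: "x \<otimes>\<^bsub>mult_of (residue_ring (int p))\<^esub> y = x * y mod int p" for x y
    by (simp add: residue_ring_def)
  have hom: "chi \<in> hom (mult_of (residue_ring (int p))) complex_units"
    and zero: "chi \<zero>\<^bsub>residue_ring (int p)\<^esub> = 0"
    and nontriv: "\<exists>x\<in>carrier (mult_of (residue_ring (int p))). chi x \<noteq> 1"
    using chi by (auto simp: nontrivial_mult_character_def mult_character_def)
  show ?thesis
  proof
    show "prime (int p)" by fact
    show "chi (x * y mod int p) = chi x * chi y"
      if "x \<in> {0..<int p} - {0}" "y \<in> {0..<int p} - {0}" for x y
      using hom_mult[OF hom, of x y] that unfolding F mult by (simp add: complex_units_def)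
    show "chi 0 = 0" using zero by (simp add: zero_cong)
    show "chi x \<noteq> 0" if "x \<in> {0..<int p} - {0}" for x
      using hom_in_carrier[OF hom, of x] that unfolding F by (simp add: complex_units_def)
    show "\<exists>x\<in>{0..<int p} - {0}. chi x \<noteq> 1" using nontriv unfolding F .
  qed
qed

lemma H_sum_eq_quad_sum:
  assumes p: "prime p" and chi: "nontrivial_mult_character p chi"
  shows "H_sum p chi A B C D = multiplicative_character.quad_sum (int p) chi A B C D"
proof -
  interpret multiplicative_character "int p" chi
    using assms by (rule multiplicative_character_of_nontrivial)
  have eq: "((a + b) mod int p + c * d mod int p) mod int p = (b + c * d + a) mod int p" for a b c d
    by (simp only: mod_add_eq) (simp add: add_ac)
  have "H_sum p chi A B C D = (\<Sum>a\<in>A. \<Sum>b\<in>B. \<Sum>c\<in>C. \<Sum>d\<in>D. chi ((b + c * d + a) mod int p))"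
    unfolding H_sum_def
    by (simp add: residue_ring_def eq)
  also have "\<dots> = (\<Sum>b\<in>B. \<Sum>a\<in>A. \<Sum>c\<in>C. \<Sum>d\<in>D. chi ((b + c * d + a) mod int p))"
    by (rule sum.swap)
  also have "\<dots> = (\<Sum>b\<in>B. \<Sum>c\<in>C. \<Sum>a\<in>A. \<Sum>d\<in>D. chi ((b + c * d + a) mod int p))"
    by (rule sum.cong[OF refl], rule sum.swap)
  also have "\<dots> = (\<Sum>c\<in>C. \<Sum>b\<in>B. \<Sum>a\<in>A. \<Sum>d\<in>D. chi ((b + c * d + a) mod int p))"
    by (rule sum.swap)
  also have "\<dots> = quad_sum A B C D"
    unfolding quad_sum_def by (rule sum.cong[OF refl], rule sum.cong[OF refl], rule sum.swap)
  finally show ?thesis .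
qed

lemma H_sum_power_saving:
  fixes \<delta> \<epsilon> :: real
  assumes p: "prime p" and chi: "nontrivial_mult_character p chi"
    and sub: "A \<subseteq> carrier (residue_ring (int p))" "B \<subseteq> carrier (residue_ring (int p))"
      "C \<subseteq> carrier (residue_ring (int p))" "D \<subseteq> carrier (residue_ring (int p))"
    and ne: "A \<noteq> {}" "B \<noteq> {}" and \<delta>: "0 < \<delta>" and \<epsilon>: "0 < \<epsilon>"
    and c: "real p powr \<delta> \<le> card C" and d: "real p powr \<delta> \<le> card D"
    and large: "real p powr (57 + \<epsilon>) \<le> real (card A) ^ 56 * real (card B) ^ 28
      * min (card C) (sqrt (real p)) ^ 27 * real (card D) ^ 4"
  shows "norm (H_sum p chi A B C D) \<le> (4 * (2 ^ 31 * (162 * 512 ^ 11 * 8 ^ 27)) + 2)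
    * (real (card A) * real (card B) * real (card C) * real (card D) * real p powr (- min (\<epsilon> / 141) \<delta>))"
proof -
  interpret multiplicative_character "int p" chi
    using p chi by (rule multiplicative_character_of_nontrivial)
  have F: "carrier (residue_ring (int p)) = {0..<int p}" by (auto simp: residue_ring_def)
  show ?thesis unfolding H_sum_eq_quad_sum[OF p chi]
    using quad_sum_power_saving[of A B C D \<delta> \<epsilon>] assms unfolding F by simp
qed

theorem theorem2:
  fixes \<delta> \<epsilon> :: real
  assumes "\<delta> > 0" and "\<epsilon> > 0"
  shows
    "(\<exists>\<tau>>0. \<exists>K>0. \<forall>(p::nat) chi A B C D.
        prime p \<longrightarrow> nontrivial_mult_character p chi \<longrightarrow>
        A \<subseteq> carrier (residue_ring (int p)) \<longrightarrow> B \<subseteq> carrier (residue_ring (int p)) \<longrightarrow>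
        C \<subseteq> carrier (residue_ring (int p)) \<longrightarrow> D \<subseteq> carrier (residue_ring (int p)) \<longrightarrow>
        real (card A) > real p powr \<delta> \<longrightarrow> real (card B) > real p powr \<delta> \<longrightarrow>
        real (card C) > real p powr \<delta> \<longrightarrow> real (card D) > real p powr \<delta> \<longrightarrow>
        real (card C) < sqrt (real p) \<longrightarrow>
        real (card D) ^ 4 * real (card A) ^ 56 * real (card B) ^ 28 * real (card C) ^ 33
          \<ge> real p powr (60 + \<epsilon>) \<longrightarrow>
        norm (H_sum p chi A B C D)
          \<le> K * (real (card A) * real (card B) * real (card C) * real (card D) * real p powr (- \<tau>)))
     \<and>
     (\<exists>\<tau>>0. \<exists>K>0. \<forall>(p::nat) chi A B C D.
        prime p \<longrightarrow> nontrivial_mult_character p chi \<longrightarrow>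
        A \<subseteq> carrier (residue_ring (int p)) \<longrightarrow> B \<subseteq> carrier (residue_ring (int p)) \<longrightarrow>
        C \<subseteq> carrier (residue_ring (int p)) \<longrightarrow> D \<subseteq> carrier (residue_ring (int p)) \<longrightarrow>
        real (card A) > real p powr \<delta> \<longrightarrow> real (card B) > real p powr \<delta> \<longrightarrow>
        real (card D) > real p powr \<delta> \<longrightarrow>
        real (card C) \<ge> sqrt (real p) \<longrightarrow>
        real (card D) ^ 8 * real (card A) ^ 112 * real (card B) ^ 56
          \<ge> real p powr (87 + \<epsilon>) \<longrightarrow>
        norm (H_sum p chi A B C D)
          \<le> K * (real (card A) * real (card B) * real (card C) * real (card D) * real p powr (- \<tau>)))"
proof -
  define K where "K = (4 * (2 ^ 31 * (162 * 512 ^ 11 * 8 ^ 27)) + 2 :: real)"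
  have K: "0 < K" by (simp add: K_def)
  have ne: "S \<noteq> {}" if "real p powr \<delta> < real (card S)" for S :: "int set" and p
    using that by (metis card.empty of_nat_0 powr_ge_zero not_le)
  let ?P = "\<lambda>\<tau> p chi A B C D. norm (H_sum p chi A B C D)
    \<le> K * (real (card A) * real (card B) * real (card C) * real (card D) * real p powr (- \<tau>))"
  have part1: "?P (min (\<epsilon> / 141) \<delta>) p chi A B C D"
    if h: "prime p" "nontrivial_mult_character p chi"
      "A \<subseteq> carrier (residue_ring (int p))" "B \<subseteq> carrier (residue_ring (int p))"
      "C \<subseteq> carrier (residue_ring (int p))" "D \<subseteq> carrier (residue_ring (int p))"
      "real (card A) > real p powr \<delta>" "real (card B) > real p powr \<delta>"
      "real (card C) > real p powr \<delta>" "real (card D) > real p powr \<delta>"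
      "real (card C) < sqrt (real p)"
      "real (card D) ^ 4 * real (card A) ^ 56 * real (card B) ^ 28 * real (card C) ^ 33 \<ge> real p powr (60 + \<epsilon>)"
    for p :: nat and chi A B C D
    unfolding K_def
  proof (rule H_sum_power_saving[OF h(1-6) ne[OF h(7)] ne[OF h(8)] assms less_imp_le[OF h(9)] less_imp_le[OF h(10)]])
    have p0: "0 < real p" using h(1) prime_gt_0_nat by simp
    let ?c = "real (card C)"
    let ?M = "real (card D) ^ 4 * real (card A) ^ 56 * real (card B) ^ 28"
    \<comment> \<open>The exponent 33 is 27 + 6, and the six surplus factors account for 60 - 57 =
      3.\<close>
    have "?c ^ 6 \<le> sqrt (real p) ^ 6" using h(11) by (intro power_mono) auto
    also have "\<dots> = real p ^ 3" using power_mult[of "sqrt (real p)" 2 3] by simp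
    finally have c6: "?c ^ 6 \<le> real p ^ 3" .
    have "real p powr (60 + \<epsilon>) = real p powr ((57 + \<epsilon>) + 3)" by (simp add: add_ac)
    also have "\<dots> = real p powr (57 + \<epsilon>) * real p powr 3" by (rule powr_add)
    also have "real p powr 3 = real p ^ 3" using p0 by simp
    finally have "real p powr (57 + \<epsilon>) * real p ^ 3 = real p powr (60 + \<epsilon>)" ..
    also have "\<dots> \<le> (?M * ?c ^ 27) * ?c ^ 6" using h(12) by (simp add: mult.assoc flip: power_add)
    also have "\<dots> \<le> (?M * ?c ^ 27) * real p ^ 3" by (intro mult_left_mono c6) auto
    finally have "real p powr (57 + \<epsilon>) \<le> ?M * ?c ^ 27"
      by (rule mult_right_le_imp_le) (use p0 in simp)
    then show "real p powr (57 + \<epsilon>) \<le> real (card A) ^ 56 * real (card B) ^ 28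
      * min (card C) (sqrt (real p)) ^ 27 * real (card D) ^ 4"
      using h(11) by (simp add: mult_ac)
  qed
  \<comment> \<open>The only lower bound for |C| is now \<surd>p, hence
    \<open>min \<delta> (1 / 2)\<close> in place of \<open>\<delta>\<close>. Taking a square root of
    the hypothesis halves \<open>\<epsilon>\<close>.\<close>
  have part2: "?P (min ((\<epsilon> / 2) / 141) (min \<delta> (1 / 2))) p chi A B C D"
    if h: "prime p" "nontrivial_mult_character p chi"
      "A \<subseteq> carrier (residue_ring (int p))" "B \<subseteq> carrier (residue_ring (int p))"
      "C \<subseteq> carrier (residue_ring (int p))" "D \<subseteq> carrier (residue_ring (int p))"
      "real (card A) > real p powr \<delta>" "real (card B) > real p powr \<delta>"
      "real (card D) > real p powr \<delta>" "real (card C) \<ge> sqrt (real p)"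
      "real (card D) ^ 8 * real (card A) ^ 112 * real (card B) ^ 56 \<ge> real p powr (87 + \<epsilon>)"
    for p :: nat and chi A B C D
    unfolding K_def
  proof (rule H_sum_power_saving[OF h(1-6) ne[OF h(7)] ne[OF h(8)]])
    have p1: "1 < real p" using h(1) prime_gt_1_nat by simp
    have sqrt: "sqrt (real p) = real p powr (1 / 2)" using p1 by (simp add: powr_half_sqrt)
    let ?M = "real (card D) ^ 4 * real (card A) ^ 56 * real (card B) ^ 28"
    show "0 < min \<delta> (1 / 2)" "0 < \<epsilon> / 2" using assms by auto
    have "real p powr (min \<delta> (1 / 2)) \<le> real p powr (1 / 2)" using p1 by (intro powr_mono) auto
    then show "real p powr (min \<delta> (1 / 2)) \<le> card C" using h(10) sqrt by simp
    have "real p powr (min \<delta> (1 / 2)) \<le> real p powr \<delta>" using p1 by (intro powr_mono) auto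
    then show "real p powr (min \<delta> (1 / 2)) \<le> card D" using h(9) by simp
    \<comment> \<open>The hypothesis bounds the square of \<open>?M\<close>. The minimum of |C| and
      \<surd>p is \<surd>p, whose 27th power supplies the rest: 87/2 + 27/2 = 57.\<close>
    have "(real p powr ((87 + \<epsilon>) / 2))\<^sup>2 = real p powr (87 + \<epsilon>)"
      by (simp only: power2_eq_square powr_add[symmetric] field_sum_of_halves)
    also have "\<dots> \<le> ?M\<^sup>2" using h(11) by (simp add: power_mult_distrib flip: power_mult)
    finally have "real p powr ((87 + \<epsilon>) / 2) \<le> ?M" by (rule power2_le_imp_le) simp
    then have "real p powr ((87 + \<epsilon>) / 2) * sqrt (real p) ^ 27 \<le> ?M * sqrt (real p) ^ 27"
      by (rule mult_right_mono) simp
    moreover have "real p powr ((87 + \<epsilon>) / 2) * sqrt (real p) ^ 27 = real p powr (57 + \<epsilon> / 2)"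
    proof -
      have "sqrt (real p) ^ 27 = real p powr (27 / 2)"
        using p1 by (simp add: sqrt powr_power)
      then have "real p powr ((87 + \<epsilon>) / 2) * sqrt (real p) ^ 27 = real p powr ((87 + \<epsilon>) / 2 + 27 / 2)"
        by (simp only: powr_add)
      also have "(87 + \<epsilon>) / 2 + 27 / 2 = 57 + \<epsilon> / 2" by (simp add: field_simps)
      finally show ?thesis .
    qed
    ultimately show "real p powr (57 + \<epsilon> / 2) \<le> real (card A) ^ 56 * real (card B) ^ 28
      * min (card C) (sqrt (real p)) ^ 27 * real (card D) ^ 4"
      using h(10) by (simp add: mult_ac min_absorb2)
  qed
  have \<tau>: "0 < min (\<epsilon> / 141) \<delta>" "0 < min ((\<epsilon> / 2) / 141) (min \<delta> (1 / 2))" using assms by auto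
  show ?thesis
    apply (rule conjI)
    subgoal
      by (rule exI[of _ "min (\<epsilon> / 141) \<delta>"], rule conjI[OF \<tau>(1)], rule exI[of _ K], rule conjI[OF K],
          intro allI impI, rule part1)
    subgoal
      by (rule exI[of _ "min ((\<epsilon> / 2) / 141) (min \<delta> (1 / 2))"], rule conjI[OF \<tau>(2)], rule exI[of _ K], rule conjI[OF K],
          intro allI impI, rule part2)
    done
qed

end
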